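(* Let $T>0$, let $\mathcal K\subset\mathbb R^d$ be compact, let $b>\operatorname{diam}(\mathcal K)+1$, and let $f,g$ satisfy the standing assumptions (i)–(iv) of the context. Given $c>0$, there exists a constant $\widehat C>0$ determined by the functions $f$, $g$ and the constant $c$ (with $T,b,\mathcal K$ fixed; independent of $\varepsilon,\mathcal S,Q,m_0,\beta_0$) such that the following holds. Let $\varepsilon\in(0,1]$, let $\mathcal S\subset\mathbb R^d$ be a finite set with $\operatorname{diam}(\mathcal K\cup\mathcal S)\le\operatorname{diam}(\mathcal K)+1$, and for $t\in[0,T]$, $\beta\in\ell_1^+(\mathcal S)$ let $Q(t,\beta)=(Q_{x,y}(t,\beta))_{x,y\in\mathcal S}$ be a Kolmogorov matrix such that: (QS1) $\min_{y\in\mathcal S}\|x-y\|\le\varepsilon$ for each $x\in\mathcal K$; (QS2) $\big\|f(t,x,\mathscr I(\beta))-\sum_{y\in\mathcal S}(y-x)Q_{x,y}(t,\beta)\big\|\le\varepsilon$ for all $t\in[0,T]$, $x\in\mathcal S$, $\beta\in\ell_1^+(\mathcal S)$; (QS3) $\sum_{y\in\mathcal S}\|x-y\|^2Q_{x,y}(t,\beta)\le\varepsilon^2$ for all $t\in[0,T]$, $x\in\mathcal S$, $\beta\in\ell_1^+(\mathcal S)$. If - $\beta_0\in\ell_1^+(\mathcal S)$, $\|\beta_0\|\le c$; - $m_0\in\mathcal M(\mathcal K)$, $\|m_0\|\le c$; - $\beta(\cdot):[0,T]\to\ell_1^+(\mathcal S)$ solves $\frac{d}{dt}\beta(t)=\beta(t)Q(t,\beta(t))+\beta(t)G(t,\beta(t))$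 with $\beta(0)=\beta_0$; - $m(\cdot):[0,T]\to\mathcal M(\mathcal K)$ is a weak solution of $\partial_tm(t)+\operatorname{div}(f(t,x,m(t))m(t))=g(t,x,m(t))m(t)$ with $m(0)=m_0$, then for all $t\in[0,T]$ $$\mathcal W_{1,b}(m(t),\mathscr I(\beta(t)))\le\widehat C\big(\varepsilon+\mathcal W_{1,b}(m_0,\mathscr I(\beta_0))\big).$$
   Context: $\mathcal M(X)$: finite nonnegative Borel measures on $X$; $\|m\|:=m(X)$; measures on $\mathcal K$ or $\mathcal S$ are regarded as measures on $\mathbb R^d$. PRW-distance: for $m_1,m_2\in\mathcal M(\mathbb R^d)$, $$\mathcal W_{1,b}(m_1,m_2):=\inf\Big\{b\|m_1-\widehat m_1\|+b\|m_2-\widehat m_2\|+\int\|x_1-x_2\|\,\varpi(d(x_1,x_2))\Big\},$$ over $\widehat m_1\le m_1$, $\widehat m_2\le m_2$ with $\|\widehat m_1\|=\|\widehat m_2\|$ and measures $\varpi$ on $\mathbb R^d\times\mathbb R^d$ with marginals $\widehat m_1,\widehat m_2$. Standing assumptions on $f:[0,T]\times\mathbb R^d\times\mathcal M(\mathbb R^d)\to\mathbb R^d$ and $g:[0,T]\times\mathbb R^d\times\mathcal M(\mathbb R^d)\to\mathbb R$: (i) $f,g$ are continuous ($\mathcal M(\mathbb R^d)$ carries $\mathcal W_{1,b}$); (ii) $\|f(t,x_1,m_1)-f(t,x_2,m_2)\|\le C_{Lf}(\|x_1-x_2\|+\mathcal W_{1,b}(m_1,m_2))$, and similarly for $g$ with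 constant $C_{Lg}$; (iii) $\|f\|\le C_f$, $|g|\le C_g$ everywhere; (iv) $f(t,x,m)=0$ for every $t\in[0,T]$, $x\in\mathbb R^d\setminus\mathcal K$, $m\in\mathcal M(\mathcal K)$. $\ell_1^+(\mathcal S)$ is the set of row-vectors $\beta=(\beta_x)_{x\in\mathcal S}$ with nonnegative entries, with norm $\|\beta\|=\sum_{x\in\mathcal S}|\beta_x|$; $\mathscr I(\beta):=\sum_{x\in\mathcal S}\beta_x\delta_x$. A Kolmogorov matrix is a square matrix with nonnegative off-diagonal entries and zero row sums. $G(t,\beta)$ is the diagonal matrix indexed by $\mathcal S$ with entries $G_{x,x}(t,\beta)=g(t,x,\mathscr I(\beta))$. Weak solution: a continuous map $m(\cdot)$ from $[0,T]$ into measures (metric $\mathcal W_{1,b}$) such that for all $\phi\in C_c^1([0,T]\times\mathbb R^d)$, $s\in[0,T]$, $$\int\phi(s,x)m(s,dx)-\int\phi(0,x)m_0(dx)=\int_0^s\!\!\int\big[\partial_t\phi(t,x)+\langle\nabla\phi(t,x),f(t,x,m(t))\rangle+\phi(t,x)g(t,x,m(t))\big]m(t,dx)\,dt.$$ *)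

theory Defs
  imports "HOL-Analysis.Analysis"
begin

text \<open>\<open>\<M> X\<close>: finite Borel measures on \<open>X\<close>, regarded as Borel measures on the whole space that do not
  charge the complement of \<open>X\<close>. It is only used for Borel sets \<open>X\<close>.\<close>

definition fin_measures :: "'a::euclidean_space set \<Rightarrow> 'a measure set" (\<open>\<M>\<close>) where
  "\<M> X = {m. sets m = sets borel \<and> finite_measure m \<and> emeasure m (UNIV - X) = 0}"

text \<open>Admissible triples \<open>(n1, n2, w)\<close> in the distance \<open>PRW\<close>: submeasures of \<open>m1\<close>, \<open>m2\<close> of equal mass
  and a coupling of them.\<close>

definition partial_plans ::
  "'a::euclidean_space measure \<Rightarrow> 'a measure \<Rightarrow> ('a measure \<times> 'a measure \<times> ('a \<times> 'a) measure) set" where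
  "partial_plans m1 m2 = {(n1, n2, w).
     n1 \<in> \<M> UNIV \<and> n2 \<in> \<M> UNIV \<and> n1 \<le> m1 \<and> n2 \<le> m2 \<and> measure n1 UNIV = measure n2 UNIV \<and>
     sets w = sets borel \<and> distr w borel fst = n1 \<and> distr w borel snd = n2}"

text \<open>The infimum is taken in \<^typ>\<open>ennreal\<close> because the transport cost of a plan may be infinite. It is
  itself finite for finite measures (take the zero submeasures), so \<^const>\<open>enn2real\<close> loses nothing.\<close>

definition PRW :: "real \<Rightarrow> 'a::euclidean_space measure \<Rightarrow> 'a measure \<Rightarrow> real" where
  "PRW b m1 m2 = enn2real (INF (n1, n2, w) \<in> partial_plans m1 m2.
     ennreal b * emeasure (diff_measure m1 n1) UNIV + ennreal b * emeasure (diff_measure m2 n2) UNIV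
     + (\<integral>\<^sup>+ z. ennreal (norm (fst z - snd z)) \<partial>w))"

text \<open>Joint continuity on \<open>[0,T] \<times> \<real>\<^sup>d \<times> \<M>(\<real>\<^sup>d)\<close>, the last factor carrying the distance \<open>PRW b\<close>.\<close>

definition PRW_continuous ::
  "real \<Rightarrow> real \<Rightarrow> (real \<Rightarrow> 'a::euclidean_space \<Rightarrow> 'a measure \<Rightarrow> 'b::real_normed_vector) \<Rightarrow> bool" where
  "PRW_continuous T b h \<longleftrightarrow>
    (\<forall>t\<in>{0..T}. \<forall>x. \<forall>m\<in>\<M> UNIV. \<forall>e>0. \<exists>\<delta>>0.
       \<forall>s\<in>{0..T}. \<forall>y. \<forall>n\<in>\<M> UNIV.
         \<bar>s - t\<bar> < \<delta> \<and> norm (y - x) < \<delta> \<and> PRW b n m < \<delta> \<longrightarrow> norm (h s y n - h t x m) < e)"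

definition PRW_lipschitz ::
  "real \<Rightarrow> real \<Rightarrow> real \<Rightarrow> (real \<Rightarrow> 'a::euclidean_space \<Rightarrow> 'a measure \<Rightarrow> 'b::real_normed_vector) \<Rightarrow> bool" where
  "PRW_lipschitz T b L h \<longleftrightarrow>
    (\<forall>t\<in>{0..T}. \<forall>x1 x2. \<forall>m1\<in>\<M> UNIV. \<forall>m2\<in>\<M> UNIV.
       norm (h t x1 m1 - h t x2 m2) \<le> L * (norm (x1 - x2) + PRW b m1 m2))"

definition standing_assumptions ::
  "real \<Rightarrow> real \<Rightarrow> 'a::euclidean_space set \<Rightarrow> (real \<Rightarrow> 'a \<Rightarrow> 'a measure \<Rightarrow> 'a)
     \<Rightarrow> (real \<Rightarrow> 'a \<Rightarrow> 'a measure \<Rightarrow> real) \<Rightarrow> bool" where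
  "standing_assumptions T b K f g \<longleftrightarrow>
     PRW_continuous T b f \<and> PRW_continuous T b g \<and>
     (\<exists>CLf. PRW_lipschitz T b CLf f) \<and> (\<exists>CLg. PRW_lipschitz T b CLg g) \<and>
     (\<exists>Cf. \<forall>t\<in>{0..T}. \<forall>x. \<forall>m\<in>\<M> UNIV. norm (f t x m) \<le> Cf) \<and>
     (\<exists>Cg. \<forall>t\<in>{0..T}. \<forall>x. \<forall>m\<in>\<M> UNIV. \<bar>g t x m\<bar> \<le> Cg) \<and>
     (\<forall>t\<in>{0..T}. \<forall>x. \<forall>m\<in>\<M> K. x \<notin> K \<longrightarrow> f t x m = 0)"

text \<open>Vectors indexed by \<open>S\<close> are represented by functions vanishing outside \<open>S\<close>, which makes the
  representation unique.\<close>

definition l1_plus :: "'a set \<Rightarrow> ('a \<Rightarrow> real) set" where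
  "l1_plus S = {\<beta>. (\<forall>x\<in>S. 0 \<le> \<beta> x) \<and> (\<forall>x. x \<notin> S \<longrightarrow> \<beta> x = 0)}"

definition l1_norm :: "'a set \<Rightarrow> ('a \<Rightarrow> real) \<Rightarrow> real" where
  "l1_norm S \<beta> = (\<Sum>x\<in>S. \<bar>\<beta> x\<bar>)"

text \<open>The measure \<open>\<Sum>x\<in>S. \<beta> x \<cdot> \<delta>\<^sub>x\<close>; see \<open>emeasure_atomic\<close> below.\<close>

definition atomic :: "'a::euclidean_space set \<Rightarrow> ('a \<Rightarrow> real) \<Rightarrow> 'a measure" (\<open>\<I>\<close>) where
  "\<I> S \<beta> = distr (point_measure S (\<lambda>x. ennreal (\<beta> x))) borel (\<lambda>x. x)"

lemma sets_atomic [simp]: "sets (\<I> S \<beta>) = sets borel"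
  by (simp add: atomic_def)

lemma emeasure_atomic:
  assumes "finite S" "A \<in> sets borel"
  shows "emeasure (\<I> S \<beta>) A = (\<Sum>x\<in>S. ennreal (\<beta> x) * indicator A x)"
proof -
  have "emeasure (\<I> S \<beta>) A = emeasure (point_measure S (\<lambda>x. ennreal (\<beta> x))) (A \<inter> S)"
    using assms by (simp add: atomic_def emeasure_distr space_point_measure)
  also have "\<dots> = (\<Sum>x\<in>A \<inter> S. ennreal (\<beta> x))"
    using assms by (subst emeasure_point_measure_finite) auto
  also have "\<dots> = (\<Sum>x\<in>S. ennreal (\<beta> x) * indicator A x)"
    using assms(1) by (intro sum.mono_neutral_cong_left) (auto simp: indicator_def)
  finally show ?thesis .
qed

lemma atomic_in_fin_measures:
  assumes "finite S"
  shows "\<I> S \<beta> \<in> \<M> S"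
proof -
  have "S \<in> sets borel"
    using assms by (simp add: borel_closed finite_imp_closed)
  then show ?thesis
    using assms
    by (auto simp: fin_measures_def emeasure_atomic atomic_def[of S \<beta>, THEN arg_cong[where f=space]]
        sum_eq_0_iff ennreal_mult_eq_top_iff less_top intro!: finite_measureI)
qed

definition kolmogorov_matrix :: "'a set \<Rightarrow> ('a \<Rightarrow> 'a \<Rightarrow> real) \<Rightarrow> bool" where
  "kolmogorov_matrix S A \<longleftrightarrow>
     (\<forall>x\<in>S. \<forall>y\<in>S. x \<noteq> y \<longrightarrow> 0 \<le> A x y) \<and> (\<forall>x\<in>S. (\<Sum>y\<in>S. A x y) = 0)"

definition row_mult :: "'a set \<Rightarrow> ('a \<Rightarrow> real) \<Rightarrow> ('a \<Rightarrow> 'a \<Rightarrow> real) \<Rightarrow> 'a \<Rightarrow> real" where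
  "row_mult S \<beta> A y = (\<Sum>x\<in>S. \<beta> x * A x y)"

definition G_matrix ::
  "'a::euclidean_space set \<Rightarrow> (real \<Rightarrow> 'a \<Rightarrow> 'a measure \<Rightarrow> real) \<Rightarrow> real \<Rightarrow> ('a \<Rightarrow> real) \<Rightarrow> 'a \<Rightarrow> 'a \<Rightarrow> real" where
  "G_matrix S g t \<beta> x y = (if x = y then g t x (\<I> S \<beta>) else 0)"

text \<open>Classical solutions; the derivative is one-sided at the end points of \<open>[0,T]\<close>.\<close>

definition ode_solution ::
  "real \<Rightarrow> 'a::euclidean_space set \<Rightarrow> (real \<Rightarrow> ('a \<Rightarrow> real) \<Rightarrow> 'a \<Rightarrow> 'a \<Rightarrow> real)
     \<Rightarrow> (real \<Rightarrow> 'a \<Rightarrow> 'a measure \<Rightarrow> real) \<Rightarrow> (real \<Rightarrow> 'a \<Rightarrow> real) \<Rightarrow> bool" where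
  "ode_solution T S Q g \<beta> \<longleftrightarrow>
     (\<forall>t\<in>{0..T}. \<beta> t \<in> l1_plus S) \<and>
     (\<forall>t\<in>{0..T}. \<forall>y\<in>S.
        ((\<lambda>s. \<beta> s y) has_real_derivative
           (row_mult S (\<beta> t) (Q t (\<beta> t)) y + row_mult S (\<beta> t) (G_matrix S g t (\<beta> t)) y))
        (at t within {0..T}))"

text \<open>\<open>test_function T \<phi> \<phi>t \<phi>x\<close>: \<open>\<phi> \<in> C\<^sub>c\<^sup>1([0,T] \<times> \<real>\<^sup>d)\<close>, with time derivative \<open>\<phi>t\<close> and spatial
  gradient \<open>\<phi>x\<close> (for \<open>T > 0\<close> these are determined by \<open>\<phi>\<close> on \<open>[0,T] \<times> \<real>\<^sup>d\<close>). Nothing is required at the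
  end points \<open>t = 0\<close>, \<open>t = T\<close> beyond one-sided differentiability.\<close>

definition test_function ::
  "real \<Rightarrow> (real \<times> 'a::euclidean_space \<Rightarrow> real) \<Rightarrow> (real \<times> 'a \<Rightarrow> real) \<Rightarrow> (real \<times> 'a \<Rightarrow> 'a) \<Rightarrow> bool" where
  "test_function T \<phi> \<phi>t \<phi>x \<longleftrightarrow>
     (\<forall>z\<in>{0..T} \<times> UNIV.
        (\<phi> has_derivative (\<lambda>(h, v). h * \<phi>t z + \<phi>x z \<bullet> v)) (at z within {0..T} \<times> UNIV)) \<and>
     continuous_on ({0..T} \<times> UNIV) \<phi>t \<and> continuous_on ({0..T} \<times> UNIV) \<phi>x \<and>
     compact (closure {z \<in> {0..T} \<times> UNIV. \<phi> z \<noteq> 0})"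

definition weak_solution ::
  "real \<Rightarrow> real \<Rightarrow> (real \<Rightarrow> 'a::euclidean_space \<Rightarrow> 'a measure \<Rightarrow> 'a) \<Rightarrow> (real \<Rightarrow> 'a \<Rightarrow> 'a measure \<Rightarrow> real)
     \<Rightarrow> 'a measure \<Rightarrow> (real \<Rightarrow> 'a measure) \<Rightarrow> bool" where
  "weak_solution T b f g m0 m \<longleftrightarrow>
     (\<forall>t\<in>{0..T}. m t \<in> \<M> UNIV) \<and>
     (\<forall>t\<in>{0..T}. ((\<lambda>s. PRW b (m s) (m t)) \<longlongrightarrow> 0) (at t within {0..T})) \<and>
     (\<forall>\<phi> \<phi>t \<phi>x. test_function T \<phi> \<phi>t \<phi>x \<longrightarrow>
        (\<forall>s\<in>{0..T}.
          ((\<lambda>t. \<integral>x. \<phi>t (t, x) + \<phi>x (t, x) \<bullet> f t x (m t) + \<phi> (t, x) * g t x (m t) \<partial>m t)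
            has_integral ((\<integral>x. \<phi> (s, x) \<partial>m s) - (\<integral>x. \<phi> (0, x) \<partial>m0))) {0..s}))"

end

theory Submission
  imports Defs
begin

text \<open>
  The distance \<open>PRW\<close> has a dual description: on a compact set it is, up to an arbitrarily small error,
  the supremum of \<open>\<integral>\<phi> dm - \<integral>\<phi> dn\<close> over the 1-Lipschitz functions \<open>\<phi>\<close> with \<open>\<bar>\<phi>\<bar> \<le> b\<close>
  (\<open>integral_diff_le_PRW\<close> for one direction, \<open>PRW_dual_potential\<close> for the other). So the two evolutions
  are compared by testing them against such functions.

  Write \<open>n(t)\<close> for the atomic measure carried by the chain. For a fixed \<open>\<phi>\<close> with gradient \<open>p\<close>, the
  integral of \<open>\<phi>\<close> against \<open>m(t)\<close> grows at the rate \<open>\<integral>(p \<bullet> f + \<phi> g) dm\<close>, by the weak equation. Against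
  \<open>n(t)\<close> the same rate appears with an error: the generator sees
  \<open>\<Sum>y. Q x y (\<phi> y - \<phi> x)\<close>, which the condition on the drift and the condition on the second moment
  turn into \<open>p x \<bullet> f\<close> up to \<open>\<epsilon> + A \<epsilon>\<^sup>2\<close>, where \<open>A\<close> bounds the quadratic remainder of \<open>\<phi>\<close>. This error is of
  order \<open>\<epsilon>\<close> as long as \<open>A\<close> is of order \<open>1/\<epsilon>\<close>, and functions of that kind approximate every
  1-Lipschitz function up to \<open>\<epsilon>\<close>: mollify at scale \<open>\<epsilon>\<close>. Hence the natural quantity is the
  discrepancy \<open>D(t)\<close>, the supremum of \<open>\<integral>\<phi> dm(t) - \<integral>\<phi> dn(t)\<close> over the class \<open>potential b A\<close> of
  \<open>b\<close>-bounded 1-Lipschitz functions with quadratic remainder \<open>A = \<kappa>/\<epsilon>\<close>. It satisfies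
  \<open>D \<le> PRW \<le> D + O(\<epsilon>)\<close> (\<open>discrepancy_le_PRW\<close>, \<open>PRW_le_discrepancy\<close>).

  What makes \<open>D\<close> evolve is that the class is almost invariant under one backward step of the dynamics.
  If \<open>F\<close> and \<open>\<gamma>\<close> are the coefficients frozen at time \<open>t\<close> and at the measure \<open>m(t)\<close>, mollified at the
  same scale \<open>\<epsilon>\<close>, then \<open>\<psi> x = \<phi> (x + h F x) (1 + h \<gamma> x)\<close> lies in \<open>1 + C h\<close> times the class, with
  \<open>C\<close> independent of \<open>\<epsilon>\<close> (\<open>potential_transport\<close>), and \<open>\<psi> = \<phi> + h (p \<bullet> F + \<phi> \<gamma>) + O(h\<^sup>2)\<close>. Therefore
  \<open>\<integral>\<phi> d(m - n)\<close> at time \<open>t + h\<close> is at most \<open>\<integral>\<psi> d(m - n)\<close> at time \<open>t\<close> plus \<open>h\<close> times the errors from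
  mollification, from the generator and from evaluating the coefficients of the chain at \<open>n(t)\<close> instead
  of \<open>m(t)\<close>; the last one is a multiple of \<open>PRW (m t) (n t)\<close>. This gives
  \<open>D(t + h) \<le> (1 + C h) D(t) + C h (\<epsilon> + D(t)) + o(h)\<close> (\<open>discrepancy_step\<close>). The term \<open>o(h)\<close> may depend
  on \<open>\<epsilon>\<close>, because \<open>h\<close> tends to \<open>0\<close> with \<open>\<epsilon>\<close> fixed; a Gronwall inequality for upper right derivatives
  (\<open>dini_gronwall\<close>) then bounds \<open>D\<close> on \<open>[0,T]\<close> by a constant times \<open>\<epsilon> + D(0)\<close>.

  The measures stay bounded by \<open>c exp (Cg T)\<close> (\<open>weak_solution_mass\<close>, \<open>ode_solution_mass\<close>), which makes
  all constants depend only on \<open>c\<close>, \<open>T\<close>, \<open>b\<close>, the coefficients and the dimension.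
\<close>

section \<open>Integrals of Lipschitz functions and the distance\<close>

lemma nn_integral_split_measure:
  assumes [measurable_cong, simp]: "sets N = sets M" "sets D = sets M"
    and split: "\<And>A. A \<in> sets M \<Longrightarrow> emeasure M A = emeasure N A + emeasure D A"
    and u: "u \<in> borel_measurable M"
  shows "(\<integral>\<^sup>+x. u x \<partial>M) = (\<integral>\<^sup>+x. u x \<partial>N) + (\<integral>\<^sup>+x. u x \<partial>D)"
  using u
proof (induction rule: borel_measurable_induct)
  case (cong f g)
  have [simp]: "space N = space M" "space D = space M"
    by (rule sets_eq_imp_space_eq[OF assms(1)], rule sets_eq_imp_space_eq[OF assms(2)])
  from cong show ?case
    by (simp cong: nn_integral_cong_simp)
next
  case (set A)
  then show ?case by (simp add: split)
next
  case (mult u c)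
  then show ?case by (simp add: nn_integral_cmult distrib_left)
next
  case (add u v)
  then show ?case by (simp add: nn_integral_add ac_simps)
next
  case (seq U)
  have *: "incseq (\<lambda>i. \<integral>\<^sup>+x. U i x \<partial>R)" for R
    using seq(3) by (auto simp: incseq_def le_fun_def intro!: nn_integral_mono)
  have eq: "(\<integral>\<^sup>+x. (SUP i. U i) x \<partial>R) = (SUP i. \<integral>\<^sup>+x. U i x \<partial>R)"
    if "sets R = sets M" for R
    using seq(1,3) that unfolding SUP_apply
    by (intro nn_integral_monotone_convergence_SUP) (auto cong: measurable_cong_sets)
  show ?case
    unfolding seq(4) eq[OF refl] eq[OF assms(1)] eq[OF assms(2)]
    by (simp add: seq.IH ennreal_SUP_add *)
qed

lemma fin_measuresD:
  assumes "m \<in> \<M> X"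
  shows "sets m = sets borel" "finite_measure m" "space m = UNIV" "emeasure m (UNIV - X) = 0"
  using assms sets_eq_imp_space_eq[of m borel] by (auto simp: fin_measures_def)

lemma fin_measures_UNIV: "m \<in> \<M> X \<Longrightarrow> m \<in> \<M> UNIV"
  by (auto simp: fin_measures_def)

lemma fin_measures_mono:
  assumes "m \<in> \<M> X" "X \<subseteq> Y" "X \<in> sets borel" shows "m \<in> \<M> Y"
proof -
  have "emeasure m (UNIV - Y) \<le> emeasure m (UNIV - X)"
    using assms fin_measuresD(1)[OF assms(1)] by (intro emeasure_mono) auto
  then show ?thesis using assms(1) by (simp add: fin_measures_def)
qed

lemma AE_support:
  assumes "m \<in> \<M> X" "compact X" shows "AE x in m. x \<in> X"
proof (rule AE_I[of _ _ "UNIV - X"])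
  show "UNIV - X \<in> sets m" using fin_measuresD(1)[OF assms(1)] assms(2) by (auto simp: compact_imp_closed)
qed (use fin_measuresD[OF assms(1)] in auto)

lemma fin_measures_integrable:
  fixes h :: "'a::euclidean_space \<Rightarrow> real"
  assumes "m \<in> \<M> UNIV" "h \<in> borel_measurable borel" "\<And>x. \<bar>h x\<bar> \<le> B"
  shows "integrable m h"
proof -
  interpret finite_measure m using fin_measuresD(2)[OF assms(1)] .
  have "h \<in> borel_measurable m" using assms(2) fin_measuresD(1)[OF assms(1)]
    by (simp cong: measurable_cong_sets)
  then show ?thesis using assms(3) by (intro integrable_const_bound[of _ B]) auto
qed

lemma abs_integral_le_mass:
  fixes h :: "'a::euclidean_space \<Rightarrow> real"
  assumes m: "m \<in> \<M> X" and X: "compact X" and h: "h \<in> borel_measurable borel" "\<And>x. x \<in> X \<Longrightarrow> \<bar>h x\<bar> \<le> B" and B: "B \<ge> 0"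
  shows "\<bar>\<integral>x. h x \<partial>m\<bar> \<le> B * measure m UNIV"
proof -
  note D = fin_measuresD[OF m]
  interpret finite_measure m by (rule D(2))
  have AE: "AE x in m. \<bar>h x\<bar> \<le> B" using AE_support[OF m X] by eventually_elim (use h in auto)
  have hm: "h \<in> borel_measurable m" unfolding measurable_cong_sets[OF D(1) refl] by (rule h)
  have "integrable m h" using AE hm by (intro integrable_const_bound[of _ B]) auto
  then have "(\<integral>x. \<bar>h x\<bar> \<partial>m) \<le> (\<integral>x. B \<partial>m)" using AE by (intro integral_mono_AE) auto
  then show ?thesis using order_trans[OF integral_abs_bound[of m h]] D(3) by (simp add: mult.commute)
qed

lemma lipschitz_borel:
  fixes h :: "'a::euclidean_space \<Rightarrow> 'b::euclidean_space"
  assumes "\<And>x y. norm (h x - h y) \<le> L * norm (x - y)"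
  shows "h \<in> borel_measurable borel"
proof -
  have "norm (h x - h y) \<le> \<bar>L\<bar> * norm (x - y)" for x y
    using assms[of x y] mult_right_mono[OF abs_ge_self[of L], of "norm (x-y)"] by simp
  then have "\<bar>L\<bar>-lipschitz_on UNIV h"
    by (auto simp: lipschitz_on_def dist_norm)
  then show ?thesis
    by (intro borel_measurable_continuous_onI lipschitz_on_continuous_on)
qed

text \<open>The easy half of Kantorovich duality. The mass left out by the plan is charged \<open>b \<ge> \<bar>\<phi>\<bar>\<close> per unit, and
the transported mass changes \<open>\<integral>\<phi>\<close> by at most the distance travelled. Adding the constant \<open>b\<close> to \<open>\<phi>\<close>
reduces the splitting \<open>m = n + (m - n)\<close> to nonnegative integrands.\<close>

lemma partial_plan_bound:
  fixes m1 m2 :: "'a::euclidean_space measure"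
  assumes m: "m1 \<in> \<M> UNIV" "m2 \<in> \<M> UNIV" and w: "(n1, n2, w) \<in> partial_plans m1 m2"
    and lip: "\<And>x y. \<bar>\<phi> x - \<phi> y\<bar> \<le> norm (x - y)" and bd: "\<And>x. \<bar>\<phi> x\<bar> \<le> b"
  shows "ennreal ((\<integral>x. \<phi> x \<partial>m1) - (\<integral>x. \<phi> x \<partial>m2)) \<le>
     ennreal b * emeasure (diff_measure m1 n1) UNIV + ennreal b * emeasure (diff_measure m2 n2) UNIV
     + (\<integral>\<^sup>+ z. ennreal (norm (fst z - snd z)) \<partial>w)" (is "_ \<le> ?R")
proof (cases "(\<integral>\<^sup>+ z. ennreal (norm (fst z - snd z)) \<partial>w) = \<infinity>")
  case True then show ?thesis by simp
next
  case False
  have b: "b \<ge> 0" using bd[of 0] by linarith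
  have \<phi>: "\<phi> \<in> borel_measurable borel" using lip by (intro lipschitz_borel[of _ 1]) auto
  have n: "n1 \<in> \<M> UNIV" "n2 \<in> \<M> UNIV" "n1 \<le> m1" "n2 \<le> m2" "sets w = sets borel"
      "distr w borel fst = n1" "distr w borel snd = n2"
    using w by (auto simp: partial_plans_def)
  have wfs: "fst \<in> measurable w borel" "snd \<in> measurable w borel"
    unfolding measurable_cong_sets[OF n(5) refl] by (intro borel_measurable_continuous_onI continuous_intros)+
  have spw: "space w = UNIV" using n(5) sets_eq_imp_space_eq by fastforce
  interpret w: finite_measure w
    proof (rule finite_measureI)
      have "emeasure n1 UNIV = emeasure w (space w)"
        using n(6) wfs by (simp add: emeasure_distr spw flip: n(6))
      moreover have "emeasure n1 UNIV \<noteq> \<infinity>" using finite_measure.emeasure_finite[OF fin_measuresD(2)[OF n(1)]] by auto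
      ultimately show "emeasure w (space w) \<noteq> \<infinity>" by simp
    qed
  \<comment> \<open>the mass that a submeasure leaves out contributes at most \<open>b\<close> per unit\<close>
  have diff: "(\<integral>x. \<phi> x \<partial>m) = (\<integral>x. \<phi> x \<partial>n) + (\<integral>x. \<phi> x \<partial>(diff_measure m n))
      \<and> \<bar>\<integral>x. \<phi> x \<partial>(diff_measure m n)\<bar> \<le> b * measure (diff_measure m n) UNIV
      \<and> emeasure (diff_measure m n) UNIV = ennreal (measure (diff_measure m n) UNIV)"
    if m: "m \<in> \<M> UNIV" and n: "n \<in> \<M> UNIV" and le: "n \<le> m" for m n :: "'a measure"
  proof -
    interpret M: finite_measure m using fin_measuresD[OF m] by simp
    interpret N: finite_measure n using fin_measuresD[OF n] by simp
    let ?D = "diff_measure m n"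
    have s: "sets n = sets m" "sets m = sets borel" "sets ?D = sets m" "space m = UNIV" "space n = UNIV" "space ?D = UNIV"
      using fin_measuresD[OF m] fin_measuresD[OF n] by auto
    have le': "emeasure n A \<le> emeasure m A" if "A \<in> sets m" for A
      using le s by (intro le_measureD3) auto
    have em: "emeasure ?D A = emeasure m A - emeasure n A" if "A \<in> sets m" for A
      using that le' by (intro emeasure_diff_measure[OF M.finite_measure_axioms N.finite_measure_axioms]) (auto simp: s)
    have sp: "emeasure m A = emeasure n A + emeasure ?D A" if "A \<in> sets m" for A
      using em[OF that] le'[OF that] that N.emeasure_finite[of A]
      by (simp add: add_diff_inverse_ennreal)
    have "emeasure ?D (space ?D) \<noteq> \<infinity>" using em[of UNIV] s M.emeasure_finite[of UNIV]
      by (auto simp: top_unique)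
    then interpret D: finite_measure ?D by (rule finite_measureI)
    have meas: "\<phi> \<in> borel_measurable m" "\<phi> \<in> borel_measurable n" "\<phi> \<in> borel_measurable ?D"
      using \<phi> s by (simp_all cong: measurable_cong_sets)
    have int: "integrable m \<phi>" "integrable n \<phi>" "integrable ?D \<phi>"
      using meas bd by (auto intro!: M.integrable_const_bound[of _ b] N.integrable_const_bound[of _ b] D.integrable_const_bound[of _ b])
    have nn0: "0 \<le> \<phi> x + b" for x
      using bd[of x] by linarith
    have nneg: "ennreal (\<integral>x. \<phi> x + b \<partial>R) = (\<integral>\<^sup>+x. ennreal (\<phi> x + b) \<partial>R)"
      if "integrable R \<phi>" "finite_measure R" for R
    proof (rule nn_integral_eq_integral[symmetric])
      have "integrable R (\<lambda>x. b)" using that(2) finite_measure.integrable_const by blast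
      then show "integrable R (\<lambda>x. \<phi> x + b)" using that(1) by auto
      show "AE x in R. 0 \<le> \<phi> x + b" using nn0 by simp
    qed
    have nn: "(\<integral>x. \<phi> x + b \<partial>R) \<ge> 0" for R :: "'a measure"
      using nn0 by simp
    have "(\<integral>\<^sup>+x. ennreal (\<phi> x + b) \<partial>m) = (\<integral>\<^sup>+x. ennreal (\<phi> x + b) \<partial>n) + (\<integral>\<^sup>+x. ennreal (\<phi> x + b) \<partial>?D)"
      using sp s meas by (intro nn_integral_split_measure) auto
    then have "(\<integral>x. \<phi> x + b \<partial>m) = (\<integral>x. \<phi> x + b \<partial>n) + (\<integral>x. \<phi> x + b \<partial>?D)"
      using nneg[OF int(1) M.finite_measure_axioms] nneg[OF int(2) N.finite_measure_axioms]
        nneg[OF int(3) D.finite_measure_axioms] nn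
      by (metis add_nonneg_nonneg ennreal_inj ennreal_plus)
    moreover have "measure m UNIV = measure n UNIV + measure ?D UNIV"
      using sp[of UNIV] s by (metis M.emeasure_eq_measure N.emeasure_eq_measure D.emeasure_eq_measure add_nonneg_nonneg ennreal_inj ennreal_plus measure_nonneg sets.top)
    ultimately have 1: "(\<integral>x. \<phi> x \<partial>m) = (\<integral>x. \<phi> x \<partial>n) + (\<integral>x. \<phi> x \<partial>?D)"
      using int by (simp add: s algebra_simps)
    have "\<bar>\<integral>x. \<phi> x \<partial>?D\<bar> \<le> (\<integral>x. \<bar>\<phi> x\<bar> \<partial>?D)" by (rule integral_abs_bound)
    also have "\<dots> \<le> (\<integral>x. b \<partial>?D)" using int bd by (intro integral_mono) auto
    finally show ?thesis using 1 by (simp add: s D.emeasure_eq_measure mult.commute)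
  qed
  have wi: "integrable w (\<lambda>z. \<phi> (fst z))" "integrable w (\<lambda>z. \<phi> (snd z))"
    using bd \<phi> measurable_compose[OF wfs(1) \<phi>] measurable_compose[OF wfs(2) \<phi>]
    by (auto intro!: w.integrable_const_bound[of _ b])
  have i1: "(\<integral>x. \<phi> x \<partial>n1) = (\<integral>z. \<phi> (fst z) \<partial>w)" "(\<integral>x. \<phi> x \<partial>n2) = (\<integral>z. \<phi> (snd z) \<partial>w)"
    using integral_distr[OF wfs(1) \<phi>] integral_distr[OF wfs(2) \<phi>] n by simp_all
  have norm_int: "integrable w (\<lambda>z. norm (fst z - snd z))"
  proof -
    have "(\<lambda>z. norm (fst z - snd z)) \<in> borel_measurable w"
      using wfs by measurable
    then show ?thesis using False by (intro integrableI_bounded) (auto simp: less_top)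
  qed
  have "(\<integral>x. \<phi> x \<partial>n1) - (\<integral>x. \<phi> x \<partial>n2) = (\<integral>z. \<phi> (fst z) - \<phi> (snd z) \<partial>w)"
    using wi i1 by simp
  also have "\<dots> \<le> (\<integral>z. norm (fst z - snd z) \<partial>w)"
    using wi norm_int lip by (intro integral_mono) (auto simp: abs_le_iff)
  finally have t: "(\<integral>x. \<phi> x \<partial>n1) - (\<integral>x. \<phi> x \<partial>n2) \<le> (\<integral>z. norm (fst z - snd z) \<partial>w)" .
  have R: "?R = ennreal (b * measure (diff_measure m1 n1) UNIV + b * measure (diff_measure m2 n2) UNIV
     + (\<integral>z. norm (fst z - snd z) \<partial>w))"
    using diff[OF m(1) n(1,3)] diff[OF m(2) n(2,4)] nn_integral_eq_integral[OF norm_int] b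
    by (simp add: ennreal_mult mult_nonneg_nonneg)
  show ?thesis unfolding R
    using diff[OF m(1) n(1,3)] diff[OF m(2) n(2,4)] t by (intro ennreal_leI) (auto simp: abs_le_iff)
qed

text \<open>The value of the infimum is finite, as the zero plan shows, so \<^const>\<open>enn2real\<close> preserves the bound
that holds for every plan.\<close>

lemma integral_diff_le_PRW:
  fixes m1 m2 :: "'a::euclidean_space measure"
  assumes m: "m1 \<in> \<M> UNIV" "m2 \<in> \<M> UNIV"
    and lip: "\<And>x y. \<bar>\<phi> x - \<phi> y\<bar> \<le> norm (x - y)" and bd: "\<And>x. \<bar>\<phi> x\<bar> \<le> b"
  shows "(\<integral>x. \<phi> x \<partial>m1) - (\<integral>x. \<phi> x \<partial>m2) \<le> PRW b m1 m2"
proof -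
  define c :: "'a measure \<times> 'a measure \<times> ('a \<times> 'a) measure \<Rightarrow> ennreal"
    where "c = (\<lambda>(n1, n2, w). ennreal b * emeasure (diff_measure m1 n1) UNIV + ennreal b * emeasure (diff_measure m2 n2) UNIV
     + (\<integral>\<^sup>+ z. ennreal (norm (fst z - snd z)) \<partial>w))"
  have le: "ennreal ((\<integral>x. \<phi> x \<partial>m1) - (\<integral>x. \<phi> x \<partial>m2)) \<le> (INF p \<in> partial_plans m1 m2. c p)"
    using partial_plan_bound[OF m _ lip bd] by (intro INF_greatest) (auto simp: c_def)
  have d: "emeasure (diff_measure m (null_measure borel)) UNIV < \<infinity>" if "m \<in> \<M> UNIV" for m :: "'a measure"
  proof -
    note D = fin_measuresD[OF that]
    have "emeasure (diff_measure m (null_measure borel)) UNIV = emeasure m UNIV - emeasure (null_measure borel) (UNIV :: 'a set)"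
      using D by (intro emeasure_diff_measure) (auto intro!: finite_measureI)
    then show ?thesis using finite_measure.emeasure_finite[OF D(2)] by (auto simp: less_top)
  qed
  have "(null_measure borel, null_measure borel, null_measure borel) \<in> partial_plans m1 m2"
  proof -
    have "null_measure borel \<in> \<M> UNIV" by (auto simp: fin_measures_def intro!: finite_measureI)
    moreover have "null_measure borel \<le> m1" "null_measure borel \<le> m2"
      using fin_measuresD(1)[OF m(1)] fin_measuresD(1)[OF m(2)] by (auto simp: le_measure le_fun_def)
    moreover have mb: "fst \<in> measurable (null_measure (borel :: ('a \<times> 'a) measure)) borel"
      "snd \<in> measurable (null_measure (borel :: ('a \<times> 'a) measure)) borel"
      unfolding measurable_cong_sets[OF sets_null_measure refl]
      by (intro borel_measurable_continuous_onI continuous_intros)+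
    moreover have "distr (null_measure (borel :: ('a \<times> 'a) measure)) borel fst = null_measure borel"
      "distr (null_measure (borel :: ('a \<times> 'a) measure)) borel snd = null_measure borel"
      using mb by (auto intro!: measure_eqI simp: emeasure_distr)
    ultimately show ?thesis by (auto simp: partial_plans_def)
  qed
  then have "(INF p \<in> partial_plans m1 m2. c p) \<le> c (null_measure borel, null_measure borel, null_measure borel)"
    by (rule INF_lower)
  also have "\<dots> < \<infinity>" using d[OF m(1)] d[OF m(2)]
    by (auto simp: c_def ennreal_mult_less_top nn_integral_null_measure)
  finally have fin: "(INF p \<in> partial_plans m1 m2. c p) < \<infinity>" .
  show ?thesis
  proof (cases "(\<integral>x. \<phi> x \<partial>m1) - (\<integral>x. \<phi> x \<partial>m2) \<ge> 0")
    case True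
    then show ?thesis using enn2real_mono[OF le] fin by (simp add: PRW_def c_def)
  next
    case False then show ?thesis unfolding PRW_def using enn2real_nonneg by (smt (verit))
  qed
qed

lemma PRW_nonneg: "PRW b m1 m2 \<ge> 0"
  by (simp add: PRW_def)

text \<open>Dividing by \<open>B / b + \<bar>L\<bar>\<close> makes \<open>h\<close> both 1-Lipschitz and bounded by \<open>b\<close>.\<close>

lemma abs_integral_diff_le_PRW:
  fixes m1 m2 :: "'a::euclidean_space measure"
  assumes m: "m1 \<in> \<M> UNIV" "m2 \<in> \<M> UNIV" and b: "b > 0"
    and lip: "\<And>x y. \<bar>h x - h y\<bar> \<le> L * norm (x - y)" and bd: "\<And>x. \<bar>h x\<bar> \<le> B"
  shows "\<bar>(\<integral>x. h x \<partial>m1) - (\<integral>x. h x \<partial>m2)\<bar> \<le> (B / b + \<bar>L\<bar>) * PRW b m1 m2"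
proof (cases "B / b + \<bar>L\<bar> = 0")
  case True
  have "B \<ge> 0" using bd[of 0] by linarith
  then have "B = 0" using True b by (smt (verit) divide_nonneg_pos divide_eq_0_iff)
  then have "h x = 0" for x using bd[of x] by simp
  then show ?thesis using True by simp
next
  case False
  have B: "B \<ge> 0" using bd[of 0] by linarith
  define l where "l = B / b + \<bar>L\<bar>"
  have l: "l > 0" unfolding l_def using False B b by (smt (verit) divide_nonneg_pos)
  have L: "\<bar>L\<bar> \<le> l" unfolding l_def using B b by simp
  have Bl: "B \<le> l * b" unfolding l_def using b by (simp add: field_simps)
  have h1: "\<bar>h x - h y\<bar> \<le> l * norm (x - y)" for x y
    using lip[of x y] L by (smt (verit) mult_right_mono norm_ge_zero)
  have "(\<integral>x. (s * h x) / l \<partial>m1) - (\<integral>x. (s * h x) / l \<partial>m2) \<le> PRW b m1 m2" if "\<bar>s\<bar> = 1" for s :: real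
  proof (rule integral_diff_le_PRW[OF m])
    fix x y
    have "s * h x / l - s * h y / l = s * (h x - h y) / l"
      by (simp add: diff_divide_distrib right_diff_distrib)
    then show "\<bar>s * h x / l - s * h y / l\<bar> \<le> norm (x - y)"
      using h1[of x y] l that by (simp add: abs_mult pos_divide_le_eq mult.commute)
    show "\<bar>s * h x / l\<bar> \<le> b"
      using order_trans[OF bd[of x] Bl] l that by (simp add: abs_mult pos_divide_le_eq mult.commute)
  qed
  from this[of 1] this[of "-1"] show ?thesis
    using l unfolding l_def[symmetric] by (simp add: abs_le_iff pos_divide_le_eq mult.commute flip: diff_divide_distrib)
qed

section \<open>Duality for finite transport problems with slack\<close>

text \<open>Functionals on the space of real functions on \<open>'j\<close>; only finitely many coordinates will matter.
Homogeneity is stated as an inequality, the converse following by scaling back.\<close>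

definition sublinear :: "(('j \<Rightarrow> real) \<Rightarrow> real) \<Rightarrow> bool" where
  "sublinear P \<longleftrightarrow> (\<forall>x y. P (\<lambda>j. x j + y j) \<le> P x + P y) \<and> (\<forall>c\<ge>0. \<forall>x. P (\<lambda>j. c * x j) \<le> c * P x)"

lemma sublinear_add: "sublinear P \<Longrightarrow> P (\<lambda>j. x j + y j) \<le> P x + P y"
  and sublinear_scale: "sublinear P \<Longrightarrow> c \<ge> 0 \<Longrightarrow> P (\<lambda>j. c * x j) \<le> c * P x"
  by (auto simp: sublinear_def)

lemma sublinear_zero:
  assumes "sublinear P" shows "P (\<lambda>j. 0) = 0"
proof -
  have "P (\<lambda>j. 0) \<le> 0" using sublinear_scale[OF assms, of 0 "\<lambda>j. 0"] by simp
  moreover have "P (\<lambda>j. 0) \<le> P (\<lambda>j. 0) + P (\<lambda>j. 0)" using sublinear_add[OF assms, of "\<lambda>j. 0" "\<lambda>j. 0"] by simp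
  ultimately show ?thesis by simp
qed

lemma sublinear_neg:
  assumes "sublinear P" shows "- P (\<lambda>j. - x j) \<le> P x"
  using sublinear_add[OF assms, of x "\<lambda>j. - x j"] sublinear_zero[OF assms] by simp

text \<open>The functional \<open>P' x = inf {P (x + t v) - t P v | t \<ge> 0}\<close> stays sublinear and lies below \<open>P\<close>; the choice
\<open>t = 1\<close> shows that it is linear along \<open>v\<close>. It is finite because subadditivity bounds the
expression below by \<open>- P (- x)\<close>.\<close>

lemma sublinear_linearize_direction:
  fixes P :: "('j \<Rightarrow> real) \<Rightarrow> real"
  assumes P: "sublinear P"
  obtains P' where "sublinear P'" "\<And>x. P' x \<le> P x" "P' (\<lambda>j. - v j) \<le> - P v"
proof
  define F where "F x t = P (\<lambda>j. x j + t * v j) - t * P v" for x t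
  define P' where "P' x = (INF t\<in>{0..}. F x t)" for x
  have lb: "F x t \<ge> - P (\<lambda>j. - x j)" if "t \<ge> 0" for x t
  proof -
    have "t * P v \<le> P (\<lambda>j. t * v j)"
    proof (cases "t = 0")
      case False
      then have "P v \<le> (1 / t) * P (\<lambda>j. t * v j)"
        using sublinear_scale[OF P, of "1 / t" "\<lambda>j. t * v j"] that by simp
      then show ?thesis using False that by (simp add: field_simps)
    qed (simp add: sublinear_zero[OF P])
    also have "\<dots> \<le> P (\<lambda>j. x j + t * v j) + P (\<lambda>j. - x j)"
      using sublinear_add[OF P, of "\<lambda>j. x j + t * v j" "\<lambda>j. - x j"] by simp
    finally show ?thesis by (simp add: F_def)
  qed
  have bdd: "bdd_below (F x ` {0..})" for x using lb by (intro bdd_belowI2[of _ "- P (\<lambda>j. - x j)"]) auto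
  have le: "P' x \<le> F x t" if "t \<ge> 0" for x t
    unfolding P'_def using that by (intro cINF_lower bdd) auto
  have approx: "\<exists>t\<ge>0. F x t < P' x + e" if "e > 0" for x e
  proof -
    have "Inf (F x ` {0..}) < P' x + e" using that by (simp add: P'_def)
    then show ?thesis using cInf_lessD[of "F x ` {0..}"] by fastforce
  qed
  show "sublinear P'"
    unfolding sublinear_def
  proof (intro conjI allI impI)
    fix x y
    show "P' (\<lambda>j. x j + y j) \<le> P' x + P' y"
    proof (rule field_le_epsilon)
      fix e :: real assume e: "e > 0"
      obtain s where s: "s \<ge> 0" "F x s < P' x + e / 2" using approx[of "e/2" x] e by auto
      obtain t where t: "t \<ge> 0" "F y t < P' y + e / 2" using approx[of "e/2" y] e by auto
      have "P' (\<lambda>j. x j + y j) \<le> F (\<lambda>j. x j + y j) (s + t)" using s t by (intro le) auto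
      also have "\<dots> \<le> F x s + F y t"
        using sublinear_add[OF P, of "\<lambda>j. x j + s * v j" "\<lambda>j. y j + t * v j"]
        by (simp add: F_def algebra_simps)
      finally show "P' (\<lambda>j. x j + y j) \<le> P' x + P' y + e" using s t by simp
    qed
  next
    fix c :: real and x assume c: "c \<ge> 0"
    show "P' (\<lambda>j. c * x j) \<le> c * P' x"
    proof (cases "c = 0")
      case True
      then show ?thesis using le[of 0 "\<lambda>j. c * x j"] by (simp add: F_def sublinear_zero[OF P])
    next
      case False
      show ?thesis
      proof (rule field_le_epsilon)
        fix e :: real assume e: "e > 0"
        obtain s where s: "s \<ge> 0" "F x s < P' x + e / c" using approx[of "e/c" x] e c False by auto
        have "P' (\<lambda>j. c * x j) \<le> F (\<lambda>j. c * x j) (c * s)" using s c by (intro le) auto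
        also have "\<dots> \<le> c * F x s"
          using sublinear_scale[OF P c, of "\<lambda>j. x j + s * v j"] by (simp add: F_def algebra_simps)
        also have "\<dots> \<le> c * (P' x + e / c)" using s c by (intro mult_left_mono) auto
        finally show "P' (\<lambda>j. c * x j) \<le> c * P' x + e" using False by (simp add: algebra_simps)
      qed
    qed
  qed
  show "P' x \<le> P x" for x using le[of 0 x] by (simp add: F_def)
  show "P' (\<lambda>j. - v j) \<le> - P v" using le[of 1 "\<lambda>j. - v j"] by (simp add: F_def sublinear_zero[OF P])
qed

text \<open>Linearity along a direction survives a decrease of the functional, so the directions can be treated
one after the other.\<close>

lemma sublinear_linearize_directions:
  fixes P :: "('j \<Rightarrow> real) \<Rightarrow> real"
  assumes "finite V" "sublinear P"
  shows "\<exists>P'. sublinear P' \<and> (\<forall>x. P' x \<le> P x) \<and> (\<forall>v\<in>V. P' (\<lambda>j. - v j) \<le> - P' v)"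
  using assms(1)
proof induction
  case empty
  then show ?case using assms(2) by auto
next
  case (insert v V)
  then obtain P' where P': "sublinear P'" "\<And>x. P' x \<le> P x" "\<And>v. v \<in> V \<Longrightarrow> P' (\<lambda>j. - v j) \<le> - P' v"
    by blast
  obtain P'' where P'': "sublinear P''" "\<And>x. P'' x \<le> P' x" "P'' (\<lambda>j. - v j) \<le> - P' v"
    using sublinear_linearize_direction[OF P'(1), of v] by blast
  have "P'' (\<lambda>j. - u j) \<le> - P'' u" if "u \<in> insert v V" for u
    using that P''(3) P''(2)[of u] P''(2)[of "\<lambda>j. - u j"] P'(3)[of u] by fastforce
  then show ?case using P'' P'(2) by (meson order_trans)
qed

text \<open>The Hahn-Banach theorem in finite dimension, with the dominated linear functional given by its
coefficients \<open>\<phi>\<close>. Linearizing along \<open>x0\<close> first pins the value there, and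
linearizing along the coordinate vectors afterwards makes the functional linear.\<close>

lemma finite_hahn_banach:
  fixes P :: "('j \<Rightarrow> real) \<Rightarrow> real"
  assumes J: "finite J" and P: "sublinear P" and x0: "\<And>j. j \<notin> J \<Longrightarrow> x0 j = 0"
  obtains \<phi> where "\<forall>x. (\<forall>j. j \<notin> J \<longrightarrow> x j = 0) \<longrightarrow> (\<Sum>j\<in>J. \<phi> j * x j) \<le> P x"
    and "(\<Sum>j\<in>J. \<phi> j * x0 j) = P x0"
proof -
  obtain P1 where P1: "sublinear P1" "\<And>x. P1 x \<le> P x" "P1 (\<lambda>j. - x0 j) \<le> - P x0"
    using sublinear_linearize_direction[OF P, of x0] by blast
  define e where "e i = (\<lambda>j. if j = i then 1 else 0 :: real)" for i :: 'j
  obtain P' where P': "sublinear P'" "\<And>x. P' x \<le> P1 x" "\<And>i. i \<in> J \<Longrightarrow> P' (\<lambda>j. - e i j) \<le> - P' (e i)"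
    using sublinear_linearize_directions[of "e ` J", OF _ P1(1)] J by auto
  have 1: "P' (\<lambda>j. c * e i j) \<le> P' (e i) * c" if "i \<in> J" for i c
  proof (cases "c \<ge> 0")
    case True
    then show ?thesis using sublinear_scale[OF P'(1), of c "e i"] by (simp add: mult.commute)
  next
    case False
    then have "P' (\<lambda>j. (-c) * (- e i j)) \<le> (-c) * P' (\<lambda>j. - e i j)"
      by (intro sublinear_scale[OF P'(1)]) auto
    also have "\<dots> \<le> (-c) * (- P' (e i))" using False P'(3)[OF that] by (intro mult_left_mono) auto
    finally show ?thesis by (simp add: mult.commute)
  qed
  have 2: "P' (\<lambda>j. \<Sum>i\<in>I. x i * e i j) \<le> (\<Sum>i\<in>I. P' (e i) * x i)" if "I \<subseteq> J" for I x
    using finite_subset[OF that J] that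
  proof induction
    case empty
    then show ?case by (simp add: sublinear_zero[OF P'(1)])
  next
    case (insert i I)
    have "P' (\<lambda>j. x i * e i j + (\<Sum>i\<in>I. x i * e i j)) \<le> P' (\<lambda>j. x i * e i j) + P' (\<lambda>j. \<Sum>i\<in>I. x i * e i j)"
      by (rule sublinear_add[OF P'(1)])
    then show ?case using insert 1[of i "x i"] by auto
  qed
  have 3: "P' x \<le> (\<Sum>i\<in>J. P' (e i) * x i)" if "\<And>j. j \<notin> J \<Longrightarrow> x j = 0" for x
  proof -
    have "(\<Sum>i\<in>J. x i * e i j) = x j" for j
      using that J by (simp add: e_def sum.delta' if_distrib cong: if_cong)
    then show ?thesis using 2[of J x] by simp
  qed
  show thesis
  proof (rule that, intro allI impI)
    fix x :: "'j \<Rightarrow> real" assume x: "\<forall>j. j \<notin> J \<longrightarrow> x j = 0"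
    have "- (\<Sum>j\<in>J. P' (e j) * x j) = (\<Sum>j\<in>J. P' (e j) * - x j)" by (simp add: sum_negf)
    then have "P' (\<lambda>j. - x j) \<le> - (\<Sum>j\<in>J. P' (e j) * x j)" using 3[of "\<lambda>j. - x j"] x by simp
    then show "(\<Sum>j\<in>J. P' (e j) * x j) \<le> P x"
      using sublinear_neg[OF P'(1), of x] P'(2)[of x] P1(2)[of x] by linarith
  next
    have "P x0 \<le> - P' (\<lambda>j. - x0 j)" using P1(3) P'(2)[of "\<lambda>j. - x0 j"] by linarith
    also have "\<dots> \<le> P' x0" by (rule sublinear_neg[OF P'(1)])
    also have "\<dots> \<le> (\<Sum>j\<in>J. P' (e j) * x0 j)" by (rule 3[OF x0])
    finally have ge: "P x0 \<le> (\<Sum>j\<in>J. P' (e j) * x0 j)" .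
    have "P' (\<lambda>j. - x0 j) \<le> - (\<Sum>j\<in>J. P' (e j) * x0 j)" using 3[of "\<lambda>j. - x0 j"] x0 by (simp add: sum_negf)
    then show "(\<Sum>j\<in>J. P' (e j) * x0 j) = P x0"
      using ge sublinear_neg[OF P'(1), of x0] P'(2)[of x0] P1(2)[of x0] by linarith
  qed
qed

text \<open>Scaling each overfull row down to its capacity \<open>a i\<close> removes as much mass from the columns as
the total excess of the rows, so the sum of the defects does not grow.\<close>

lemma trim_rows:
  fixes w :: "'i \<Rightarrow> 'k \<Rightarrow> real"
  assumes fin: "finite I" "finite J" and w: "\<And>i j. w i j \<ge> 0" and a: "\<And>i. a i \<ge> 0"
  obtains w' where "\<And>i j. 0 \<le> w' i j" "\<And>i j. w' i j \<le> w i j" "\<And>i. i \<in> I \<Longrightarrow> (\<Sum>j\<in>J. w' i j) \<le> a i"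
    "(\<Sum>i\<in>I. \<bar>a i - (\<Sum>j\<in>J. w' i j)\<bar>) + (\<Sum>j\<in>J. (\<Sum>i\<in>I. w i j) - (\<Sum>i\<in>I. w' i j)) \<le> (\<Sum>i\<in>I. \<bar>a i - (\<Sum>j\<in>J. w i j)\<bar>)"
proof
  define R where "R i = (\<Sum>j\<in>J. w i j)" for i
  define s where "s i = (if R i \<le> a i then 1 else a i / R i)" for i
  let ?w' = "\<lambda>i j. s i * w i j"
  have s: "0 \<le> s i" "s i \<le> 1" "s i * R i = min (R i) (a i)" for i
    using a[of i] by (auto simp: s_def)
  show "0 \<le> ?w' i j" "?w' i j \<le> w i j" for i j using s[of i] w[of i j] by (auto intro: mult_left_le_one_le)
  have R': "(\<Sum>j\<in>J. ?w' i j) = min (R i) (a i)" for i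
    unfolding s(3)[symmetric] by (simp add: R_def sum_distrib_left)
  show "(\<Sum>j\<in>J. ?w' i j) \<le> a i" for i unfolding R' by simp
  have "(\<Sum>j\<in>J. (\<Sum>i\<in>I. w i j) - (\<Sum>i\<in>I. ?w' i j)) = (\<Sum>i\<in>I. R i) - (\<Sum>i\<in>I. \<Sum>j\<in>J. ?w' i j)"
    unfolding sum_subtractf R_def by (simp add: sum.swap[of _ I])
  also have "\<dots> = (\<Sum>i\<in>I. R i - min (R i) (a i))" by (simp add: R' sum_subtractf)
  finally have "(\<Sum>i\<in>I. \<bar>a i - (\<Sum>j\<in>J. ?w' i j)\<bar>) + (\<Sum>j\<in>J. (\<Sum>i\<in>I. w i j) - (\<Sum>i\<in>I. ?w' i j))
     = (\<Sum>i\<in>I. \<bar>a i - min (R i) (a i)\<bar> + (R i - min (R i) (a i)))" unfolding R' by (simp only: sum.distrib)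
  also have "\<dots> = (\<Sum>i\<in>I. \<bar>a i - R i\<bar>)" by (intro sum.cong) auto
  finally show "(\<Sum>i\<in>I. \<bar>a i - (\<Sum>j\<in>J. ?w' i j)\<bar>) + (\<Sum>j\<in>J. (\<Sum>i\<in>I. w i j) - (\<Sum>i\<in>I. ?w' i j)) \<le> (\<Sum>i\<in>I. \<bar>a i - (\<Sum>j\<in>J. w i j)\<bar>)"
    by (simp add: R_def)
qed

text \<open>Transport cost of \<open>w\<close> where any mismatch between \<open>w\<close> and the given marginals is charged \<open>b\<close> per unit.
Overfull rows and columns are admitted: this makes the minimal cost finite and sublinear on all
(signed) pairs of marginals, so that it can be linearized.\<close>

definition penalty_cost :: "real \<Rightarrow> 'i set \<Rightarrow> 'k set \<Rightarrow> ('i \<Rightarrow> 'k \<Rightarrow> real) \<Rightarrow> ('i \<Rightarrow> real) \<Rightarrow> ('k \<Rightarrow> real) \<Rightarrow> ('i \<Rightarrow> 'k \<Rightarrow> real) \<Rightarrow> real" where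
  "penalty_cost b I J d a a' w = (\<Sum>i\<in>I. \<Sum>j\<in>J. w i j * d i j)
     + b * (\<Sum>i\<in>I. \<bar>a i - (\<Sum>j\<in>J. w i j)\<bar>) + b * (\<Sum>j\<in>J. \<bar>a' j - (\<Sum>i\<in>I. w i j)\<bar>)"

lemma trim_rows_cost:
  fixes w :: "'i \<Rightarrow> 'k \<Rightarrow> real"
  assumes fin: "finite I" "finite J" and w: "\<And>i j. w i j \<ge> 0" and a: "\<And>i. a i \<ge> 0"
    and b: "b \<ge> 0" and d: "\<And>i j. d i j \<ge> 0"
  obtains w' where "\<And>i j. 0 \<le> w' i j" "\<And>i j. w' i j \<le> w i j" "\<And>i. i \<in> I \<Longrightarrow> (\<Sum>j\<in>J. w' i j) \<le> a i"
    "penalty_cost b I J d a a' w' \<le> penalty_cost b I J d a a' w"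
proof -
  obtain w' where w': "\<And>i j. 0 \<le> w' i j" "\<And>i j. w' i j \<le> w i j" "\<And>i. i \<in> I \<Longrightarrow> (\<Sum>j\<in>J. w' i j) \<le> a i"
    "(\<Sum>i\<in>I. \<bar>a i - (\<Sum>j\<in>J. w' i j)\<bar>) + (\<Sum>j\<in>J. (\<Sum>i\<in>I. w i j) - (\<Sum>i\<in>I. w' i j)) \<le> (\<Sum>i\<in>I. \<bar>a i - (\<Sum>j\<in>J. w i j)\<bar>)"
    using trim_rows[where I = I and J = J and w = w and a = a] fin w a by blast
  have le: "(\<Sum>i\<in>I. w' i j) \<le> (\<Sum>i\<in>I. w i j)" for j by (intro sum_mono w')
  have "(\<Sum>j\<in>J. \<bar>a' j - (\<Sum>i\<in>I. w' i j)\<bar>) \<le> (\<Sum>j\<in>J. \<bar>a' j - (\<Sum>i\<in>I. w i j)\<bar> + ((\<Sum>i\<in>I. w i j) - (\<Sum>i\<in>I. w' i j)))"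
  proof (rule sum_mono)
    fix j show "\<bar>a' j - (\<Sum>i\<in>I. w' i j)\<bar> \<le> \<bar>a' j - (\<Sum>i\<in>I. w i j)\<bar> + ((\<Sum>i\<in>I. w i j) - (\<Sum>i\<in>I. w' i j))"
      using le[of j] by linarith
  qed
  then have "(\<Sum>i\<in>I. \<bar>a i - (\<Sum>j\<in>J. w' i j)\<bar>) + (\<Sum>j\<in>J. \<bar>a' j - (\<Sum>i\<in>I. w' i j)\<bar>)
    \<le> (\<Sum>i\<in>I. \<bar>a i - (\<Sum>j\<in>J. w i j)\<bar>) + (\<Sum>j\<in>J. \<bar>a' j - (\<Sum>i\<in>I. w i j)\<bar>)"
    using w'(4) by (simp add: sum.distrib)
  moreover have "(\<Sum>i\<in>I. \<Sum>j\<in>J. w' i j * d i j) \<le> (\<Sum>i\<in>I. \<Sum>j\<in>J. w i j * d i j)"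
    by (intro sum_mono mult_right_mono w' d)
  ultimately have "penalty_cost b I J d a a' w' \<le> penalty_cost b I J d a a' w"
    using mult_left_mono[OF _ b] unfolding penalty_cost_def add.assoc distrib_left[symmetric] by (intro add_mono)
  then show thesis using that w' by blast
qed

lemma penalty_cost_transpose:
  "penalty_cost b J I (\<lambda>j i. d i j) a' a (\<lambda>j i. w i j) = penalty_cost b I J d a a' w"
  using sum.swap[of "\<lambda>i j. w i j * d i j" J I] by (simp add: penalty_cost_def)

text \<open>Admitting overfull rows and columns does not lower the minimal cost: trim the rows, then the columns,
which keeps the rows within their capacities.\<close>

lemma trim_plan:
  fixes w :: "'i \<Rightarrow> 'k \<Rightarrow> real"
  assumes fin: "finite I" "finite J" and w: "\<And>i j. w i j \<ge> 0" and a: "\<And>i. a i \<ge> 0" "\<And>j. a' j \<ge> 0"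
    and b: "b \<ge> 0" and d: "\<And>i j. d i j \<ge> 0"
  obtains w' where "\<And>i j. 0 \<le> w' i j" "\<And>i. i \<in> I \<Longrightarrow> (\<Sum>j\<in>J. w' i j) \<le> a i" "\<And>j. j \<in> J \<Longrightarrow> (\<Sum>i\<in>I. w' i j) \<le> a' j"
    "penalty_cost b I J d a a' w' \<le> penalty_cost b I J d a a' w"
proof -
  obtain w1 where w1: "\<And>i j. 0 \<le> w1 i j" "\<And>i j. w1 i j \<le> w i j" "\<And>i. i \<in> I \<Longrightarrow> (\<Sum>j\<in>J. w1 i j) \<le> a i"
    "penalty_cost b I J d a a' w1 \<le> penalty_cost b I J d a a' w"
    using trim_rows_cost[where I = I and J = J and w = w and a = a and b = b and d = d and a' = a'] assms by metis
  obtain w2 where w2: "\<And>j i. 0 \<le> w2 j i" "\<And>j i. w2 j i \<le> w1 i j" "\<And>j. j \<in> J \<Longrightarrow> (\<Sum>i\<in>I. w2 j i) \<le> a' j"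
    "penalty_cost b J I (\<lambda>j i. d i j) a' a w2 \<le> penalty_cost b J I (\<lambda>j i. d i j) a' a (\<lambda>j i. w1 i j)"
    using trim_rows_cost[where I = J and J = I and w = "\<lambda>j i. w1 i j" and a = a' and b = b and d = "\<lambda>j i. d i j" and a' = a]
      assms w1(1) by metis
  have "(\<Sum>j\<in>J. w2 j i) \<le> a i" if "i \<in> I" for i
    using w1(3)[OF that] sum_mono[of J "\<lambda>j. w2 j i" "\<lambda>j. w1 i j"] w2(2) by fastforce
  then show thesis
    using that[of "\<lambda>i j. w2 j i"] w2 w1(4)
      penalty_cost_transpose[of b J I d a' a "\<lambda>i j. w2 j i"] penalty_cost_transpose[of b J I d a' a w1]
    by auto
qed

text \<open>The minimal penalized cost is a sublinear functional of the pair of marginals. A linear functional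
below it that touches it at the given pair is a dual solution: testing with one unit of mass at a single
point gives \<open>\<bar>\<phi>\<bar>, \<bar>\<psi>\<bar> \<le> b\<close>, and testing with one unit at \<open>i\<close> matched with one unit at \<open>j\<close> gives
\<open>\<phi> i - \<psi> j \<le> d i j\<close>. The primal side is attained only up to \<open>\<delta>\<close>, which spares a compactness argument.\<close>

lemma finite_transport_duality:
  fixes d :: "'i \<Rightarrow> 'k \<Rightarrow> real"
  assumes fin: "finite I" "finite J" and b: "b \<ge> 0" and d: "\<And>i j. d i j \<ge> 0"
    and a: "\<And>i. a i \<ge> 0" "\<And>j. a' j \<ge> 0" and \<delta>: "\<delta> > 0"
  obtains \<phi> \<psi> w where "\<And>i j. i \<in> I \<Longrightarrow> j \<in> J \<Longrightarrow> \<phi> i - \<psi> j \<le> d i j"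
    "\<And>i. i \<in> I \<Longrightarrow> \<bar>\<phi> i\<bar> \<le> b" "\<And>j. j \<in> J \<Longrightarrow> \<bar>\<psi> j\<bar> \<le> b"
    "\<And>i j. 0 \<le> w i j" "\<And>i. i \<in> I \<Longrightarrow> (\<Sum>j\<in>J. w i j) \<le> a i" "\<And>j. j \<in> J \<Longrightarrow> (\<Sum>i\<in>I. w i j) \<le> a' j"
    "(\<Sum>i\<in>I. \<Sum>j\<in>J. w i j * d i j) + b * (\<Sum>i\<in>I. a i - (\<Sum>j\<in>J. w i j)) + b * (\<Sum>j\<in>J. a' j - (\<Sum>i\<in>I. w i j))
      \<le> (\<Sum>i\<in>I. \<phi> i * a i) - (\<Sum>j\<in>J. \<psi> j * a' j) + \<delta>"
proof -
  define C where "C x w = penalty_cost b I J d (\<lambda>i. x (Inl i)) (\<lambda>j. x (Inr j)) w" for x :: "'i + 'k \<Rightarrow> real" and w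
  define W where "W = {w :: 'i \<Rightarrow> 'k \<Rightarrow> real. \<forall>i j. w i j \<ge> 0}"
  define P where "P x = (INF w\<in>W. C x w)" for x
  have C0: "C x w \<ge> 0" if "w \<in> W" for x w
    using that b d by (auto simp: C_def W_def penalty_cost_def intro!: add_nonneg_nonneg sum_nonneg mult_nonneg_nonneg)
  have Wne: "(\<lambda>i j. 0) \<in> W" by (simp add: W_def)
  have le: "P x \<le> C x w" if "w \<in> W" for x w
    unfolding P_def using that C0 by (intro cINF_lower bdd_belowI2[of _ 0]) auto
  have approx: "\<exists>w\<in>W. C x w < P x + e" if "e > 0" for x e
  proof -
    have "Inf (C x ` W) < P x + e" using that by (simp add: P_def)
    then show ?thesis using cInf_lessD[of "C x ` W"] Wne by fastforce
  qed
  have Cadd: "C (\<lambda>k. x k + y k) (\<lambda>i j. w i j + v i j) \<le> C x w + C y v" for x y w v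
  proof -
    have "(\<Sum>i\<in>I. \<bar>x (Inl i) + y (Inl i) - (\<Sum>j\<in>J. w i j + v i j)\<bar>)
      \<le> (\<Sum>i\<in>I. \<bar>x (Inl i) - (\<Sum>j\<in>J. w i j)\<bar> + \<bar>y (Inl i) - (\<Sum>j\<in>J. v i j)\<bar>)"
      unfolding sum.distrib[where A = J] by (rule sum_mono) linarith
    moreover have "(\<Sum>j\<in>J. \<bar>x (Inr j) + y (Inr j) - (\<Sum>i\<in>I. w i j + v i j)\<bar>)
      \<le> (\<Sum>j\<in>J. \<bar>x (Inr j) - (\<Sum>i\<in>I. w i j)\<bar> + \<bar>y (Inr j) - (\<Sum>i\<in>I. v i j)\<bar>)"
      unfolding sum.distrib[where A = I] by (rule sum_mono) linarith
    ultimately have "b * (\<Sum>i\<in>I. \<bar>x (Inl i) + y (Inl i) - (\<Sum>j\<in>J. w i j + v i j)\<bar>)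
      + b * (\<Sum>j\<in>J. \<bar>x (Inr j) + y (Inr j) - (\<Sum>i\<in>I. w i j + v i j)\<bar>)
      \<le> b * (\<Sum>i\<in>I. \<bar>x (Inl i) - (\<Sum>j\<in>J. w i j)\<bar> + \<bar>y (Inl i) - (\<Sum>j\<in>J. v i j)\<bar>)
      + b * (\<Sum>j\<in>J. \<bar>x (Inr j) - (\<Sum>i\<in>I. w i j)\<bar> + \<bar>y (Inr j) - (\<Sum>i\<in>I. v i j)\<bar>)"
      using b by (intro add_mono mult_left_mono)
    then show ?thesis by (simp add: C_def penalty_cost_def distrib_left distrib_right sum.distrib)
  qed
  have Cscale: "C (\<lambda>k. c * x k) (\<lambda>i j. c * w i j) = c * C x w" if "c \<ge> 0" for c x w
  proof -
    have "\<bar>c * u - (\<Sum>j\<in>A. c * v j)\<bar> = c * \<bar>u - (\<Sum>j\<in>A. v j)\<bar>" for u A and v :: "'z \<Rightarrow> real"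
      using that by (simp add: abs_mult flip: sum_distrib_left right_diff_distrib)
    then have scale_sum: "(\<Sum>k\<in>B. \<bar>c * u k - (\<Sum>j\<in>A. c * v k j)\<bar>) = c * (\<Sum>k\<in>B. \<bar>u k - (\<Sum>j\<in>A. v k j)\<bar>)"
      for A B u and v :: "'y \<Rightarrow> 'z \<Rightarrow> real"
      unfolding sum_distrib_left[of c _ B] by (intro sum.cong refl)
    have "(\<Sum>i\<in>I. \<bar>c * x (Inl i) - (\<Sum>j\<in>J. c * w i j)\<bar>) = c * (\<Sum>i\<in>I. \<bar>x (Inl i) - (\<Sum>j\<in>J. w i j)\<bar>)"
      "(\<Sum>j\<in>J. \<bar>c * x (Inr j) - (\<Sum>i\<in>I. c * w i j)\<bar>) = c * (\<Sum>j\<in>J. \<bar>x (Inr j) - (\<Sum>i\<in>I. w i j)\<bar>)"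
      by (rule scale_sum)+
    moreover have "(\<Sum>i\<in>I. \<Sum>j\<in>J. c * w i j * d i j) = c * (\<Sum>i\<in>I. \<Sum>j\<in>J. w i j * d i j)"
      by (simp add: sum_distrib_left mult.assoc)
    ultimately show ?thesis
      by (simp add: C_def penalty_cost_def distrib_left mult.left_commute)
  qed
  have sub: "sublinear P"
    unfolding sublinear_def
  proof (intro conjI allI impI)
    fix x y
    show "P (\<lambda>j. x j + y j) \<le> P x + P y"
    proof (rule field_le_epsilon)
      fix e :: real assume e: "e > 0"
      obtain w v where w: "w \<in> W" "C x w < P x + e / 2" and v: "v \<in> W" "C y v < P y + e / 2"
        using approx[of "e/2"] e by (meson half_gt_zero)
      have "P (\<lambda>j. x j + y j) \<le> C (\<lambda>j. x j + y j) (\<lambda>i j. w i j + v i j)"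
        using w v by (intro le) (auto simp: W_def)
      then show "P (\<lambda>j. x j + y j) \<le> P x + P y + e" using Cadd[of x y w v] w v by linarith
    qed
  next
    fix c :: real and x assume c: "c \<ge> 0"
    show "P (\<lambda>j. c * x j) \<le> c * P x"
    proof (rule field_le_epsilon)
      fix e :: real assume e: "e > 0"
      obtain w where w: "w \<in> W" "C x w < P x + e / (c + 1)"
        using approx[of "e / (c + 1)" x] e c by auto
      have "P (\<lambda>j. c * x j) \<le> C (\<lambda>j. c * x j) (\<lambda>i j. c * w i j)"
        using w c by (intro le) (auto simp: W_def)
      also have "\<dots> = c * C x w" by (rule Cscale[OF c])
      also have "\<dots> \<le> c * (P x + e / (c + 1))" using w c by (intro mult_left_mono) auto
      also have "\<dots> \<le> c * P x + e" using c e by (simp add: field_simps)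
      finally show "P (\<lambda>j. c * x j) \<le> c * P x + e" .
    qed
  qed
  define x0 where "x0 k = (if k \<in> I <+> J then case_sum a a' k else 0)" for k
  have finJ: "finite (I <+> J)" and x00: "\<And>k. k \<notin> I <+> J \<Longrightarrow> x0 k = 0"
    using fin by (auto simp: x0_def)
  obtain \<xi> where \<xi>_all: "\<forall>x. (\<forall>k. k \<notin> I <+> J \<longrightarrow> x k = 0) \<longrightarrow> (\<Sum>k\<in>I <+> J. \<xi> k * x k) \<le> P x"
    and eq: "(\<Sum>k\<in>I <+> J. \<xi> k * x0 k) = P x0"
    using finite_hahn_banach[OF finJ sub x00] .
  have \<xi>: "(\<Sum>k\<in>I <+> J. \<xi> k * x k) \<le> P x" if "\<And>k. k \<notin> I <+> J \<Longrightarrow> x k = 0" for x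
    using \<xi>_all that by simp
  have split: "(\<Sum>k\<in>I <+> J. \<xi> k * x k) = (\<Sum>i\<in>I. \<xi> (Inl i) * x (Inl i)) + (\<Sum>j\<in>J. \<xi> (Inr j) * x (Inr j))" for x
    using fin by (simp add: sum.Plus)
  have bound: "\<bar>\<xi> k\<bar> \<le> b" if k: "k \<in> I <+> J" for k
  proof -
    have "s * \<xi> k \<le> b" if "\<bar>s\<bar> = 1" for s
    proof -
      let ?x = "\<lambda>l. if l = k then s else 0"
      have "(\<Sum>l\<in>I <+> J. \<xi> l * ?x l) = s * \<xi> k"
        using k fin by (simp add: if_distrib sum.delta cong: if_cong)
      moreover have "(\<Sum>l\<in>I <+> J. \<xi> l * ?x l) \<le> P ?x" using k by (intro \<xi>) auto
      moreover have "P ?x \<le> C ?x (\<lambda>i j. 0)" by (rule le[OF Wne])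
      moreover have "C ?x (\<lambda>i j. 0) = b"
      proof -
        have "(\<Sum>i\<in>I. \<bar>?x (Inl i)\<bar>) = (\<Sum>i\<in>I. if Inl i = k then 1 else 0)"
          "(\<Sum>j\<in>J. \<bar>?x (Inr j)\<bar>) = (\<Sum>j\<in>J. if Inr j = k then 1 else 0)"
          using that by (auto intro!: sum.cong)
        then have "(\<Sum>i\<in>I. \<bar>?x (Inl i)\<bar>) + (\<Sum>j\<in>J. \<bar>?x (Inr j)\<bar>) = 1"
          using k fin by (cases k) auto
        moreover have "C ?x (\<lambda>i j. 0) = b * ((\<Sum>i\<in>I. \<bar>?x (Inl i)\<bar>) + (\<Sum>j\<in>J. \<bar>?x (Inr j)\<bar>))"
          by (simp only: C_def penalty_cost_def distrib_left) simp
        ultimately show ?thesis by simp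
      qed
      ultimately show ?thesis by simp
    qed
    from this[of 1] this[of "-1"] show ?thesis by simp
  qed
  have pair: "\<xi> (Inl i) + \<xi> (Inr j) \<le> d i j" if ij: "i \<in> I" "j \<in> J" for i j
  proof -
    let ?x = "\<lambda>l. if l = Inl i \<or> l = Inr j then 1 else 0 :: real"
    let ?w = "\<lambda>i' j'. if i' = i \<and> j' = j then 1 else 0 :: real"
    have "(\<Sum>l\<in>I <+> J. \<xi> l * ?x l) = \<xi> (Inl i) + \<xi> (Inr j)"
      unfolding split using ij fin by (simp add: if_distrib sum.delta cong: if_cong)
    moreover have "(\<Sum>l\<in>I <+> J. \<xi> l * ?x l) \<le> P ?x" using ij by (intro \<xi>) auto
    moreover have "P ?x \<le> C ?x ?w" by (rule le) (simp add: W_def)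
    moreover have "C ?x ?w = d i j"
    proof -
      have r: "(\<Sum>j'\<in>J. ?w i' j') = (if i' = i then 1 else 0)" for i' using ij fin by (cases "i' = i") auto
      have c: "(\<Sum>i'\<in>I. ?w i' j') = (if j' = j then 1 else 0)" for j' using ij fin by (cases "j' = j") auto
      have "(\<Sum>j'\<in>J. ?w i' j' * d i' j') = (if i' = i then d i j else 0)" for i'
      proof (cases "i' = i")
        case True
        have "(\<Sum>j'\<in>J. ?w i' j' * d i' j') = (\<Sum>j'\<in>J. if j' = j then d i j else 0)"
          using True by (intro sum.cong) auto
        then show ?thesis using True ij fin by simp
      qed simp
      then show ?thesis unfolding C_def penalty_cost_def r c using ij fin by simp
    qed
    ultimately show ?thesis by simp
  qed
  obtain w0 where w0: "w0 \<in> W" "C x0 w0 < P x0 + \<delta>" using approx[OF \<delta>] by blast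
  have ext: "penalty_cost b I J d a a' w = C x0 w" for w
    by (simp add: C_def penalty_cost_def x0_def InlI InrI cong: sum.cong_simp)
  obtain w where w: "\<And>i j. 0 \<le> w i j" "\<And>i. i \<in> I \<Longrightarrow> (\<Sum>j\<in>J. w i j) \<le> a i" "\<And>j. j \<in> J \<Longrightarrow> (\<Sum>i\<in>I. w i j) \<le> a' j"
    "penalty_cost b I J d a a' w \<le> penalty_cost b I J d a a' w0"
    by (rule trim_plan[where I = I and J = J and w = w0 and a = a and a' = a' and b = b and d = d, OF fin _ a b d]) (use w0(1) in \<open>auto simp: W_def\<close>)
  show thesis
  proof (rule that[of "\<lambda>i. \<xi> (Inl i)" "\<lambda>j. - \<xi> (Inr j)" w])
    have r: "(\<Sum>i\<in>I. \<bar>a i - (\<Sum>j\<in>J. w i j)\<bar>) = (\<Sum>i\<in>I. a i - (\<Sum>j\<in>J. w i j))"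
      using w(2) by (intro sum.cong) auto
    have c: "(\<Sum>j\<in>J. \<bar>a' j - (\<Sum>i\<in>I. w i j)\<bar>) = (\<Sum>j\<in>J. a' j - (\<Sum>i\<in>I. w i j))"
      using w(3) by (intro sum.cong) auto
    have "penalty_cost b I J d a a' w \<le> (\<Sum>k\<in>I <+> J. \<xi> k * x0 k) + \<delta>"
      using w(4) w0(2) eq ext by simp
    then show "(\<Sum>i\<in>I. \<Sum>j\<in>J. w i j * d i j) + b * (\<Sum>i\<in>I. a i - (\<Sum>j\<in>J. w i j)) + b * (\<Sum>j\<in>J. a' j - (\<Sum>i\<in>I. w i j))
      \<le> (\<Sum>i\<in>I. \<xi> (Inl i) * a i) - (\<Sum>j\<in>J. - \<xi> (Inr j) * a' j) + \<delta>"
      unfolding penalty_cost_def r c split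
      by (simp add: x0_def sum_negf InlI InrI cong: sum.cong_simp)
  qed (use w pair in \<open>auto intro!: bound InlI InrI\<close>)
qed

section \<open>Almost optimal potentials for measures on a compact set\<close>

lemma compact_small_partition:
  fixes X :: "'a::euclidean_space set"
  assumes X: "compact X" and \<eta>: "\<eta> > 0"
  obtains n and c :: "nat \<Rightarrow> 'a" and A where "\<And>i. A i \<in> sets borel" "\<And>i x. x \<in> A i \<Longrightarrow> norm (x - c i) \<le> \<eta>"
    "disjoint_family A" "(\<Union>i<n. A i) = X"
proof -
  obtain C where C: "finite C" "C \<subseteq> X" "X \<subseteq> (\<Union>x\<in>C. ball x \<eta>)"
  proof (rule compactE_image[OF X, of X "\<lambda>x. ball x \<eta>"])
    show "X \<subseteq> (\<Union>x\<in>X. ball x \<eta>)" using \<eta> by auto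
  qed auto
  obtain c where c: "bij_betw c {0..<card C} C" using ex_bij_betw_nat_finite[OF C(1)] by blast
  let ?n = "card C"
  define A where "A i = (if i < ?n then X \<inter> disjointed (\<lambda>i. ball (c i) \<eta>) i else {})" for i
  have sub: "disjointed (\<lambda>i. ball (c i) \<eta>) i \<subseteq> ball (c i) \<eta>" for i by (rule disjointed_subset)
  show thesis
  proof
    show "A i \<in> sets borel" for i
    proof -
      have "range (\<lambda>i. ball (c i) \<eta>) \<subseteq> sets borel" by auto
      from sets.range_disjointed_sets[OF this] X show ?thesis
        by (auto simp: A_def compact_imp_closed)
    qed
    show "norm (x - c i) \<le> \<eta>" if "x \<in> A i" for i x
      using that sub[of i] by (auto simp: A_def dist_norm norm_minus_commute split: if_splits)
    show "disjoint_family A"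
      using disjoint_family_disjointed[of "\<lambda>i. ball (c i) \<eta>"] by (auto simp: A_def disjoint_family_on_def)
    have "(\<Union>i<?n. ball (c i) \<eta>) = (\<Union>x\<in>C. ball x \<eta>)"
    proof -
      have "c ` {..<?n} = C" using bij_betw_imp_surj_on[OF c] by (simp add: lessThan_atLeast0)
      moreover have "(\<Union>i<?n. ball (c i) \<eta>) = (\<Union>x\<in>c ` {..<?n}. ball x \<eta>)" by simp
      ultimately show ?thesis by simp
    qed
    then have "(\<Union>i<?n. disjointed (\<lambda>i. ball (c i) \<eta>) i) = (\<Union>x\<in>C. ball x \<eta>)"
      using finite_UN_disjointed_eq[of "\<lambda>i. ball (c i) \<eta>" ?n] by (simp add: lessThan_atLeast0)
    then show "(\<Union>i<?n. A i) = X" using C(3) by (auto simp: A_def)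
  qed
qed

lemma partition_sum_measure:
  fixes n :: nat
  assumes m: "m \<in> \<M> X" and A: "\<And>i. A i \<in> sets borel" "disjoint_family A" "(\<Union>i<n. A i) = X"
  shows "(\<Sum>i<n. measure m (A i)) = measure m UNIV"
proof -
  note D = fin_measuresD[OF m]
  interpret finite_measure m by (rule D(2))
  have Xb: "X \<in> sets borel" unfolding A(3)[symmetric] using A(1) by (intro sets.finite_UN) auto
  have "measure m (UNIV - X) = 0" using D(4) by (simp add: measure_def)
  then have "measure m X = measure m UNIV"
    using finite_measure_compl[of X] D Xb by simp
  moreover have "measure m (\<Union>i<n. A i) = (\<Sum>i<n. measure m (A i))"
    using A D by (intro finite_measure_finite_Union) (auto simp: disjoint_family_on_def)
  ultimately show ?thesis using A(3) by simp
qed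

text \<open>On each cell, \<open>\<phi>\<close> differs from its value at the centre by at most \<open>\<eta>\<close>.\<close>

lemma integral_partition_approx:
  fixes m :: "'a::euclidean_space measure" and n :: nat
  assumes m: "m \<in> \<M> X" and A: "\<And>i. A i \<in> sets borel" "disjoint_family A" "(\<Union>i<n. A i) = X"
    and near: "\<And>i x. x \<in> A i \<Longrightarrow> norm (x - c i) \<le> \<eta>"
    and lip: "\<And>x y. \<bar>\<phi> x - \<phi> y\<bar> \<le> norm (x - y)" and bd: "\<And>x. \<bar>\<phi> x\<bar> \<le> b"
  shows "\<bar>(\<integral>x. \<phi> x \<partial>m) - (\<Sum>i<n. \<phi> (c i) * measure m (A i))\<bar> \<le> \<eta> * measure m UNIV"
proof -
  note D = fin_measuresD[OF m]
  interpret finite_measure m by (rule D(2))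
  have int: "integrable m \<phi>"
    using lip bd by (intro fin_measures_integrable[OF fin_measures_UNIV[OF m]] lipschitz_borel[of _ 1]) auto
  have iA: "integrable m (\<lambda>x. \<phi> (c i) * indicator (A i) x)" for i
    using A(1) D by (intro integrable_mult_right) (auto simp: integrable_indicator_iff less_top[symmetric])
  let ?s = "\<lambda>x. \<Sum>i<n. \<phi> (c i) * indicator (A i) x"
  have s: "(\<integral>x. ?s x \<partial>m) = (\<Sum>i<n. \<phi> (c i) * measure m (A i))"
    using iA A(1) D by (simp add: Bochner_Integration.integral_sum del: sum_mult_indicator)
  have Xb: "X \<in> sets borel" unfolding A(3)[symmetric] using A(1) by (intro sets.finite_UN) auto
  have AEX: "AE x in m. x \<in> X"
    using D(1,3,4) Xb by (intro AE_I[of _ _ "UNIV - X"]) auto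
  have close: "\<bar>\<phi> x - ?s x\<bar> \<le> \<eta>" if xX: "x \<in> X" for x
  proof -
    obtain i where i: "i < n" "x \<in> A i" using xX unfolding A(3)[symmetric] by auto
    have "?s x = (\<Sum>j<n. if j = i then \<phi> (c i) else 0)"
      using i A(2) by (intro sum.cong) (auto simp: disjoint_family_on_def indicator_def)
    then have "?s x = \<phi> (c i)" using i by simp
    then show ?thesis using lip[of x "c i"] near[OF i(2)] by linarith
  qed
  have "\<bar>(\<integral>x. \<phi> x \<partial>m) - (\<integral>x. ?s x \<partial>m)\<bar> = \<bar>\<integral>x. \<phi> x - ?s x \<partial>m\<bar>"
    using int iA by (simp add: Bochner_Integration.integral_diff del: sum_mult_indicator)
  also have "\<dots> \<le> (\<integral>x. \<bar>\<phi> x - ?s x\<bar> \<partial>m)" by (rule integral_abs_bound)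
  also have "\<dots> \<le> (\<integral>x. \<eta> \<partial>m)"
    using int iA close AEX
    by (intro integral_mono_AE) (auto elim!: eventually_mono simp del: sum_mult_indicator)
  also have "\<dots> = \<eta> * measure m UNIV" by (simp add: D mult.commute)
  finally show ?thesis unfolding s .
qed

text \<open>A plan \<open>w\<close> between the cells of a partition is spread out to a plan between the measures by the density
\<open>w i j / (m1 (A i) m2 (A j))\<close> on \<open>A i \<times> A j\<close> with respect to the product measure. Replacing
points by the centres of their cells costs at most \<open>2 \<eta>\<close> per unit of mass.\<close>

lemma PRW_le_partition_plan:
  fixes m1 m2 :: "'a::euclidean_space measure" and n :: nat
  assumes m: "m1 \<in> \<M> X" "m2 \<in> \<M> X" and b: "b \<ge> 0"
    and A: "\<And>i. A i \<in> sets borel" "disjoint_family A" "(\<Union>i<n. A i) = X"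
    and near: "\<And>i x. x \<in> A i \<Longrightarrow> norm (x - c i) \<le> \<eta>" and \<eta>: "\<eta> > 0"
    and w: "\<And>i j. 0 \<le> w i j" "\<And>i. i < n \<Longrightarrow> (\<Sum>j<n. w i j) \<le> measure m1 (A i)"
      "\<And>j. j < n \<Longrightarrow> (\<Sum>i<n. w i j) \<le> measure m2 (A j)"
  shows "PRW b m1 m2 \<le> b * (measure m1 UNIV - (\<Sum>i<n. \<Sum>j<n. w i j)) + b * (measure m2 UNIV - (\<Sum>i<n. \<Sum>j<n. w i j))
     + (\<Sum>i<n. \<Sum>j<n. w i j * (norm (c i - c j) + 2 * \<eta>))"
proof -
  note D1 = fin_measuresD[OF m(1)] and D2 = fin_measuresD[OF m(2)]
  interpret M1: finite_measure m1 by (rule D1(2))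
  interpret M2: finite_measure m2 by (rule D2(2))
  interpret P: pair_sigma_finite m1 m2 ..
  define a1 where "a1 i = measure m1 (A i)" for i
  define a2 where "a2 j = measure m2 (A j)" for j
  define k where "k i j = w i j / (a1 i * a2 j)" for i j
  have k0: "k i j \<ge> 0" for i j using w(1) by (simp add: k_def a1_def a2_def)
  \<comment> \<open>on cells of measure zero the density is \<open>x / 0 = 0\<close>, which is right because \<open>w\<close> vanishes there\<close>
  have wk: "k i j * (a1 i * a2 j) = w i j" if "i < n" "j < n" for i j
  proof (cases "a1 i = 0 \<or> a2 j = 0")
    case True
    have "w i j \<le> (\<Sum>j<n. w i j)" "w i j \<le> (\<Sum>i<n. w i j)"
      using that w(1) member_le_sum[of j "{..<n}" "w i"] member_le_sum[of i "{..<n}" "\<lambda>i. w i j"] by auto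
    then have "w i j = 0" using True w(2)[OF that(1)] w(3)[OF that(2)] w(1)[of i j] by (auto simp: a1_def a2_def)
    then show ?thesis using True by auto
  qed (auto simp: k_def)
  let ?MM = "m1 \<Otimes>\<^sub>M m2"
  define dens where "dens z = (\<Sum>i<n. \<Sum>j<n. ennreal (k i j) * indicator (A i \<times> A j) z)" for z
  define W where "W = density ?MM dens"
  have setsP: "sets ?MM = sets borel"
  proof -
    have "sets ?MM = sets (borel \<Otimes>\<^sub>M (borel :: 'a measure))"
      by (intro sets_pair_measure_cong D1(1) D2(1))
    then show ?thesis by (simp only: borel_prod)
  qed
  have rect: "B1 \<times> B2 \<in> sets ?MM" if "B1 \<in> sets borel" "B2 \<in> sets borel" for B1 B2
    using that D1(1) D2(1) by auto
  have dm: "dens \<in> borel_measurable ?MM"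
    unfolding dens_def using A(1) rect by measurable
  have setsW: "sets W = sets borel" by (simp add: W_def setsP)
  have spW: "space W = UNIV" using sets_eq_imp_space_eq[OF setsW] by simp
  have nn_cells: "(\<integral>\<^sup>+z. (\<Sum>i<n. \<Sum>j<n. u i j * indicator (B i \<times> B' j) z) \<partial>?MM)
      = (\<Sum>i<n. \<Sum>j<n. u i j * emeasure ?MM (B i \<times> B' j))"
    if "\<And>i. B i \<in> sets borel" "\<And>j. B' j \<in> sets borel" for u :: "nat \<Rightarrow> nat \<Rightarrow> ennreal" and B B'
    using rect[OF that]
    by (simp add: nn_integral_sum nn_integral_cmult_indicator del: sum_mult_indicator)
  have rectW: "emeasure W (B1 \<times> B2) = (\<Sum>i<n. \<Sum>j<n. ennreal (k i j) * (emeasure m1 (A i \<inter> B1) * emeasure m2 (A j \<inter> B2)))"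
    if B: "B1 \<in> sets borel" "B2 \<in> sets borel" for B1 B2
  proof -
    have "emeasure W (B1 \<times> B2) = (\<integral>\<^sup>+z. dens z * indicator (B1 \<times> B2) z \<partial>?MM)"
      unfolding W_def using dm rect[OF B] by (rule emeasure_density)
    also have "\<dots> = (\<integral>\<^sup>+z. (\<Sum>i<n. \<Sum>j<n. ennreal (k i j) * indicator ((A i \<inter> B1) \<times> (A j \<inter> B2)) z) \<partial>?MM)"
      by (intro nn_integral_cong) (auto simp: dens_def sum_distrib_right indicator_def intro!: sum.cong)
    also have "\<dots> = (\<Sum>i<n. \<Sum>j<n. ennreal (k i j) * emeasure ?MM ((A i \<inter> B1) \<times> (A j \<inter> B2)))"
      using A(1) B by (intro nn_cells) auto
    also have "\<dots> = (\<Sum>i<n. \<Sum>j<n. ennreal (k i j) * (emeasure m1 (A i \<inter> B1) * emeasure m2 (A j \<inter> B2)))"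
      using A(1) B D1(1) D2(1) by (intro sum.cong refl) (simp add: M2.emeasure_pair_measure_Times)
    finally show ?thesis .
  qed
  have cell: "ennreal (k i j) * (emeasure m1 (A i) * emeasure m2 (A j)) = ennreal (w i j)" if "i < n" "j < n" for i j
    using wk[OF that] k0[of i j]
    by (simp add: M1.emeasure_eq_measure M2.emeasure_eq_measure a1_def a2_def flip: ennreal_mult')
  have massW: "emeasure W UNIV = ennreal (\<Sum>i<n. \<Sum>j<n. w i j)"
    using rectW[of UNIV UNIV] cell w(1) by (simp add: sum_nonneg flip: sum_ennreal)
  define n1 where "n1 = distr W borel fst"
  define n2 where "n2 = distr W borel snd"
  have mf: "fst \<in> measurable W borel" "snd \<in> measurable W borel"
    unfolding measurable_cong_sets[OF setsW refl] by (intro borel_measurable_continuous_onI continuous_intros)+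
  have en1: "emeasure n1 B = emeasure W (B \<times> UNIV)" "emeasure n2 B = emeasure W (UNIV \<times> B)"
    if "B \<in> sets borel" for B
    using that mf by (auto simp: n1_def n2_def emeasure_distr spW intro!: arg_cong[where f = "emeasure W"])
  have split: "emeasure mm B \<ge> (\<Sum>i<n. emeasure mm (A i \<inter> B))" if "mm \<in> \<M> X" "B \<in> sets borel" for mm and B :: "'a set"
  proof -
    have s: "sets mm = sets borel" using fin_measuresD[OF that(1)] by simp
    have "(\<Sum>i<n. emeasure mm (A i \<inter> B)) = emeasure mm (\<Union>i<n. A i \<inter> B)"
      using A s that by (intro sum_emeasure) (auto simp: disjoint_family_on_def)
    also have "\<dots> \<le> emeasure mm B" using s that by (intro emeasure_mono) auto
    finally show ?thesis .
  qed
  have part: "u * (emeasure mm (A i \<inter> B)) \<le> emeasure mm (A i \<inter> B)" if "u \<le> 1" for u mm i and B :: "'a set"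
    using mult_right_mono[OF that, of "emeasure mm (A i \<inter> B)"] by simp
  have row1: "(\<Sum>j<n. ennreal (k i j) * emeasure m2 (A j)) \<le> 1 \<or> emeasure m1 (A i) = 0" if i: "i < n" for i
  proof (cases "a1 i = 0")
    case True then show ?thesis by (simp add: a1_def M1.emeasure_eq_measure)
  next
    case False
    then have pos: "a1 i > 0" by (simp add: a1_def zero_less_measure_iff)
    have "(\<Sum>j<n. k i j * a2 j) * a1 i = (\<Sum>j<n. w i j)"
      using wk[OF i] by (simp add: sum_distrib_left sum_distrib_right mult_ac)
    also have "\<dots> \<le> a1 i" using w(2)[OF i] by (simp add: a1_def)
    finally have "(\<Sum>j<n. k i j * a2 j) \<le> 1" using pos by simp
    moreover have "(\<Sum>j<n. ennreal (k i j) * emeasure m2 (A j)) = ennreal (\<Sum>j<n. k i j * a2 j)"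
      using k0 by (simp add: M2.emeasure_eq_measure a2_def ennreal_mult sum_ennreal[symmetric])
    ultimately show ?thesis by simp
  qed
  have row2: "(\<Sum>i<n. ennreal (k i j) * emeasure m1 (A i)) \<le> 1 \<or> emeasure m2 (A j) = 0" if j: "j < n" for j
  proof (cases "a2 j = 0")
    case True then show ?thesis by (simp add: a2_def M2.emeasure_eq_measure)
  next
    case False
    then have pos: "a2 j > 0" by (simp add: a2_def zero_less_measure_iff)
    have "(\<Sum>i<n. k i j * a1 i) * a2 j = (\<Sum>i<n. w i j)"
      using wk[OF _ j] by (simp add: sum_distrib_left sum_distrib_right mult_ac)
    also have "\<dots> \<le> a2 j" using w(3)[OF j] by (simp add: a2_def)
    finally have "(\<Sum>i<n. k i j * a1 i) \<le> 1" using pos by simp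
    moreover have "(\<Sum>i<n. ennreal (k i j) * emeasure m1 (A i)) = ennreal (\<Sum>i<n. k i j * a1 i)"
      using k0 by (simp add: M1.emeasure_eq_measure a1_def ennreal_mult sum_ennreal[symmetric])
    ultimately show ?thesis by simp
  qed
  have zero: "emeasure mm (A i \<inter> B) = 0" if "emeasure mm (A i) = 0" "mm \<in> \<M> X" "B \<in> sets borel" for mm i B
  proof -
    have "emeasure mm (A i \<inter> B) \<le> emeasure mm (A i)"
      using that A(1) fin_measuresD(1)[OF that(2)] by (intro emeasure_mono) auto
    then show ?thesis using that(1) by simp
  qed
  have le1: "emeasure n1 B \<le> emeasure m1 B" if B: "B \<in> sets borel" for B
  proof -
    have "emeasure n1 B = (\<Sum>i<n. \<Sum>j<n. ennreal (k i j) * (emeasure m1 (A i \<inter> B) * emeasure m2 (A j)))"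
      using en1(1)[OF B] rectW[OF B, of UNIV] by simp
    also have "\<dots> = (\<Sum>i<n. (\<Sum>j<n. ennreal (k i j) * emeasure m2 (A j)) * emeasure m1 (A i \<inter> B))"
      unfolding sum_distrib_right by (intro sum.cong refl) (simp add: mult_ac)
    also have "\<dots> \<le> (\<Sum>i<n. emeasure m1 (A i \<inter> B))"
    proof (rule sum_mono)
      fix i assume "i \<in> {..<n}"
      then consider "(\<Sum>j<n. ennreal (k i j) * emeasure m2 (A j)) \<le> 1" | "emeasure m1 (A i \<inter> B) = 0"
        using row1[of i] zero[OF _ m(1) B, of i] by auto
      then show "(\<Sum>j<n. ennreal (k i j) * emeasure m2 (A j)) * emeasure m1 (A i \<inter> B) \<le> emeasure m1 (A i \<inter> B)"
        using part by cases auto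
    qed
    also have "\<dots> \<le> emeasure m1 B" by (rule split[OF m(1) B])
    finally show ?thesis .
  qed
  have le2: "emeasure n2 B \<le> emeasure m2 B" if B: "B \<in> sets borel" for B
  proof -
    have "emeasure n2 B = (\<Sum>i<n. \<Sum>j<n. ennreal (k i j) * (emeasure m1 (A i) * emeasure m2 (A j \<inter> B)))"
      using en1(2)[OF B] rectW[of UNIV B] B by simp
    also have "\<dots> = (\<Sum>j<n. (\<Sum>i<n. ennreal (k i j) * emeasure m1 (A i)) * emeasure m2 (A j \<inter> B))"
      unfolding sum_distrib_right by (subst sum.swap, intro sum.cong refl) (simp add: mult_ac)
    also have "\<dots> \<le> (\<Sum>j<n. emeasure m2 (A j \<inter> B))"
    proof (rule sum_mono)
      fix j assume "j \<in> {..<n}"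
      then consider "(\<Sum>i<n. ennreal (k i j) * emeasure m1 (A i)) \<le> 1" | "emeasure m2 (A j \<inter> B) = 0"
        using row2[of j] zero[OF _ m(2) B, of j] by auto
      then show "(\<Sum>i<n. ennreal (k i j) * emeasure m1 (A i)) * emeasure m2 (A j \<inter> B) \<le> emeasure m2 (A j \<inter> B)"
        using part by cases auto
    qed
    also have "\<dots> \<le> emeasure m2 B" by (rule split[OF m(2) B])
    finally show ?thesis .
  qed
  have s1: "sets n1 = sets borel" "sets n2 = sets borel" by (simp_all add: n1_def n2_def)
  have sp1: "space n1 = UNIV" "space n2 = UNIV" by (simp_all add: n1_def n2_def)
  have nUNIV: "emeasure n1 UNIV = ennreal (\<Sum>i<n. \<Sum>j<n. w i j)" "emeasure n2 UNIV = ennreal (\<Sum>i<n. \<Sum>j<n. w i j)"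
    using en1[of UNIV] massW by simp_all
  have f1: "finite_measure n1" "finite_measure n2" using nUNIV sp1 by (auto intro!: finite_measureI)
  have plan: "(n1, n2, W) \<in> partial_plans m1 m2"
  proof -
    have "n1 \<le> m1" "n2 \<le> m2"
      using le1 le2 D1(1) D2(1) s1 by (auto simp: le_measure le_fun_def)
    moreover have "n1 \<in> \<M> UNIV" "n2 \<in> \<M> UNIV" using s1 f1 by (auto simp: fin_measures_def)
    moreover have "measure n1 UNIV = measure n2 UNIV" using nUNIV by (simp add: measure_def)
    ultimately show ?thesis using setsW by (simp add: partial_plans_def n1_def n2_def)
  qed
  have w0: "(\<Sum>i<n. \<Sum>j<n. w i j) \<ge> 0" using w(1) by (intro sum_nonneg)
  have dm1: "emeasure (diff_measure m1 n1) UNIV = ennreal (measure m1 UNIV - (\<Sum>i<n. \<Sum>j<n. w i j))"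
  proof -
    have "emeasure (diff_measure m1 n1) UNIV = emeasure m1 UNIV - emeasure n1 UNIV"
      using le1 D1 s1 f1 by (intro emeasure_diff_measure) auto
    then show ?thesis using nUNIV w0 by (simp add: M1.emeasure_eq_measure ennreal_minus)
  qed
  have dm2: "emeasure (diff_measure m2 n2) UNIV = ennreal (measure m2 UNIV - (\<Sum>i<n. \<Sum>j<n. w i j))"
  proof -
    have "emeasure (diff_measure m2 n2) UNIV = emeasure m2 UNIV - emeasure n2 UNIV"
      using le2 D2 s1 f1 by (intro emeasure_diff_measure) auto
    then show ?thesis using nUNIV w0 by (simp add: M2.emeasure_eq_measure ennreal_minus)
  qed
  let ?cost = "\<Sum>i<n. \<Sum>j<n. w i j * (norm (c i - c j) + 2 * \<eta>)"
  have cost0: "?cost \<ge> 0" using w(1) \<eta> by (intro sum_nonneg mult_nonneg_nonneg) auto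
  have cost: "(\<integral>\<^sup>+ z. ennreal (norm (fst z - snd z)) \<partial>W) \<le> ennreal ?cost"
  proof -
    have nm: "(\<lambda>z. ennreal (norm (fst z - snd z))) \<in> borel_measurable ?MM"
      unfolding measurable_cong_sets[OF setsP refl]
      by (intro measurable_compose[OF _ measurable_ennreal] borel_measurable_continuous_onI continuous_intros)
    have "(\<integral>\<^sup>+ z. ennreal (norm (fst z - snd z)) \<partial>W) = (\<integral>\<^sup>+ z. dens z * ennreal (norm (fst z - snd z)) \<partial>?MM)"
      unfolding W_def using dm nm by (rule nn_integral_density)
    also have "\<dots> \<le> (\<integral>\<^sup>+ z. (\<Sum>i<n. \<Sum>j<n. (ennreal (k i j) * ennreal (norm (c i - c j) + 2 * \<eta>)) * indicator (A i \<times> A j) z) \<partial>?MM)"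
    proof (intro nn_integral_mono)
      fix z
      have t: "ennreal (norm (fst z - snd z)) * indicator (A i \<times> A j) z \<le> ennreal (norm (c i - c j) + 2 * \<eta>) * indicator (A i \<times> A j) z" for i j
      proof (cases "z \<in> A i \<times> A j")
        case True
        then have "norm (fst z - c i) \<le> \<eta>" "norm (snd z - c j) \<le> \<eta>" using near by auto
        then have "norm (fst z - snd z) \<le> norm (c i - c j) + 2 * \<eta>" by norm
        then show ?thesis using True by (simp add: ennreal_leI)
      qed simp
      have "dens z * ennreal (norm (fst z - snd z)) = (\<Sum>i<n. \<Sum>j<n. ennreal (k i j) * (ennreal (norm (fst z - snd z)) * indicator (A i \<times> A j) z))"
        unfolding dens_def sum_distrib_right by (intro sum.cong refl) (simp add: mult_ac)
      also have "\<dots> \<le> (\<Sum>i<n. \<Sum>j<n. ennreal (k i j) * (ennreal (norm (c i - c j) + 2 * \<eta>) * indicator (A i \<times> A j) z))"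
        by (intro sum_mono mult_left_mono t) auto
      finally show "dens z * ennreal (norm (fst z - snd z)) \<le> (\<Sum>i<n. \<Sum>j<n. (ennreal (k i j) * ennreal (norm (c i - c j) + 2 * \<eta>)) * indicator (A i \<times> A j) z)"
        by (simp add: mult.assoc)
    qed
    also have "\<dots> = (\<Sum>i<n. \<Sum>j<n. (ennreal (k i j) * ennreal (norm (c i - c j) + 2 * \<eta>)) * emeasure ?MM (A i \<times> A j))"
      using A(1) by (intro nn_cells)
    also have "\<dots> = (\<Sum>i<n. \<Sum>j<n. ennreal (norm (c i - c j) + 2 * \<eta>) * (ennreal (k i j) * (emeasure m1 (A i) * emeasure m2 (A j))))"
      using A(1) D1(1) D2(1) by (intro sum.cong refl) (simp add: M2.emeasure_pair_measure_Times mult_ac)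
    also have "\<dots> = (\<Sum>i<n. \<Sum>j<n. ennreal (w i j * (norm (c i - c j) + 2 * \<eta>)))"
    proof (intro sum.cong refl)
      fix i j assume "i \<in> {..<n}" "j \<in> {..<n}"
      then show "ennreal (norm (c i - c j) + 2 * \<eta>) * (ennreal (k i j) * (emeasure m1 (A i) * emeasure m2 (A j))) = ennreal (w i j * (norm (c i - c j) + 2 * \<eta>))"
        using cell[of i j] w(1)[of i j] by (simp only: lessThan_iff) (simp add: ennreal_mult' mult.commute)
    qed
    also have "\<dots> = ennreal ?cost"
    proof -
      have "w i j * (norm (c i - c j) + 2 * \<eta>) \<ge> 0" for i j using w(1)[of i j] \<eta> by simp
      then show ?thesis by (simp add: sum_ennreal sum_nonneg)
    qed
    finally show ?thesis .
  qed
  have mass_le: "(\<Sum>i<n. \<Sum>j<n. w i j) \<le> measure m1 UNIV" "(\<Sum>i<n. \<Sum>j<n. w i j) \<le> measure m2 UNIV"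
    using le1[of UNIV] le2[of UNIV] nUNIV by (simp_all add: M1.emeasure_eq_measure M2.emeasure_eq_measure)
  let ?R = "b * (measure m1 UNIV - (\<Sum>i<n. \<Sum>j<n. w i j)) + b * (measure m2 UNIV - (\<Sum>i<n. \<Sum>j<n. w i j)) + ?cost"
  have "(INF (n1, n2, w) \<in> partial_plans m1 m2.
     ennreal b * emeasure (diff_measure m1 n1) UNIV + ennreal b * emeasure (diff_measure m2 n2) UNIV
     + (\<integral>\<^sup>+ z. ennreal (norm (fst z - snd z)) \<partial>w)) \<le> ennreal b * emeasure (diff_measure m1 n1) UNIV + ennreal b * emeasure (diff_measure m2 n2) UNIV
     + (\<integral>\<^sup>+ z. ennreal (norm (fst z - snd z)) \<partial>W)"
    by (rule INF_lower2[OF plan]) simp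
  also have "\<dots> \<le> ennreal b * ennreal (measure m1 UNIV - (\<Sum>i<n. \<Sum>j<n. w i j)) + ennreal b * ennreal (measure m2 UNIV - (\<Sum>i<n. \<Sum>j<n. w i j)) + ennreal ?cost"
    unfolding dm1 dm2 by (intro add_mono order_refl cost)
  also have "\<dots> = ennreal ?R"
    using b mass_le cost0 by (simp add: ennreal_mult mult_nonneg_nonneg)
  finally have "PRW b m1 m2 \<le> enn2real (ennreal ?R)"
    unfolding PRW_def by (rule enn2real_mono) simp
  moreover have "?R \<ge> 0"
    using b mass_le cost0 by (intro add_nonneg_nonneg mult_nonneg_nonneg) auto
  ultimately show ?thesis by (simp only: enn2real_ennreal)
qed

text \<open>The hard half of Kantorovich duality, up to \<open>O(\<eta>)\<close>. Finite duality on a fine partition gives \<open>\<phi>\<close> and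
\<open>\<psi>\<close> at the centres; the function \<open>\<Phi> x = min b (min\<^sub>j (\<psi> j + norm (x - c j)))\<close> is 1-Lipschitz, bounded by \<open>b\<close>,
above \<open>\<phi>\<close> and below \<open>\<psi>\<close> at the centres, so it replaces both.\<close>

lemma PRW_dual_potential:
  fixes m1 m2 :: "'a::euclidean_space measure"
  assumes X: "compact X" and m: "m1 \<in> \<M> X" "m2 \<in> \<M> X" and b: "b \<ge> 0" and \<eta>: "\<eta> > 0"
  obtains \<phi> where "\<And>x y. \<bar>\<phi> x - \<phi> y\<bar> \<le> norm (x - y)" "\<And>x. \<bar>\<phi> x\<bar> \<le> b"
    "PRW b m1 m2 \<le> (\<integral>x. \<phi> x \<partial>m1) - (\<integral>x. \<phi> x \<partial>m2) + (3 * (measure m1 UNIV + measure m2 UNIV) + 1) * \<eta>"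
proof -
  obtain n and c :: "nat \<Rightarrow> 'a" and A where A: "\<And>i. A i \<in> sets borel" "disjoint_family A" "(\<Union>i<n. A i) = X"
    and near: "\<And>i x. x \<in> A i \<Longrightarrow> norm (x - c i) \<le> \<eta>"
    using compact_small_partition[OF X \<eta>] by metis
  define d where "d i j = norm (c i - c j)" for i j
  define a1 where "a1 i = measure m1 (A i)" for i
  define a2 where "a2 i = measure m2 (A i)" for i
  obtain \<phi> \<psi> w where fp: "\<And>i j. i < n \<Longrightarrow> j < n \<Longrightarrow> \<phi> i - \<psi> j \<le> d i j"
    "\<And>i. i < n \<Longrightarrow> \<bar>\<phi> i\<bar> \<le> b" "\<And>j. j < n \<Longrightarrow> \<bar>\<psi> j\<bar> \<le> b"
    and w: "\<And>i j. 0 \<le> w i j" "\<And>i. i < n \<Longrightarrow> (\<Sum>j<n. w i j) \<le> a1 i" "\<And>j. j < n \<Longrightarrow> (\<Sum>i<n. w i j) \<le> a2 j"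
    and opt: "(\<Sum>i<n. \<Sum>j<n. w i j * d i j) + b * (\<Sum>i<n. a1 i - (\<Sum>j<n. w i j)) + b * (\<Sum>j<n. a2 j - (\<Sum>i<n. w i j))
      \<le> (\<Sum>i<n. \<phi> i * a1 i) - (\<Sum>j<n. \<psi> j * a2 j) + \<eta>"
    using finite_transport_duality[where I = "{..<n}" and J = "{..<n}" and b = b and d = d and a = a1 and a' = a2 and \<delta> = \<eta>]
      b \<eta> by (auto simp: d_def a1_def a2_def)
  \<comment> \<open>inserting \<open>b\<close> bounds the minimum from above and covers the case of no cells\<close>
  define S where "S x = insert b ((\<lambda>j. \<psi> j + norm (x - c j)) ` {..<n})" for x
  define \<Phi> where "\<Phi> x = Min (S x)" for x
  have finS: "finite (S x)" "S x \<noteq> {}" for x by (auto simp: S_def)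
  have lipa: "\<Phi> x \<le> \<Phi> y + norm (x - y)" for x y
  proof -
    have "\<Phi> y \<in> S y" unfolding \<Phi>_def using finS by (rule Min_in)
    then consider "\<Phi> y = b" | j where "j < n" "\<Phi> y = \<psi> j + norm (y - c j)" by (auto simp: S_def)
    then show ?thesis
    proof cases
      case 1
      have "\<Phi> x \<le> b" unfolding \<Phi>_def using finS by (intro Min_le) (auto simp: S_def)
      then show ?thesis using 1 by (simp add: add_increasing2)
    next
      case 2
      have "\<Phi> x \<le> \<psi> j + norm (x - c j)" unfolding \<Phi>_def using finS 2 by (intro Min_le) (auto simp: S_def)
      then show ?thesis using 2 norm_triangle_ineq[of "x - y" "y - c j"] by simp
    qed
  qed
  have lip: "\<bar>\<Phi> x - \<Phi> y\<bar> \<le> norm (x - y)" for x y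
    using lipa[of x y] lipa[of y x] by (simp add: norm_minus_commute abs_le_iff)
  have bd: "\<bar>\<Phi> x\<bar> \<le> b" for x
  proof -
    have "\<Phi> x \<le> b" unfolding \<Phi>_def using finS by (intro Min_le) (auto simp: S_def)
    moreover have "- b \<le> \<Phi> x"
    proof -
      have "- b \<le> \<psi> j + norm (x - c j)" if "j < n" for j
        using fp(3)[OF that] by (smt (verit) norm_ge_zero)
      then show ?thesis unfolding \<Phi>_def using finS b by (intro Min.boundedI) (auto simp: S_def)
    qed
    ultimately show ?thesis by simp
  qed
  have up: "\<phi> i \<le> \<Phi> (c i)" if "i < n" for i
    unfolding \<Phi>_def using finS that fp(1)[OF that] fp(2)[OF that]
    by (intro Min.boundedI) (auto simp: S_def d_def algebra_simps)
  have lo: "\<Phi> (c j) \<le> \<psi> j" if "j < n" for j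
    unfolding \<Phi>_def using finS that by (intro Min_le) (auto simp: S_def image_iff intro!: bexI[of _ j])
  have "(\<Sum>i<n. \<phi> i * a1 i) \<le> (\<Sum>i<n. \<Phi> (c i) * a1 i)"
    using up by (intro sum_mono mult_right_mono) (auto simp: a1_def)
  moreover have "(\<Sum>i<n. \<Phi> (c i) * a2 i) \<le> (\<Sum>i<n. \<psi> i * a2 i)"
    using lo by (intro sum_mono mult_right_mono) (auto simp: a2_def)
  moreover have "\<bar>(\<integral>x. \<Phi> x \<partial>m1) - (\<Sum>i<n. \<Phi> (c i) * measure m1 (A i))\<bar> \<le> \<eta> * measure m1 UNIV"
    "\<bar>(\<integral>x. \<Phi> x \<partial>m2) - (\<Sum>i<n. \<Phi> (c i) * measure m2 (A i))\<bar> \<le> \<eta> * measure m2 UNIV"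
    by (rule integral_partition_approx[OF m(1) A near lip bd] integral_partition_approx[OF m(2) A near lip bd]; assumption)+
  ultimately have dual: "(\<Sum>i<n. \<phi> i * a1 i) - (\<Sum>j<n. \<psi> j * a2 j) \<le> (\<integral>x. \<Phi> x \<partial>m1) - (\<integral>x. \<Phi> x \<partial>m2) + \<eta> * measure m1 UNIV + \<eta> * measure m2 UNIV"
    by (auto simp: a1_def a2_def abs_le_iff)
  have tot: "(\<Sum>i<n. a1 i) = measure m1 UNIV" "(\<Sum>i<n. a2 i) = measure m2 UNIV"
    using partition_sum_measure[OF m(1) A] partition_sum_measure[OF m(2) A] by (simp_all add: a1_def a2_def)
  have wm: "(\<Sum>i<n. \<Sum>j<n. w i j) \<le> measure m1 UNIV"
    unfolding tot(1)[symmetric] using w(2) by (intro sum_mono) auto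
  have swap: "(\<Sum>j<n. \<Sum>i<n. w i j) = (\<Sum>i<n. \<Sum>j<n. w i j)" by (rule sum.swap)
  have "PRW b m1 m2 \<le> b * (measure m1 UNIV - (\<Sum>i<n. \<Sum>j<n. w i j)) + b * (measure m2 UNIV - (\<Sum>i<n. \<Sum>j<n. w i j))
     + (\<Sum>i<n. \<Sum>j<n. w i j * (norm (c i - c j) + 2 * \<eta>))"
    using PRW_le_partition_plan[OF m b A near \<eta> w(1)] w(2,3) by (simp add: a1_def a2_def)
  also have "\<dots> = (\<Sum>i<n. \<Sum>j<n. w i j * d i j) + b * (\<Sum>i<n. a1 i - (\<Sum>j<n. w i j)) + b * (\<Sum>j<n. a2 j - (\<Sum>i<n. w i j)) + 2 * \<eta> * (\<Sum>i<n. \<Sum>j<n. w i j)"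
    unfolding sum_subtractf tot swap d_def
    by (simp add: distrib_left sum.distrib sum_distrib_left mult_ac)
  also have "\<dots> \<le> (\<integral>x. \<Phi> x \<partial>m1) - (\<integral>x. \<Phi> x \<partial>m2) + \<eta> * measure m1 UNIV + \<eta> * measure m2 UNIV + \<eta> + 2 * \<eta> * measure m1 UNIV"
    using opt dual mult_left_mono[OF wm, of "2 * \<eta>"] \<eta> by linarith
  also have "\<dots> \<le> (\<integral>x. \<Phi> x \<partial>m1) - (\<integral>x. \<Phi> x \<partial>m2) + (3 * (measure m1 UNIV + measure m2 UNIV) + 1) * \<eta>"
    using \<eta> by (simp add: algebra_simps)
  finally show thesis using that lip bd by blast
qed

section \<open>Mollification at a given scale\<close>

text \<open>A quantitative form of \<open>C\<^sup>1\<^sup>,\<^sup>1\<close> regularity. Unlike a Lipschitz bound on a derivative it passes to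
compositions and products by a direct computation with remainders.\<close>

definition quad_approx :: "real \<Rightarrow> ('a::euclidean_space \<Rightarrow> 'b::euclidean_space) \<Rightarrow> ('a \<Rightarrow> 'a \<Rightarrow> 'b) \<Rightarrow> bool" where
  "quad_approx A F D \<longleftrightarrow> (\<forall>x. linear (D x)) \<and> (\<forall>x y. norm (F y - F x - D x (y - x)) \<le> A * (norm (y - x))\<^sup>2)"

text \<open>The mollifier, up to normalization.\<close>

definition bump :: "'a::euclidean_space \<Rightarrow> real" where
  "bump z = (max 0 (1 - (norm z)\<^sup>2))\<^sup>2"

definition bump_deriv :: "'a::euclidean_space \<Rightarrow> 'a \<Rightarrow> real" where
  "bump_deriv z v = - 4 * max 0 (1 - (norm z)\<^sup>2) * (z \<bullet> v)"

lemma bump_nonneg: "bump z \<ge> 0"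
  by (simp add: bump_def)

lemma bump_outside: "norm z \<ge> 1 \<Longrightarrow> bump z = 0"
  using power_mono[of 1 "norm z" 2] by (simp add: bump_def)

lemma bump_deriv_outside: "norm z \<ge> 1 \<Longrightarrow> bump_deriv z v = 0"
  using power_mono[of 1 "norm z" 2] by (simp add: bump_deriv_def)

lemma continuous_bump [continuous_intros]: "continuous_on S bump"
  unfolding bump_def[abs_def] by (intro continuous_intros)

lemma continuous_bump_deriv: "continuous_on S (\<lambda>z. bump_deriv z v)"
  unfolding bump_deriv_def by (intro continuous_intros)

text \<open>The square of the positive part is \<open>C\<^sup>1\<^sup>,\<^sup>1\<close>: this makes it a convenient building block both for the
mollifier and for cut-off functions.\<close>

lemma pos_part_square_taylor:
  fixes s t :: real
  shows "\<bar>(max 0 t)\<^sup>2 - (max 0 s)\<^sup>2 - 2 * max 0 s * (t - s)\<bar> \<le> (t - s)\<^sup>2"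
proof -
  consider "s \<ge> 0" "t \<ge> 0" | "s \<ge> 0" "t < 0" | "s < 0" "t \<ge> 0" | "s < 0" "t < 0" by linarith
  then show ?thesis
  proof cases
    case 1
    have "t\<^sup>2 - s\<^sup>2 - 2 * s * (t - s) = (t - s)\<^sup>2" by (simp add: power2_eq_square algebra_simps)
    then show ?thesis using 1 by (simp add: max_def)
  next
    case 2
    have "- s\<^sup>2 - 2 * s * (t - s) = (t - s)\<^sup>2 - t\<^sup>2" by (simp add: power2_eq_square algebra_simps)
    moreover have "t\<^sup>2 \<le> (t - s)\<^sup>2" using 2 by (intro abs_le_square_iff[THEN iffD1]) auto
    moreover have "t\<^sup>2 \<ge> 0" by simp
    ultimately show ?thesis using 2 by (simp add: max_def)
  next
    case 3
    have "t\<^sup>2 \<le> (t - s)\<^sup>2" using 3 by (intro power_mono) auto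
    then show ?thesis using 3 by (simp add: max_def)
  next
    case 4
    then show ?thesis by (simp add: max_def)
  qed
qed

lemma bump_taylor:
  fixes z v :: "'a::euclidean_space"
  assumes v: "norm v \<le> 1"
  shows "\<bar>bump (z + v) - bump z - bump_deriv z v\<bar> \<le> 27 * (norm v)\<^sup>2 * indicator (cball 0 2) z"
proof (cases "norm z \<le> 2")
  case False
  then have "norm (z + v) \<ge> 1" using v norm_triangle_ineq2[of z "- v"] by simp
  then show ?thesis using False by (simp add: bump_outside bump_deriv_outside)
next
  case True
  define s where "s = 1 - (norm z)\<^sup>2"
  define t where "t = 1 - (norm (z + v))\<^sup>2"
  have st: "t - s = - 2 * (z \<bullet> v) - (norm v)\<^sup>2"
    by (simp add: s_def t_def power2_norm_eq_inner inner_add_left inner_add_right inner_commute)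
  have "\<bar>t - s\<bar> \<le> 2 * \<bar>z \<bullet> v\<bar> + (norm v)\<^sup>2" unfolding st using zero_le_power2[of "norm v"] by linarith
  also have "\<dots> \<le> 2 * (2 * norm v) + 1 * norm v"
  proof -
    have "\<bar>z \<bullet> v\<bar> \<le> 2 * norm v"
      using Cauchy_Schwarz_ineq2[of z v] mult_right_mono[OF True, of "norm v"] by simp
    moreover have "(norm v)\<^sup>2 \<le> 1 * norm v"
      unfolding power2_eq_square using v by (intro mult_right_mono) auto
    ultimately show ?thesis by linarith
  qed
  finally have "(t - s)\<^sup>2 \<le> (5 * norm v)\<^sup>2" by (intro abs_le_square_iff[THEN iffD1]) simp
  moreover have sq: "(5 * norm v)\<^sup>2 = 25 * (norm v)\<^sup>2" by (simp add: power_mult_distrib)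
  moreover have "bump (z + v) - bump z - bump_deriv z v
    = ((max 0 t)\<^sup>2 - (max 0 s)\<^sup>2 - 2 * max 0 s * (t - s)) - 2 * max 0 s * (norm v)\<^sup>2"
    unfolding bump_def bump_deriv_def s_def[symmetric] t_def[symmetric] st by (simp add: algebra_simps)
  moreover have "0 \<le> 2 * max 0 s * (norm v)\<^sup>2" "2 * max 0 s * (norm v)\<^sup>2 \<le> 2 * 1 * (norm v)\<^sup>2"
    by (simp, intro mult_right_mono mult_left_mono) (auto simp: s_def)
  ultimately have "\<bar>bump (z + v) - bump z - bump_deriv z v\<bar> \<le> 27 * (norm v)\<^sup>2"
    using pos_part_square_taylor[of t s] sq by linarith
  then show ?thesis using True by simp
qed

lemma integrable_compact_support:
  fixes h :: "'a::euclidean_space \<Rightarrow> 'b::{banach, second_countable_topology}"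
  assumes "continuous_on UNIV h" "\<And>z. norm z > R \<Longrightarrow> h z = 0"
  shows "integrable lborel h"
proof -
  have "integrable lborel (\<lambda>z. indicator (cball 0 R) z *\<^sub>R h z)"
    using assms(1) by (intro borel_integrable_compact) (auto intro: continuous_on_subset)
  also have "(\<lambda>z. indicator (cball 0 R) z *\<^sub>R h z) = h"
    using assms(2) by (auto simp: indicator_def not_le)
  finally show ?thesis .
qed

lemma lborel_integral_translate:
  fixes h :: "'a::euclidean_space \<Rightarrow> 'b::{banach, second_countable_topology}"
  assumes "h \<in> borel_measurable borel"
  shows "(\<integral>z. h (v + z) \<partial>lborel) = (\<integral>z. h z \<partial>lborel)"
proof -
  have "(\<integral>z. h z \<partial>distr lborel borel ((+) v)) = (\<integral>z. h (v + z) \<partial>lborel)"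
    using assms by (intro integral_distr) auto
  then show ?thesis by (simp add: lborel_distr_plus)
qed

lemma norm_integral_le_cball:
  fixes h :: "'a::euclidean_space \<Rightarrow> 'b::euclidean_space"
  assumes "integrable lborel h" "\<And>z. norm (h z) \<le> B * indicator (cball 0 R) z"
  shows "norm (\<integral>z. h z \<partial>lborel) \<le> B * measure lborel (cball (0::'a) R)"
proof -
  have "norm (\<integral>z. h z \<partial>lborel) \<le> (\<integral>z. norm (h z) \<partial>lborel)" by (rule integral_norm_bound)
  also have "\<dots> \<le> (\<integral>z. B * indicator (cball 0 R) z \<partial>(lborel :: 'a measure))"
    using assms by (intro integral_mono integrable_norm integrable_mult_right)
      (auto simp: integrable_indicator_iff emeasure_bounded_finite[unfolded infinity_ennreal_def])
  also have "\<dots> = B * measure lborel (cball (0::'a) R)" by simp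
  finally show ?thesis .
qed

lemma bump_integral_pos: "(\<integral>z. bump z \<partial>(lborel :: 'a::euclidean_space measure)) > 0"
proof -
  have int: "integrable (lborel :: 'a measure) bump"
    by (intro integrable_compact_support[of _ 1] continuous_intros) (simp add: bump_outside)
  have "0 < (9 / 16) * measure lborel (ball (0::'a) (1/2))" by (simp add: content_ball_pos)
  also have "\<dots> = (\<integral>z. (9 / 16) * indicator (ball 0 (1/2)) z \<partial>(lborel :: 'a measure))" by simp
  also have "\<dots> \<le> (\<integral>z. bump z \<partial>(lborel :: 'a measure))"
  proof (rule integral_mono)
    show "integrable lborel (\<lambda>z. (9 / 16) * indicat_real (ball (0::'a) (1/2)) z)"
      by (intro integrable_mult_right) (auto simp: integrable_indicator_iff emeasure_bounded_finite[unfolded infinity_ennreal_def])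
    fix z :: 'a
    show "(9 / 16) * indicator (ball 0 (1/2)) z \<le> bump z"
    proof (cases "norm z < 1/2")
      case True
      then have "(norm z)\<^sup>2 \<le> (1/2)\<^sup>2" by (intro power_mono) auto
      then have "3 / 4 \<le> 1 - (norm z)\<^sup>2" by (simp add: power2_eq_square)
      then have "(3 / 4)\<^sup>2 \<le> (max 0 (1 - (norm z)\<^sup>2))\<^sup>2" by (intro power_mono) auto
      then show ?thesis using True by (simp add: bump_def power2_eq_square)
    qed (simp add: bump_nonneg)
  qed (rule int)
  finally show ?thesis .
qed

text \<open>Mollification at scale 1. In the remainder of \<open>G\<close>, the increment is moved from \<open>F\<close> to the bump by a
translation of the integration variable. Since the bump has the same integral everywhere, \<open>F\<close> may be
replaced by \<open>F - F x\<close>, which is at most \<open>2 L\<close> on the relevant ball; so the constant is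
proportional to \<open>L\<close>. For increments longer than 1 the Lipschitz bounds alone suffice.\<close>

lemma mollification_unit:
  obtains \<kappa> :: real where "\<kappa> > 0"
    "\<forall>L (F :: 'a::euclidean_space \<Rightarrow> 'b::euclidean_space). L \<ge> 0 \<longrightarrow> (\<forall>x y. norm (F x - F y) \<le> L * norm (x - y)) \<longrightarrow>
       (\<exists>G D. (\<forall>x. norm (G x - F x) \<le> L) \<and> (\<forall>x y. norm (G x - G y) \<le> L * norm (x - y)) \<and>
         (\<forall>B. (\<forall>x. norm (F x) \<le> B) \<longrightarrow> (\<forall>x. norm (G x) \<le> B)) \<and> quad_approx (\<kappa> * L) G D)"
proof
  define c0 where "c0 = (\<integral>z. bump z \<partial>(lborel :: 'a measure))"
  define V where "V = measure lborel (cball (0::'a) 2)"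
  \<comment> \<open>enough for short increments, \<open>54 = 2 * 27\<close> (bump remainder times \<open>2 L\<close>), and for long ones, \<open>1 + 4 * V / c0\<close>\<close>
  define \<kappa> where "\<kappa> = 1 + 58 * V / c0"
  have c0: "c0 > 0" unfolding c0_def by (rule bump_integral_pos)
  have V: "V \<ge> 0" by (simp add: V_def)
  show "\<kappa> > 0" using c0 V by (simp add: \<kappa>_def add_pos_nonneg)
  show "\<forall>L (F :: 'a \<Rightarrow> 'b). L \<ge> 0 \<longrightarrow> (\<forall>x y. norm (F x - F y) \<le> L * norm (x - y)) \<longrightarrow>
       (\<exists>G D. (\<forall>x. norm (G x - F x) \<le> L) \<and> (\<forall>x y. norm (G x - G y) \<le> L * norm (x - y)) \<and>
         (\<forall>B. (\<forall>x. norm (F x) \<le> B) \<longrightarrow> (\<forall>x. norm (G x) \<le> B)) \<and> quad_approx (\<kappa> * L) G D)"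
  proof (intro allI impI)
    fix L :: real and F :: "'a \<Rightarrow> 'b"
    assume L: "L \<ge> 0" and lip': "\<forall>x y. norm (F x - F y) \<le> L * norm (x - y)"
    then have lip: "norm (F x - F y) \<le> L * norm (x - y)" for x y by blast
    have "L-lipschitz_on UNIV F" using L lip by (auto simp: lipschitz_on_def dist_norm)
    then have contF: "continuous_on S F" for S
      using lipschitz_on_continuous_on continuous_on_subset by blast
    note contF' = continuous_on_compose2[OF contF[of UNIV]]
    have cb: "continuous_on UNIV (\<lambda>z. bump (z - v))" for v :: 'a
      by (intro continuous_on_compose2[OF continuous_bump[of UNIV]] continuous_intros) auto
    have ib: "integrable lborel (\<lambda>z. bump (z - v) *\<^sub>R H z)" if "continuous_on UNIV H"
      for v :: 'a and H :: "'a \<Rightarrow> 'c::euclidean_space"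
    proof (rule integrable_compact_support[of _ "norm v + 1"])
      show "continuous_on UNIV (\<lambda>z. bump (z - v) *\<^sub>R H z)" using cb that by (intro continuous_intros)
      fix z :: 'a assume "norm v + 1 < norm z"
      then have "norm (z - v) \<ge> 1" using norm_triangle_ineq2[of z v] by simp
      then show "bump (z - v) *\<^sub>R H z = 0" by (simp add: bump_outside)
    qed
    have id: "integrable lborel (\<lambda>z. bump_deriv z v *\<^sub>R H z)" if "continuous_on UNIV H"
      for v :: 'a and H :: "'a \<Rightarrow> 'b"
      using that continuous_bump_deriv
      by (intro integrable_compact_support[of _ 1] continuous_intros) (auto simp: bump_deriv_outside)
    have ib0: "integrable lborel (\<lambda>z. bump z *\<^sub>R H z)" if "continuous_on UNIV H"
      for H :: "'a \<Rightarrow> 'c::euclidean_space"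
      using ib[OF that, of 0] by simp
    have mass: "(\<integral>z. bump (z - v) \<partial>lborel) = c0" for v :: 'a
      using lborel_integral_translate[of "\<lambda>z. bump (z - v)" v] cb[of v]
      by (simp add: c0_def borel_measurable_continuous_onI)
    have cont_shift: "continuous_on UNIV (\<lambda>z. F (x + z))" for x
      by (intro contF' continuous_intros) auto
    define G where "G x = (1 / c0) *\<^sub>R (\<integral>z. bump z *\<^sub>R F (x + z) \<partial>lborel)" for x
    define D where "D x v = - (1 / c0) *\<^sub>R (\<integral>z. bump_deriv z v *\<^sub>R (F (x + z) - F x) \<partial>lborel)" for x v
    \<comment> \<open>an average against the normalized bump obeys any bound that holds on the unit ball\<close>
    have avg: "norm ((1 / c0) *\<^sub>R (\<integral>z. bump z *\<^sub>R H z \<partial>lborel)) \<le> B"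
      if H: "continuous_on UNIV H" and B: "\<And>z. norm z \<le> 1 \<Longrightarrow> norm (H z) \<le> B" for H :: "'a \<Rightarrow> 'b" and B
    proof -
      have "norm (\<integral>z. bump z *\<^sub>R H z \<partial>lborel) \<le> (\<integral>z. norm (bump z *\<^sub>R H z) \<partial>lborel)"
        by (rule integral_norm_bound)
      also have "\<dots> \<le> (\<integral>z. bump z * B \<partial>(lborel :: 'a measure))"
      proof (rule integral_mono)
        show "integrable lborel (\<lambda>z. norm (bump z *\<^sub>R H z))" by (intro integrable_norm ib0 H)
        show "integrable (lborel :: 'a measure) (\<lambda>z. bump z * B)" using ib0[of "\<lambda>_. B"] by simp
        fix z :: 'a
        show "norm (bump z *\<^sub>R H z) \<le> bump z * B"
          using B[of z] bump_outside[of z] bump_nonneg[of z] by (cases "norm z \<le> 1") (auto intro: mult_left_mono)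
      qed
      also have "\<dots> = c0 * B" by (simp add: c0_def)
      finally show ?thesis using c0 by (simp add: pos_divide_le_eq mult.commute)
    qed
    have Gdiff: "G y - u = (1 / c0) *\<^sub>R (\<integral>z. bump z *\<^sub>R (F (y + z) - u) \<partial>lborel)" for y u
    proof -
      have "(\<integral>z. bump z *\<^sub>R (F (y + z) - u) \<partial>lborel) = (\<integral>z. bump z *\<^sub>R F (y + z) \<partial>lborel) - (\<integral>z. bump z *\<^sub>R u \<partial>(lborel :: 'a measure))"
        unfolding scaleR_diff_right
        by (intro Bochner_Integration.integral_diff ib0 cont_shift continuous_intros)
      also have "(\<integral>z. bump z *\<^sub>R u \<partial>(lborel :: 'a measure)) = c0 *\<^sub>R u"
        unfolding c0_def using ib0[of "\<lambda>_. 1 :: real"] by (intro integral_scaleR_left) simp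
      finally show ?thesis using c0 by (simp add: G_def scaleR_diff_right)
    qed
    have near: "norm (G x - F x) \<le> L" for x
      unfolding Gdiff
    proof (rule avg)
      fix z :: 'a assume "norm z \<le> 1"
      then show "norm (F (x + z) - F x) \<le> L"
        using lip[of "x + z" x] mult_left_mono[of "norm z" 1 L] L by simp
    qed (intro continuous_intros cont_shift)
    have lipG: "norm (G x - G y) \<le> L * norm (x - y)" for x y
    proof -
      have "G x - G y = (1 / c0) *\<^sub>R (\<integral>z. bump z *\<^sub>R (F (x + z) - F (y + z)) \<partial>lborel)"
        unfolding scaleR_diff_right G_def
        by (subst Bochner_Integration.integral_diff) (auto intro!: ib0 cont_shift simp: scaleR_diff_right)
      moreover have "norm \<dots> \<le> L * norm (x - y)"
      proof (intro avg continuous_intros cont_shift)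
        fix z show "norm (F (x + z) - F (y + z)) \<le> L * norm (x - y)" using lip[of "x + z" "y + z"] by simp
      qed
      ultimately show ?thesis by simp
    qed
    have bdG: "norm (G x) \<le> B" if "\<And>x. norm (F x) \<le> B" for B x
      unfolding G_def using that by (intro avg cont_shift)
    have linD: "linear (D x)" for x
    proof (rule linearI)
      have H: "continuous_on UNIV (\<lambda>z. F (x + z) - F x)" by (intro continuous_intros cont_shift)
      show "D x (u + v) = D x u + D x v" for u v
      proof -
        have "bump_deriv z (u + v) *\<^sub>R (F (x + z) - F x) = bump_deriv z u *\<^sub>R (F (x + z) - F x) + bump_deriv z v *\<^sub>R (F (x + z) - F x)" for z
          unfolding scaleR_add_left[symmetric] by (simp add: bump_deriv_def inner_add_right distrib_left)
        then show ?thesis using id[OF H] by (simp add: D_def scaleR_add_right scaleR_diff_right)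
      qed
      show "D x (r *\<^sub>R v) = r *\<^sub>R D x v" for r v
      proof -
        have "bump_deriv z (r *\<^sub>R v) *\<^sub>R (F (x + z) - F x) = r *\<^sub>R (bump_deriv z v *\<^sub>R (F (x + z) - F x))" for z
          by (simp add: bump_deriv_def mult_ac)
        then show ?thesis unfolding D_def by (simp only: integral_scaleR_right scaleR_left_commute)
      qed
    qed
    have rem: "norm (G (x + v) - G x - D x v) \<le> \<kappa> * L * (norm v)\<^sup>2" for x v
    proof (cases "norm v \<le> 1")
      case True
      let ?H = "\<lambda>z. F (x + z) - F x"
      let ?r = "\<lambda>z. bump (z - v) - bump z + bump_deriv z v"
      have H: "continuous_on UNIV ?H" by (intro continuous_intros cont_shift)
      have "G (x + v) - F x = (1 / c0) *\<^sub>R (\<integral>z. bump z *\<^sub>R (F (x + (v + z)) - F x) \<partial>lborel)"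
        by (simp add: Gdiff add.assoc)
      also have "(\<integral>z. bump z *\<^sub>R (F (x + (v + z)) - F x) \<partial>lborel) = (\<integral>z. bump (z - v) *\<^sub>R ?H z \<partial>lborel)"
      proof -
        have "continuous_on UNIV (\<lambda>z. bump (z - v) *\<^sub>R ?H z)" by (rule continuous_on_scaleR[OF cb H])
        then show ?thesis
          using lborel_integral_translate[of "\<lambda>z. bump (z - v) *\<^sub>R ?H z" v] by (simp add: borel_measurable_continuous_onI)
      qed
      finally have 1: "G (x + v) - F x = (1 / c0) *\<^sub>R (\<integral>z. bump (z - v) *\<^sub>R ?H z \<partial>lborel)" .
      have "G (x + v) - G x - D x v = (G (x + v) - F x) - (G x - F x) - D x v" by simp
      also have "\<dots> = (1 / c0) *\<^sub>R ((\<integral>z. bump (z - v) *\<^sub>R ?H z \<partial>lborel) - (\<integral>z. bump z *\<^sub>R ?H z \<partial>lborel) + (\<integral>z. bump_deriv z v *\<^sub>R ?H z \<partial>lborel))"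
        unfolding 1 Gdiff[of x "F x"] D_def by (simp add: scaleR_diff_right scaleR_add_right)
      also have "\<dots> = (1 / c0) *\<^sub>R (\<integral>z. ?r z *\<^sub>R ?H z \<partial>lborel)"
        using ib[OF H, of v] ib0[OF H] id[OF H, of v] by (simp add: scaleR_add_left scaleR_diff_left)
      finally have eq: "G (x + v) - G x - D x v = (1 / c0) *\<^sub>R (\<integral>z. ?r z *\<^sub>R ?H z \<partial>lborel)" .
      have "norm (\<integral>z. ?r z *\<^sub>R ?H z \<partial>lborel) \<le> (54 * L * (norm v)\<^sup>2) * measure lborel (cball (0::'a) 2)"
      proof (rule norm_integral_le_cball)
        show "integrable lborel (\<lambda>z. ?r z *\<^sub>R ?H z)"
          unfolding scaleR_add_left scaleR_diff_left
          by (intro Bochner_Integration.integrable_add Bochner_Integration.integrable_diff ib[OF H] ib0[OF H] id[OF H])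
        fix z :: 'a
        have r: "\<bar>?r z\<bar> \<le> 27 * (norm v)\<^sup>2 * indicator (cball 0 2) z"
          using bump_taylor[of "- v" z] True by (simp add: bump_deriv_def)
        show "norm (?r z *\<^sub>R ?H z) \<le> 54 * L * (norm v)\<^sup>2 * indicator (cball 0 2) z"
        proof (cases "norm z \<le> 2")
          case True
          have "norm (?H z) \<le> L * 2" using lip[of "x + z" x] mult_left_mono[OF True L] by simp
          then have "\<bar>?r z\<bar> * norm (?H z) \<le> (27 * (norm v)\<^sup>2) * (L * 2)"
            using r True by (intro mult_mono) auto
          then show ?thesis using True by (simp add: mult_ac)
        qed (use r in simp)
      qed
      then have "norm (G (x + v) - G x - D x v) \<le> (1 / c0) * ((54 * L * (norm v)\<^sup>2) * V)"
        unfolding eq using c0 by (simp add: V_def divide_right_mono)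
      also have "\<dots> = (54 * V / c0) * (L * (norm v)\<^sup>2)" by (simp add: field_simps)
      also have "\<dots> \<le> \<kappa> * (L * (norm v)\<^sup>2)"
      proof (rule mult_right_mono)
        have "54 * V / c0 \<le> 58 * V / c0" using c0 V by (intro divide_right_mono) auto
        then show "54 * V / c0 \<le> \<kappa>" by (simp add: \<kappa>_def)
      qed (use L in simp)
      finally show ?thesis by (simp add: mult.assoc)
    next
      case False
      have v: "norm v \<le> (norm v)\<^sup>2" using False by (simp add: power2_eq_square mult_le_cancel_left1)
      have "norm (\<integral>z. bump_deriv z v *\<^sub>R (F (x + z) - F x) \<partial>lborel) \<le> (4 * L * norm v) * measure lborel (cball (0::'a) 2)"
      proof (rule norm_integral_le_cball)
        show "integrable lborel (\<lambda>z. bump_deriv z v *\<^sub>R (F (x + z) - F x))"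
          by (intro id continuous_intros cont_shift)
        fix z :: 'a
        show "norm (bump_deriv z v *\<^sub>R (F (x + z) - F x)) \<le> 4 * L * norm v * indicator (cball 0 2) z"
        proof (cases "norm z \<le> 1")
          case True
          have "\<bar>z \<bullet> v\<bar> \<le> 1 * norm v"
            using Cauchy_Schwarz_ineq2[of z v] mult_right_mono[OF True, of "norm v"] by simp
          then have "\<bar>bump_deriv z v\<bar> \<le> (4 * 1) * (1 * norm v)"
            unfolding bump_deriv_def abs_mult by (intro mult_mono) auto
          moreover have "norm (F (x + z) - F x) \<le> L * 1"
            using lip[of "x + z" x] mult_left_mono[OF True L] by simp
          ultimately have "\<bar>bump_deriv z v\<bar> * norm (F (x + z) - F x) \<le> (4 * norm v) * L"
            by (intro mult_mono) auto
          then show ?thesis using True by (simp add: mult_ac)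
        next
          case False
          then show ?thesis using L by (simp add: bump_deriv_outside)
        qed
      qed
      then have "norm (D x v) \<le> (1 / c0) * ((4 * L * norm v) * V)"
        unfolding D_def using c0 by (simp add: V_def divide_right_mono)
      also have "\<dots> = (4 * V / c0) * L * norm v" by (simp add: field_simps)
      finally have "norm (D x v) \<le> (4 * V / c0) * L * norm v" .
      moreover have "norm (G (x + v) - G x) \<le> L * norm v" using lipG[of "x + v" x] by simp
      ultimately have "norm (G (x + v) - G x - D x v) \<le> (1 + 4 * V / c0) * (L * norm v)"
        using norm_triangle_ineq4[of "G (x + v) - G x" "D x v"] by (simp add: algebra_simps)
      also have "\<dots> \<le> \<kappa> * (L * (norm v)\<^sup>2)"
      proof (intro mult_mono mult_left_mono)
        have "4 * V / c0 \<le> 58 * V / c0" using c0 V by (intro divide_right_mono) auto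
        then show "1 + 4 * V / c0 \<le> \<kappa>" by (simp add: \<kappa>_def)
      qed (use L v \<open>\<kappa> > 0\<close> in auto)
      finally show ?thesis by (simp add: mult.assoc)
    qed
    have "quad_approx (\<kappa> * L) G D"
      unfolding quad_approx_def using linD rem[of _ "_ - _"] by (metis add.commute diff_add_cancel)
    then show "\<exists>G D. (\<forall>x. norm (G x - F x) \<le> L) \<and> (\<forall>x y. norm (G x - G y) \<le> L * norm (x - y)) \<and>
           (\<forall>B. (\<forall>x. norm (F x) \<le> B) \<longrightarrow> (\<forall>x. norm (G x) \<le> B)) \<and> quad_approx (\<kappa> * L) G D"
      using near lipG bdG by blast
  qed
qed

text \<open>\<open>F\<close> can be approximated at every scale \<open>\<epsilon>\<close> with remainder constant \<open>\<kappa> L / \<epsilon>\<close>, keeping its Lipschitz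
constant and its bounds.\<close>

definition mollifiable :: "real \<Rightarrow> ('a::euclidean_space \<Rightarrow> 'b::euclidean_space) \<Rightarrow> bool" where
  "mollifiable \<kappa> F \<longleftrightarrow> (\<forall>L \<epsilon>. L \<ge> 0 \<longrightarrow> \<epsilon> > 0 \<longrightarrow> (\<forall>x y. norm (F x - F y) \<le> L * norm (x - y)) \<longrightarrow>
     (\<exists>G D. (\<forall>x. norm (G x - F x) \<le> L * \<epsilon>) \<and> (\<forall>x y. norm (G x - G y) \<le> L * norm (x - y)) \<and>
       (\<forall>B. (\<forall>x. norm (F x) \<le> B) \<longrightarrow> (\<forall>x. norm (G x) \<le> B)) \<and> quad_approx (\<kappa> / \<epsilon> * L) G D))"

text \<open>Rescaling: \<open>F\<close> on the scale \<open>\<epsilon>\<close> is a function with Lipschitz constant \<open>L \<epsilon>\<close> on the scale 1, and scaling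
back divides the quadratic constant by \<open>\<epsilon>\<^sup>2\<close>.\<close>

lemma mollification:
  obtains \<kappa> :: real where "\<kappa> > 0" "\<And>F :: 'a::euclidean_space \<Rightarrow> 'b::euclidean_space. mollifiable \<kappa> F"
proof -
  obtain \<kappa> :: real where \<kappa>: "\<kappa> > 0"
    and moll: "\<forall>L (F :: 'a \<Rightarrow> 'b). L \<ge> 0 \<longrightarrow> (\<forall>x y. norm (F x - F y) \<le> L * norm (x - y)) \<longrightarrow>
       (\<exists>G D. (\<forall>x. norm (G x - F x) \<le> L) \<and> (\<forall>x y. norm (G x - G y) \<le> L * norm (x - y)) \<and>
         (\<forall>B. (\<forall>x. norm (F x) \<le> B) \<longrightarrow> (\<forall>x. norm (G x) \<le> B)) \<and> quad_approx (\<kappa> * L) G D)"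
    using mollification_unit[where 'a = 'a and 'b = 'b] .
  have "\<exists>G D. (\<forall>x. norm (G x - F x) \<le> L * \<epsilon>) \<and> (\<forall>x y. norm (G x - G y) \<le> L * norm (x - y)) \<and>
         (\<forall>B. (\<forall>x. norm (F x) \<le> B) \<longrightarrow> (\<forall>x. norm (G x) \<le> B)) \<and> quad_approx (\<kappa> / \<epsilon> * L) G D"
    if L: "L \<ge> 0" and \<epsilon>: "\<epsilon> > 0" and lip: "\<And>x y. norm (F x - F y) \<le> L * norm (x - y)" for L \<epsilon> and F :: "'a \<Rightarrow> 'b"
  proof -
    have "norm (F (\<epsilon> *\<^sub>R x) - F (\<epsilon> *\<^sub>R y)) \<le> (L * \<epsilon>) * norm (x - y)" for x y
      using lip[of "\<epsilon> *\<^sub>R x" "\<epsilon> *\<^sub>R y"] \<epsilon> by (simp add: mult_ac flip: scaleR_diff_right)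
    with moll[rule_format, of "L * \<epsilon>" "\<lambda>x. F (\<epsilon> *\<^sub>R x)"] L \<epsilon>
    obtain G D where G: "\<And>x. norm (G x - F (\<epsilon> *\<^sub>R x)) \<le> L * \<epsilon>" "\<And>x y. norm (G x - G y) \<le> (L * \<epsilon>) * norm (x - y)"
      "\<And>B. (\<forall>x. norm (F (\<epsilon> *\<^sub>R x)) \<le> B) \<longrightarrow> (\<forall>x. norm (G x) \<le> B)" and q: "quad_approx (\<kappa> * (L * \<epsilon>)) G D"
      by auto
    let ?s = "\<lambda>x. (1 / \<epsilon>) *\<^sub>R x"
    have "norm (G (?s x) - F x) \<le> L * \<epsilon>" for x using G(1)[of "?s x"] \<epsilon> by simp
    moreover have "norm (G (?s x) - G (?s y)) \<le> L * norm (x - y)" for x y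
      using G(2)[of "?s x" "?s y"] \<epsilon> by (simp flip: scaleR_diff_right)
    moreover have "norm (G (?s x)) \<le> B" if "\<forall>x. norm (F x) \<le> B" for B x
      using G(3)[of B] that by simp
    moreover have "quad_approx (\<kappa> / \<epsilon> * L) (\<lambda>x. G (?s x)) (\<lambda>x v. D (?s x) (?s v))"
      unfolding quad_approx_def
    proof (intro conjI allI)
      fix x y
      have "linear (D (?s x) \<circ> ?s)"
        using q by (intro linear_compose) (auto simp: quad_approx_def intro: linear_scale_self)
      then show "linear (\<lambda>v. D (?s x) (?s v))" by (simp add: o_def)
      have "norm (G (?s y) - G (?s x) - D (?s x) (?s y - ?s x)) \<le> \<kappa> * (L * \<epsilon>) * (norm (?s y - ?s x))\<^sup>2"
        using q by (simp add: quad_approx_def)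
      also have "\<dots> = \<kappa> / \<epsilon> * L * (norm (y - x))\<^sup>2"
        using \<epsilon> by (simp add: power_divide power2_eq_square flip: scaleR_diff_right)
      finally show "norm (G (?s y) - G (?s x) - D (?s x) (?s (y - x))) \<le> \<kappa> / \<epsilon> * L * (norm (y - x))\<^sup>2"
        by (simp add: scaleR_diff_right)
    qed
    ultimately show ?thesis by (intro exI[of _ "\<lambda>x. G (?s x)"] exI[of _ "\<lambda>x v. D (?s x) (?s v)"]) blast
  qed
  then have "mollifiable \<kappa> F" for F :: "'a \<Rightarrow> 'b" unfolding mollifiable_def by blast
  then show thesis using that \<kappa> by blast
qed

lemma mollifiableD:
  assumes "mollifiable \<kappa> F" "L \<ge> 0" "\<epsilon> > 0" "\<And>x y. norm (F x - F y) \<le> L * norm (x - y)"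
  obtains G D where "\<And>x. norm (G x - F x) \<le> L * \<epsilon>" "\<And>x y. norm (G x - G y) \<le> L * norm (x - y)"
    "\<And>B x. \<forall>x. norm (F x) \<le> B \<Longrightarrow> norm (G x) \<le> B" "quad_approx (\<kappa> / \<epsilon> * L) G D"
proof -
  from assms(1)[unfolded mollifiable_def, rule_format, OF assms(2,3)] assms(4)
  obtain G D where G: "\<forall>x. norm (G x - F x) \<le> L * \<epsilon>" "\<forall>x y. norm (G x - G y) \<le> L * norm (x - y)"
    "\<forall>B. (\<forall>x. norm (F x) \<le> B) \<longrightarrow> (\<forall>x. norm (G x) \<le> B)" and q: "quad_approx (\<kappa> / \<epsilon> * L) G D"
    by blast
  show thesis by (rule that[OF _ _ _ q]) (use G in auto)
qed

lemma quad_approx_mono: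
  "quad_approx A F D \<Longrightarrow> A \<le> B \<Longrightarrow> quad_approx B F D"
  unfolding quad_approx_def by (meson mult_right_mono order_trans zero_le_power2)

lemma mollifiable_mono:
  assumes F: "mollifiable \<kappa> F" and le: "\<kappa> \<le> \<kappa>'"
  shows "mollifiable \<kappa>' F"
  unfolding mollifiable_def
proof (intro allI impI)
  fix L \<epsilon> :: real assume L: "0 \<le> L" and \<epsilon>: "0 < \<epsilon>" and lip: "\<forall>x y. norm (F x - F y) \<le> L * norm (x - y)"
  from F[unfolded mollifiable_def, rule_format, OF L \<epsilon>] lip
  obtain G D where G: "\<forall>x. norm (G x - F x) \<le> L * \<epsilon>" "\<forall>x y. norm (G x - G y) \<le> L * norm (x - y)"
    "\<forall>B. (\<forall>x. norm (F x) \<le> B) \<longrightarrow> (\<forall>x. norm (G x) \<le> B)" and q: "quad_approx (\<kappa> / \<epsilon> * L) G D"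
    by blast
  have "\<kappa> / \<epsilon> * L \<le> \<kappa>' / \<epsilon> * L" using le L \<epsilon> by (intro mult_right_mono divide_right_mono) auto
  from G quad_approx_mono[OF q this]
  show "\<exists>G D. (\<forall>x. norm (G x - F x) \<le> L * \<epsilon>) \<and> (\<forall>x y. norm (G x - G y) \<le> L * norm (x - y)) \<and>
       (\<forall>B. (\<forall>x. norm (F x) \<le> B) \<longrightarrow> (\<forall>x. norm (G x) \<le> B)) \<and> quad_approx (\<kappa>' / \<epsilon> * L) G D"
    by blast
qed

section \<open>Functions with a quadratic first-order remainder\<close>

definition has_quad_gradient :: "real \<Rightarrow> ('a::euclidean_space \<Rightarrow> real) \<Rightarrow> ('a \<Rightarrow> 'a) \<Rightarrow> bool" where
  "has_quad_gradient A \<phi> p \<longleftrightarrow> (\<forall>x y. \<bar>\<phi> y - \<phi> x - p x \<bullet> (y - x)\<bar> \<le> A * (norm (y - x))\<^sup>2)"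

lemma has_quad_gradientD:
  "has_quad_gradient A \<phi> p \<Longrightarrow> \<bar>\<phi> y - \<phi> x - p x \<bullet> (y - x)\<bar> \<le> A * (norm (y - x))\<^sup>2"
  by (simp add: has_quad_gradient_def)

lemma has_quad_gradient_mono:
  "has_quad_gradient A \<phi> p \<Longrightarrow> A \<le> B \<Longrightarrow> has_quad_gradient B \<phi> p"
  unfolding has_quad_gradient_def by (meson mult_right_mono order_trans zero_le_power2)

lemma quad_approx_real_gradient:
  fixes \<phi> :: "'a::euclidean_space \<Rightarrow> real"
  assumes "quad_approx A \<phi> D"
  obtains p where "has_quad_gradient A \<phi> p"
proof
  have "adjoint (D x) 1 \<bullet> v = D x v" for x v
    using assms adjoint_clauses(2)[of "D x" 1 v] by (simp add: quad_approx_def)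
  then show "has_quad_gradient A \<phi> (\<lambda>x. adjoint (D x) 1)"
    using assms by (auto simp: has_quad_gradient_def quad_approx_def)
qed

text \<open>Apply the remainder estimate to a step of length \<open>s\<close> along \<open>p x\<close> and let \<open>s\<close> tend to 0.\<close>

lemma quad_gradient_norm_le:
  fixes \<phi> :: "'a::euclidean_space \<Rightarrow> real"
  assumes q: "has_quad_gradient A \<phi> p" and lip: "\<And>x y. \<bar>\<phi> x - \<phi> y\<bar> \<le> L * norm (x - y)"
  shows "norm (p x) \<le> L"
proof (cases "p x = 0")
  case True
  obtain i :: 'a where "i \<in> Basis" using nonempty_Basis by blast
  then have "0 \<le> L" using lip[of i 0] abs_ge_zero[of "\<phi> i - \<phi> 0"] by simp
  then show ?thesis using True by simp
next
  case False
  let ?n = "norm (p x)"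
  have n: "?n > 0" using False by simp
  have le: "?n \<le> L + A * s" if s: "s > 0" for s
  proof -
    define v where "v = (s / ?n) *\<^sub>R p x"
    have nv: "norm v = s" using n s by (simp add: v_def)
    have pv: "p x \<bullet> v = s * ?n" using n by (simp add: v_def power2_norm_eq_inner[symmetric] power2_eq_square)
    have "s * ?n \<le> L * s + A * s\<^sup>2"
      using has_quad_gradientD[OF q, of "x + v" x] lip[of "x + v" x] pv nv by (simp add: abs_le_iff)
    then have "s * ?n \<le> s * (L + A * s)" by (simp add: algebra_simps power2_eq_square)
    then show ?thesis using s by simp
  qed
  show ?thesis
  proof (rule field_le_epsilon)
    fix e :: real assume e: "e > 0"
    have "A * (e / (\<bar>A\<bar> + 1)) \<le> e"
      using e mult_right_mono[of A "\<bar>A\<bar> + 1" e] by (simp add: pos_divide_le_eq mult.commute)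
    then show "?n \<le> L + e" using le[of "e / (\<bar>A\<bar> + 1)"] e by (smt (verit) divide_pos_pos)
  qed
qed

text \<open>Compare the expansions of \<open>\<phi>\<close> at \<open>x\<close> and at \<open>y\<close> in a third point \<open>z\<close>, at distance \<open>norm (x - y)\<close> from \<open>y\<close> in
the direction of \<open>p x - p y\<close>. The three remainders add up to \<open>4 A + A + A\<close> times the squared distance.\<close>

lemma quad_gradient_lipschitz:
  fixes \<phi> :: "'a::euclidean_space \<Rightarrow> real"
  assumes q: "has_quad_gradient A \<phi> p" and A: "A \<ge> 0"
  shows "norm (p x - p y) \<le> 6 * A * norm (x - y)"
proof (cases "p x = p y")
  case False
  let ?r = "norm (x - y)"
  define w where "w = p x - p y"
  have w: "norm w > 0" using False by (simp add: w_def)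
  define u where "u = (?r / norm w) *\<^sub>R w"
  have nu: "norm u = ?r" using w by (simp add: u_def)
  define z where "z = y + u"
  have wu: "(p x - p y) \<bullet> u = ?r * norm w"
    using w by (simp add: u_def w_def[symmetric] power2_norm_eq_inner[symmetric] power2_eq_square)
  have "norm (z - x) \<le> 2 * ?r"
    using norm_triangle_ineq[of "y - x" u] nu by (simp add: z_def norm_minus_commute algebra_simps)
  then have "(norm (z - x))\<^sup>2 \<le> (2 * ?r)\<^sup>2" by (intro power_mono) auto
  then have a: "A * (norm (z - x))\<^sup>2 \<le> A * (4 * ?r\<^sup>2)"
    using A by (intro mult_left_mono) (auto simp: power_mult_distrib)
  have "\<bar>\<phi> z - \<phi> x - p x \<bullet> (z - x)\<bar> \<le> A * (4 * ?r\<^sup>2)"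
    using has_quad_gradientD[OF q, of z x] a by linarith
  moreover have "\<bar>\<phi> z - \<phi> y - p y \<bullet> u\<bar> \<le> A * ?r\<^sup>2"
    using has_quad_gradientD[OF q, of z y] nu by (simp add: z_def)
  moreover have "\<bar>\<phi> y - \<phi> x - p x \<bullet> (y - x)\<bar> \<le> A * ?r\<^sup>2"
    using has_quad_gradientD[OF q, of y x] by (simp add: norm_minus_commute)
  moreover have "p x \<bullet> (z - x) = p x \<bullet> (y - x) + p x \<bullet> u"
    by (simp add: z_def inner_diff_right inner_add_right)
  ultimately have "p x \<bullet> u - p y \<bullet> u \<le> 6 * A * ?r\<^sup>2" by (simp add: abs_le_iff)
  then have "?r * norm w \<le> ?r * (6 * A * ?r)"
    using wu by (simp add: inner_diff_left power2_eq_square algebra_simps)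
  moreover have "?r > 0" using False by (cases "x = y") auto
  ultimately show ?thesis by (simp add: w_def)
qed (use A in simp)

lemma quad_gradient_has_derivative:
  fixes \<phi> :: "'a::euclidean_space \<Rightarrow> real"
  assumes q: "has_quad_gradient A \<phi> p"
  shows "(\<phi> has_derivative (\<lambda>v. p x \<bullet> v)) (at x)"
  unfolding has_derivative_at_alt
proof (intro conjI allI impI)
  show "bounded_linear (\<lambda>v. p x \<bullet> v)" by (rule bounded_linear_inner_right)
  fix e :: real assume e: "e > 0"
  show "\<exists>d>0. \<forall>y. norm (y - x) < d \<longrightarrow> norm (\<phi> y - \<phi> x - p x \<bullet> (y - x)) \<le> e * norm (y - x)"
  proof (intro exI[of _ "e / (\<bar>A\<bar> + 1)"] conjI allI impI)
    show "e / (\<bar>A\<bar> + 1) > 0" using e by (simp add: add_nonneg_pos)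
    fix y assume y: "norm (y - x) < e / (\<bar>A\<bar> + 1)"
    have "A * norm (y - x) \<le> (\<bar>A\<bar> + 1) * norm (y - x)" by (intro mult_right_mono) auto
    also have "\<dots> \<le> e" using y by (simp add: pos_less_divide_eq mult.commute)
    finally have "A * norm (y - x) * norm (y - x) \<le> e * norm (y - x)" by (intro mult_right_mono) auto
    then show "norm (\<phi> y - \<phi> x - p x \<bullet> (y - x)) \<le> e * norm (y - x)"
      using has_quad_gradientD[OF q, of y x] by (simp add: power2_eq_square mult.assoc)
  qed
qed

lemma quad_gradient_compose:
  fixes \<phi> :: "'a::euclidean_space \<Rightarrow> real" and F :: "'a \<Rightarrow> 'a"
  assumes q: "has_quad_gradient A \<phi> p" and A: "A \<ge> 0" and p: "\<And>x. norm (p x) \<le> P"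
    and F: "quad_approx B F D" and lip: "\<And>x y. norm (F x - F y) \<le> M * norm (x - y)"
  shows "has_quad_gradient (A * M\<^sup>2 + P * B) (\<lambda>x. \<phi> (F x)) (\<lambda>x. adjoint (D x) (p (F x)))"
  unfolding has_quad_gradient_def
proof (intro allI)
  fix x y :: 'a
  let ?n = "(norm (y - x))\<^sup>2"
  let ?R = "F y - F x - D x (y - x)"
  have lin: "linear (D x)" using F by (simp add: quad_approx_def)
  have "(norm (F y - F x))\<^sup>2 \<le> (M * norm (y - x))\<^sup>2" using lip[of y x] by (intro power_mono) auto
  then have 1: "\<bar>\<phi> (F y) - \<phi> (F x) - p (F x) \<bullet> (F y - F x)\<bar> \<le> A * M\<^sup>2 * ?n"
    using has_quad_gradientD[OF q, of "F y" "F x"] mult_left_mono[OF _ A]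
    by (fastforce simp: power_mult_distrib mult.assoc)
  have "norm (p (F x)) * norm ?R \<le> P * (B * ?n)"
    using p[of "F x"] F order_trans[OF norm_ge_zero p] by (intro mult_mono) (auto simp: quad_approx_def)
  then have 2: "\<bar>p (F x) \<bullet> ?R\<bar> \<le> P * B * ?n"
    using Cauchy_Schwarz_ineq2[of "p (F x)" ?R] by (simp add: mult.assoc)
  have "adjoint (D x) (p (F x)) \<bullet> (y - x) = p (F x) \<bullet> D x (y - x)"
    by (simp add: adjoint_clauses(2)[OF lin])
  then have "\<phi> (F y) - \<phi> (F x) - adjoint (D x) (p (F x)) \<bullet> (y - x)
    = (\<phi> (F y) - \<phi> (F x) - p (F x) \<bullet> (F y - F x)) + p (F x) \<bullet> ?R"
    by (simp add: inner_diff_right)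
  then show "\<bar>\<phi> (F y) - \<phi> (F x) - adjoint (D x) (p (F x)) \<bullet> (y - x)\<bar> \<le> (A * M\<^sup>2 + P * B) * ?n"
    using 1 2 by (simp add: distrib_right)
qed

lemma quad_gradient_mult:
  fixes \<phi> \<gamma> :: "'a::euclidean_space \<Rightarrow> real"
  assumes \<phi>: "has_quad_gradient A \<phi> p" "\<And>x. \<bar>\<phi> x\<bar> \<le> B" "\<And>x y. \<bar>\<phi> x - \<phi> y\<bar> \<le> L * norm (x - y)"
    and \<gamma>: "has_quad_gradient A' \<gamma> q" "\<And>x. \<bar>\<gamma> x\<bar> \<le> B'" "\<And>x y. \<bar>\<gamma> x - \<gamma> y\<bar> \<le> L' * norm (x - y)"
  shows "has_quad_gradient (A * B' + B * A' + L * L') (\<lambda>x. \<phi> x * \<gamma> x) (\<lambda>x. \<gamma> x *\<^sub>R p x + \<phi> x *\<^sub>R q x)"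
  unfolding has_quad_gradient_def
proof (intro allI)
  fix x y :: 'a
  let ?n = "norm (y - x)"
  have 1: "\<bar>\<phi> y - \<phi> x - p x \<bullet> (y - x)\<bar> * \<bar>\<gamma> x\<bar> \<le> (A * ?n\<^sup>2) * B'"
    using has_quad_gradientD[OF \<phi>(1), of y x] \<gamma>(2)[of x] by (intro mult_mono) auto
  have 2: "\<bar>\<phi> x\<bar> * \<bar>\<gamma> y - \<gamma> x - q x \<bullet> (y - x)\<bar> \<le> B * (A' * ?n\<^sup>2)"
    using has_quad_gradientD[OF \<gamma>(1), of y x] \<phi>(2)[of x] abs_ge_zero[of "\<phi> x"]
    by (intro mult_mono) (auto simp del: abs_ge_zero)
  have 3: "\<bar>\<phi> y - \<phi> x\<bar> * \<bar>\<gamma> y - \<gamma> x\<bar> \<le> (L * ?n) * (L' * ?n)"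
    using \<phi>(3)[of y x] \<gamma>(3)[of y x] abs_ge_zero[of "\<phi> y - \<phi> x"]
    by (intro mult_mono) (auto simp del: abs_ge_zero)
  have "\<phi> y * \<gamma> y - \<phi> x * \<gamma> x - (\<gamma> x *\<^sub>R p x + \<phi> x *\<^sub>R q x) \<bullet> (y - x)
    = (\<phi> y - \<phi> x - p x \<bullet> (y - x)) * \<gamma> x + \<phi> x * (\<gamma> y - \<gamma> x - q x \<bullet> (y - x)) + (\<phi> y - \<phi> x) * (\<gamma> y - \<gamma> x)"
    by (simp add: inner_add_left algebra_simps)
  also have "\<bar>\<dots>\<bar> \<le> \<bar>(\<phi> y - \<phi> x - p x \<bullet> (y - x)) * \<gamma> x\<bar> + \<bar>\<phi> x * (\<gamma> y - \<gamma> x - q x \<bullet> (y - x))\<bar> + \<bar>(\<phi> y - \<phi> x) * (\<gamma> y - \<gamma> x)\<bar>"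
    by linarith
  also have "\<dots> \<le> (A * ?n\<^sup>2) * B' + B * (A' * ?n\<^sup>2) + (L * ?n) * (L' * ?n)"
    using 1 2 3 unfolding abs_mult by linarith
  also have "\<dots> = (A * B' + B * A' + L * L') * ?n\<^sup>2" by (simp add: power2_eq_square algebra_simps)
  finally show "\<bar>\<phi> y * \<gamma> y - \<phi> x * \<gamma> x - (\<gamma> x *\<^sub>R p x + \<phi> x *\<^sub>R q x) \<bullet> (y - x)\<bar> \<le> (A * B' + B * A' + L * L') * ?n\<^sup>2" .
qed

text \<open>The test functions of the duality argument. Later \<open>A = \<kappa> / \<epsilon>\<close>.\<close>

definition potential :: "real \<Rightarrow> real \<Rightarrow> ('a::euclidean_space \<Rightarrow> real) \<Rightarrow> ('a \<Rightarrow> 'a) \<Rightarrow> bool" where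
  "potential b A \<phi> p \<longleftrightarrow> (\<forall>x. \<bar>\<phi> x\<bar> \<le> b) \<and> (\<forall>x y. \<bar>\<phi> x - \<phi> y\<bar> \<le> norm (x - y)) \<and> has_quad_gradient A \<phi> p"

lemma potentialD:
  assumes "potential b A \<phi> p"
  shows "\<bar>\<phi> x\<bar> \<le> b" "\<bar>\<phi> x - \<phi> y\<bar> \<le> norm (x - y)" "has_quad_gradient A \<phi> p"
  using assms by (auto simp: potential_def)

lemma potential_grad_norm:
  assumes "potential b A \<phi> p" shows "norm (p x) \<le> 1"
  using quad_gradient_norm_le[of A \<phi> p 1] potentialD[OF assms] by simp

text \<open>For \<open>h \<le> 1\<close>, the bound, the Lipschitz constant and the quadratic constant of a transported potential
each grow at most by the factor \<open>1 + h * transport_growth b Lf Cg Lg\<close>.\<close>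

definition transport_growth :: "real \<Rightarrow> real \<Rightarrow> real \<Rightarrow> real \<Rightarrow> real" where
  "transport_growth b Lf Cg Lg = (1 + Cg) * (1 + 3 * Lf + Lf\<^sup>2) + (b + 1 + Lf) * Lg"

text \<open>The class of potentials is almost invariant under a backward Euler step of transport along \<open>F\<close> with
growth rate \<open>\<gamma>\<close>. The coefficients have quadratic constants \<open>A Lf\<close> and \<open>A Lg\<close> of the same order as the potential
itself, so the growth factor does not involve \<open>A\<close>; products of Lipschitz constants are absorbed
using \<open>A \<ge> 1\<close>.\<close>

lemma potential_transport:
  fixes \<phi> :: "'a::euclidean_space \<Rightarrow> real"
  assumes \<phi>: "potential b A \<phi> p" and A: "A \<ge> 1" and b: "b \<ge> 0" and h: "0 \<le> h" "h \<le> 1"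
    and F: "quad_approx (A * Lf) F D" "\<And>x y. norm (F x - F y) \<le> Lf * norm (x - y)" and Lf: "Lf \<ge> 0"
    and \<gamma>: "has_quad_gradient (A * Lg) \<gamma> q" "\<And>x y. \<bar>\<gamma> x - \<gamma> y\<bar> \<le> Lg * norm (x - y)" "\<And>x. \<bar>\<gamma> x\<bar> \<le> Cg"
    and Lg: "Lg \<ge> 0"
  obtains p' where "potential b A (\<lambda>x. \<phi> (x + h *\<^sub>R F x) * (1 + h * \<gamma> x) / (1 + h * transport_growth b Lf Cg Lg)) p'"
proof -
  let ?E = "\<lambda>x. x + h *\<^sub>R F x"
  let ?K = "transport_growth b Lf Cg Lg"
  let ?\<psi> = "\<lambda>x. \<phi> (?E x) * (1 + h * \<gamma> x)"
  have Cg: "Cg \<ge> 0" using \<gamma>(3)[of 0] by linarith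
  have lipE: "norm (?E x - ?E y) \<le> (1 + h * Lf) * norm (x - y)" for x y
  proof -
    have "norm (?E x - ?E y) \<le> norm (x - y) + norm (h *\<^sub>R (F x - F y))"
      using norm_triangle_ineq[of "x - y" "h *\<^sub>R (F x - F y)"] by (simp add: algebra_simps)
    also have "\<dots> \<le> norm (x - y) + h * (Lf * norm (x - y))"
      using F(2)[of x y] h by (simp add: mult_left_mono)
    finally show ?thesis by (simp add: algebra_simps)
  qed
  have qE: "quad_approx (h * (A * Lf)) ?E (\<lambda>x v. v + h *\<^sub>R D x v)"
    unfolding quad_approx_def
  proof (intro conjI allI)
    fix x y :: 'a
    show "linear (\<lambda>v. v + h *\<^sub>R D x v)"
      using F(1) by (intro linear_compose_add linear_compose_scale_right linear_ident) (auto simp: quad_approx_def linear_id)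
    have "?E y - ?E x - (y - x + h *\<^sub>R D x (y - x)) = h *\<^sub>R (F y - F x - D x (y - x))"
      by (simp add: algebra_simps)
    then show "norm (?E y - ?E x - (y - x + h *\<^sub>R D x (y - x))) \<le> h * (A * Lf) * (norm (y - x))\<^sup>2"
      using F(1) h by (simp add: quad_approx_def mult.assoc mult_left_mono)
  qed
  have q1: "has_quad_gradient (A * (1 + h * Lf)\<^sup>2 + 1 * (h * (A * Lf))) (\<lambda>x. \<phi> (?E x)) (\<lambda>x. adjoint (\<lambda>v. v + h *\<^sub>R D x v) (p (?E x)))"
    using A potential_grad_norm[OF \<phi>] by (intro quad_gradient_compose[OF potentialD(3)[OF \<phi>] _ _ qE lipE]) auto
  have lip1: "\<bar>\<phi> (?E x) - \<phi> (?E y)\<bar> \<le> (1 + h * Lf) * norm (x - y)" for x y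
    using potentialD(2)[OF \<phi>, of "?E x" "?E y"] lipE[of x y] by linarith
  have q2: "has_quad_gradient (h * (A * Lg)) (\<lambda>x. 1 + h * \<gamma> x) (\<lambda>x. h *\<^sub>R q x)"
    unfolding has_quad_gradient_def
  proof (intro allI)
    fix x y :: 'a
    have "1 + h * \<gamma> y - (1 + h * \<gamma> x) - h *\<^sub>R q x \<bullet> (y - x) = h * (\<gamma> y - \<gamma> x - q x \<bullet> (y - x))"
      by (simp add: algebra_simps)
    then show "\<bar>1 + h * \<gamma> y - (1 + h * \<gamma> x) - h *\<^sub>R q x \<bullet> (y - x)\<bar> \<le> h * (A * Lg) * (norm (y - x))\<^sup>2"
      using has_quad_gradientD[OF \<gamma>(1), of y x] h by (simp add: abs_mult mult.assoc mult_left_mono)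
  qed
  have bd2: "\<bar>1 + h * \<gamma> x\<bar> \<le> 1 + h * Cg" for x
  proof -
    have "\<bar>h * \<gamma> x\<bar> \<le> h * Cg" using \<gamma>(3)[of x] h by (simp add: abs_mult mult_left_mono)
    then show ?thesis by linarith
  qed
  have lip2: "\<bar>(1 + h * \<gamma> x) - (1 + h * \<gamma> y)\<bar> \<le> h * Lg * norm (x - y)" for x y
  proof -
    have "(1 + h * \<gamma> x) - (1 + h * \<gamma> y) = h * (\<gamma> x - \<gamma> y)" by (simp add: algebra_simps)
    then show ?thesis using \<gamma>(2)[of x y] h by (simp add: abs_mult mult.assoc mult_left_mono)
  qed
  have bd1: "\<bar>\<phi> (?E x)\<bar> \<le> b" for x by (rule potentialD(1)[OF \<phi>])
  note q = quad_gradient_mult[OF q1 bd1 lip1 q2 bd2 lip2]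
  have hh: "h * h \<le> h" using h by (simp add: mult_left_le)
  have hLf: "(h * Lf) * (h * Lf) \<le> h * Lf\<^sup>2"
    using mult_right_mono[OF hh, of "Lf\<^sup>2"] by (simp add: power2_eq_square mult_ac)
  have s1: "(1 + h * Lf)\<^sup>2 + h * Lf \<le> 1 + h * (3 * Lf + Lf\<^sup>2)"
    using hLf by (simp add: power2_eq_square algebra_simps)
  have X: "3 * Lf + Lf\<^sup>2 \<ge> 0" using Lf by simp
  have s2: "(1 + h * Cg) * (1 + h * (3 * Lf + Lf\<^sup>2)) \<le> 1 + h * (Cg + (3 * Lf + Lf\<^sup>2) + Cg * (3 * Lf + Lf\<^sup>2))"
    using mult_right_mono[OF hh mult_nonneg_nonneg[OF Cg X]] by (simp add: algebra_simps)
  have hLf1: "h * Lf \<le> Lf" using h Lf by (simp add: mult_left_le_one_le)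
  have s3: "(1 + h * Lf) * (h * Lg) \<le> h * ((1 + Lf) * Lg)"
    using mult_right_mono[of "1 + h * Lf" "1 + Lf" "h * Lg"] hLf1 h Lg by (simp add: mult_ac)
  have K: "?K = 1 + (Cg + (3 * Lf + Lf\<^sup>2) + Cg * (3 * Lf + Lf\<^sup>2)) + b * Lg + (1 + Lf) * Lg"
    by (simp add: transport_growth_def algebra_simps)
  have hK: "h * ?K = h + h * (Cg + (3 * Lf + Lf\<^sup>2) + Cg * (3 * Lf + Lf\<^sup>2)) + h * (b * Lg) + h * ((1 + Lf) * Lg)"
    unfolding K by (simp only: distrib_left mult_1_right)
  have total: "((1 + h * Lf)\<^sup>2 + h * Lf) * (1 + h * Cg) + b * (h * Lg) + (1 + h * Lf) * (h * Lg) \<le> 1 + h * ?K"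
  proof -
    have "((1 + h * Lf)\<^sup>2 + h * Lf) * (1 + h * Cg) \<le> (1 + h * (3 * Lf + Lf\<^sup>2)) * (1 + h * Cg)"
      using s1 h Cg by (intro mult_right_mono) auto
    then have "((1 + h * Lf)\<^sup>2 + h * Lf) * (1 + h * Cg) \<le> 1 + h * (Cg + (3 * Lf + Lf\<^sup>2) + Cg * (3 * Lf + Lf\<^sup>2))"
      using s2 by (simp add: mult.commute)
    moreover have "b * (h * Lg) = h * (b * Lg)" by simp
    ultimately show ?thesis using s3 h unfolding hK by linarith
  qed
  have K0: "?K \<ge> 0" unfolding transport_growth_def using Cg Lf Lg b X by (intro add_nonneg_nonneg mult_nonneg_nonneg) auto
  have l: "1 + h * ?K > 0" using K0 h by (simp add: add_pos_nonneg)
  define Z where "Z = ((1 + h * Lf)\<^sup>2 + h * Lf) * (1 + h * Cg)"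
  have nonneg: "0 \<le> b * (h * Lg)" "0 \<le> (1 + h * Lf) * (h * Lg)" "0 \<le> h * Lf" "0 \<le> h * Cg"
    using b h Lf Lg Cg by auto
  have ZK: "Z + b * (h * Lg) \<le> 1 + h * ?K"
    using order_trans[OF add_increasing2[OF nonneg(2) order_refl] total] by (simp add: Z_def)
  then have ZK': "Z \<le> 1 + h * ?K" using nonneg(1) by linarith
  have supb: "\<bar>?\<psi> x\<bar> \<le> (1 + h * ?K) * b" for x
  proof -
    have "1 * (1 + h * Cg) \<le> Z"
      unfolding Z_def using nonneg one_le_power[of "1 + h * Lf" 2] by (intro mult_right_mono) linarith+
    then have "1 + h * Cg \<le> 1 + h * ?K" using order_trans[OF _ ZK', of "1 + h * Cg"] by (simp only: mult_1_left)
    moreover have "\<bar>?\<psi> x\<bar> \<le> b * (1 + h * Cg)"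
      unfolding abs_mult using bd1 bd2 b by (intro mult_mono) auto
    ultimately show ?thesis using mult_left_mono[of "1 + h * Cg" "1 + h * ?K" b] b by (simp add: mult.commute)
  qed
  have lip: "\<bar>?\<psi> x - ?\<psi> y\<bar> \<le> (1 + h * ?K) * norm (x - y)" for x y
  proof -
    have "?\<psi> x - ?\<psi> y = (\<phi> (?E x) - \<phi> (?E y)) * (1 + h * \<gamma> x) + \<phi> (?E y) * ((1 + h * \<gamma> x) - (1 + h * \<gamma> y))"
      by (simp add: algebra_simps)
    also have "\<bar>\<dots>\<bar> \<le> \<bar>\<phi> (?E x) - \<phi> (?E y)\<bar> * \<bar>1 + h * \<gamma> x\<bar> + \<bar>\<phi> (?E y)\<bar> * \<bar>(1 + h * \<gamma> x) - (1 + h * \<gamma> y)\<bar>"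
      unfolding abs_mult[symmetric] by (rule abs_triangle_ineq)
    also have "\<dots> \<le> ((1 + h * Lf) * norm (x - y)) * (1 + h * Cg) + b * (h * Lg * norm (x - y))"
      using lip1[of x y] bd2[of x] bd1[of y] lip2[of x y] nonneg b by (intro add_mono mult_mono) auto
    also have "\<dots> = ((1 + h * Lf) * (1 + h * Cg) + b * (h * Lg)) * norm (x - y)" by (simp add: algebra_simps)
    also have "\<dots> \<le> (1 + h * ?K) * norm (x - y)"
    proof (rule mult_right_mono)
      have "1 + h * Lf \<le> (1 + h * Lf)\<^sup>2 + h * Lf" using one_le_power[of "1 + h * Lf" 2] nonneg(3) by simp
      then have "(1 + h * Lf) * (1 + h * Cg) \<le> Z"
        unfolding Z_def using nonneg by (intro mult_right_mono) auto
      then show "(1 + h * Lf) * (1 + h * Cg) + b * (h * Lg) \<le> 1 + h * ?K" using ZK by linarith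
    qed simp
    finally show ?thesis .
  qed
  have "(A * (1 + h * Lf)\<^sup>2 + 1 * (h * (A * Lf))) * (1 + h * Cg) + b * (h * (A * Lg)) + (1 + h * Lf) * (h * Lg)
    \<le> A * (((1 + h * Lf)\<^sup>2 + h * Lf) * (1 + h * Cg) + b * (h * Lg) + (1 + h * Lf) * (h * Lg))"
    using mult_right_mono[OF A nonneg(2)] by (simp add: algebra_simps)
  also have "\<dots> \<le> A * (1 + h * ?K)" using total A by (intro mult_left_mono) auto
  finally have qA: "(A * (1 + h * Lf)\<^sup>2 + 1 * (h * (A * Lf))) * (1 + h * Cg) + b * (h * (A * Lg)) + (1 + h * Lf) * (h * Lg) \<le> A * (1 + h * ?K)" .
  from has_quad_gradient_mono[OF q qA] obtain p0 where p0: "has_quad_gradient (A * (1 + h * ?K)) ?\<psi> p0" by blast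
  have "potential b A (\<lambda>x. ?\<psi> x / (1 + h * ?K)) (\<lambda>x. (1 / (1 + h * ?K)) *\<^sub>R p0 x)"
    unfolding potential_def has_quad_gradient_def
  proof (intro conjI allI)
    fix x y :: 'a
    show "\<bar>?\<psi> x / (1 + h * ?K)\<bar> \<le> b" using supb[of x] l by (simp add: pos_divide_le_eq mult.commute)
    show "\<bar>?\<psi> x / (1 + h * ?K) - ?\<psi> y / (1 + h * ?K)\<bar> \<le> norm (x - y)"
      using lip[of x y] l by (simp add: pos_divide_le_eq mult.commute flip: diff_divide_distrib)
    have "?\<psi> y / (1 + h * ?K) - ?\<psi> x / (1 + h * ?K) - ((1 / (1 + h * ?K)) *\<^sub>R p0 x) \<bullet> (y - x)
      = (?\<psi> y - ?\<psi> x - p0 x \<bullet> (y - x)) / (1 + h * ?K)"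
      by (simp add: diff_divide_distrib)
    then show "\<bar>?\<psi> y / (1 + h * ?K) - ?\<psi> x / (1 + h * ?K) - ((1 / (1 + h * ?K)) *\<^sub>R p0 x) \<bullet> (y - x)\<bar> \<le> A * (norm (y - x))\<^sup>2"
      using has_quad_gradientD[OF p0, of y x] l by (simp add: pos_divide_le_eq mult_ac)
  qed
  then show thesis by (rule that)
qed

lemma potential_transport_expansion:
  fixes \<phi> :: "'a::euclidean_space \<Rightarrow> real"
  assumes \<phi>: "potential b A \<phi> p" and A: "A \<ge> 0" and h: "0 \<le> h" "h \<le> 1"
    and F: "norm F \<le> Cf" and \<gamma>: "\<bar>\<gamma>\<bar> \<le> Cg"
  shows "\<bar>\<phi> (x + h *\<^sub>R F) * (1 + h * \<gamma>) - \<phi> x - h * (p x \<bullet> F + \<phi> x * \<gamma>)\<bar> \<le> h\<^sup>2 * (Cg * Cf + (1 + Cg) * (A * Cf\<^sup>2))"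
proof -
  define R where "R = \<phi> (x + h *\<^sub>R F) - \<phi> x - h * (p x \<bullet> F)"
  have Cf: "Cf \<ge> 0" using F norm_ge_zero[of F] by linarith
  have Cg: "Cg \<ge> 0" using \<gamma> by linarith
  have "\<bar>R\<bar> \<le> A * (h * norm F)\<^sup>2"
    using has_quad_gradientD[OF potentialD(3)[OF \<phi>], of "x + h *\<^sub>R F" x] h by (simp add: R_def)
  also have "\<dots> \<le> A * (h * Cf)\<^sup>2" using A h F Cf by (intro mult_left_mono power_mono) auto
  finally have R: "\<bar>R\<bar> \<le> h\<^sup>2 * (A * Cf\<^sup>2)" by (simp add: power_mult_distrib mult_ac)
  have "norm (p x) * norm F \<le> 1 * Cf" using potential_grad_norm[OF \<phi>, of x] F by (intro mult_mono) auto
  then have pF: "\<bar>p x \<bullet> F\<bar> \<le> Cf" using Cauchy_Schwarz_ineq2[of "p x" F] by simp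
  have "\<bar>h * \<gamma>\<bar> \<le> 1 * Cg" unfolding abs_mult using h \<gamma> by (intro mult_mono) auto
  then have g1: "\<bar>1 + h * \<gamma>\<bar> \<le> 1 + Cg" by linarith
  have "\<phi> (x + h *\<^sub>R F) * (1 + h * \<gamma>) - \<phi> x - h * (p x \<bullet> F + \<phi> x * \<gamma>) = h\<^sup>2 * (\<gamma> * (p x \<bullet> F)) + (1 + h * \<gamma>) * R"
    by (simp add: R_def power2_eq_square algebra_simps)
  also have "\<bar>\<dots>\<bar> \<le> h\<^sup>2 * (\<bar>\<gamma>\<bar> * \<bar>p x \<bullet> F\<bar>) + \<bar>1 + h * \<gamma>\<bar> * \<bar>R\<bar>"
    using abs_triangle_ineq[of "h\<^sup>2 * (\<gamma> * (p x \<bullet> F))" "(1 + h * \<gamma>) * R"] by (simp add: abs_mult)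
  also have "\<dots> \<le> h\<^sup>2 * (Cg * Cf) + (1 + Cg) * (h\<^sup>2 * (A * Cf\<^sup>2))"
    using \<gamma> pF g1 R Cg by (intro add_mono mult_left_mono mult_mono) auto
  finally show ?thesis by (simp add: algebra_simps)
qed

section \<open>Dini-type Gronwall inequalities\<close>

text \<open>Gronwall's inequality from an upper bound on right difference quotients; the second
condition excludes upward jumps, as lower semicontinuity from the left does. The function
\<open>w t = (u 0 + (B + \<eta>) t) exp (A t)\<close> grows at least as fast as \<open>u\<close> is allowed to, so the set of \<open>r\<close> such that
\<open>u \<le> w\<close> on \<open>[0, r]\<close> is closed and can be extended to the right.\<close>

lemma dini_gronwall:
  fixes u :: "real \<Rightarrow> real"
  assumes A: "A \<ge> 0" and B: "B \<ge> 0" and u0: "u 0 \<ge> 0"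
    and right: "\<And>t \<eta>. 0 \<le> t \<Longrightarrow> t < T \<Longrightarrow> \<eta> > 0 \<Longrightarrow> \<exists>\<delta>>0. \<forall>h. 0 < h \<and> h < \<delta> \<and> t + h \<le> T \<longrightarrow> u (t + h) \<le> u t + h * (A * u t + B + \<eta>)"
    and left: "\<And>t \<eta>. 0 < t \<Longrightarrow> t \<le> T \<Longrightarrow> \<eta> > 0 \<Longrightarrow> \<exists>\<delta>>0. \<forall>s. 0 \<le> s \<and> t - \<delta> < s \<and> s < t \<longrightarrow> u t \<le> u s + \<eta>"
    and t: "0 \<le> t" "t \<le> T"
  shows "u t \<le> (u 0 + B * t) * exp (A * t)"
proof -
  have main: "u t \<le> (u 0 + (B + \<eta>) * t) * exp (A * t)" if \<eta>: "\<eta> > 0" for \<eta>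
  proof -
    define w where "w t = (u 0 + (B + \<eta>) * t) * exp (A * t)" for t
    have wpos: "0 \<le> u 0 + (B + \<eta>) * s" if "s \<ge> 0" for s
      using that B \<eta> u0 by simp
    have wmono: "w s \<le> w t" if "0 \<le> s" "s \<le> t" for s t
      unfolding w_def using that wpos A B \<eta> by (intro mult_mono) (auto intro: mult_left_mono)
    have wstep: "w s + h * (A * w s + B + \<eta>) \<le> w (s + h)" if s: "s \<ge> 0" and h: "h \<ge> 0" for s h
    proof -
      let ?X = "u 0 + (B + \<eta>) * s" and ?e = "exp (A * s)"
      have e1: "1 \<le> ?e" using A s by simp
      have "?X + h * (A * ?X) + h * (B + \<eta>) \<le> (?X + (B + \<eta>) * h) * (1 + A * h)"
        using A B \<eta> h by (simp add: algebra_simps)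
      also have "\<dots> \<le> (?X + (B + \<eta>) * h) * exp (A * h)"
        using exp_ge_add_one_self[of "A * h"] wpos[OF s] B \<eta> h by (intro mult_left_mono) auto
      finally have "?e * (?X + h * (A * ?X) + h * (B + \<eta>)) \<le> ?e * ((?X + (B + \<eta>) * h) * exp (A * h))"
        by (intro mult_left_mono) auto
      also have "\<dots> = w (s + h)" by (simp add: w_def algebra_simps exp_add)
      finally have 1: "w s + h * (A * w s) + ?e * (h * (B + \<eta>)) \<le> w (s + h)" by (simp add: w_def algebra_simps)
      have "1 * (h * (B + \<eta>)) \<le> ?e * (h * (B + \<eta>))" using e1 h B \<eta> by (intro mult_right_mono) auto
      with 1 show ?thesis by (simp add: algebra_simps)
    qed
    define G where "G = {r. 0 \<le> r \<and> r \<le> T \<and> (\<forall>s. 0 \<le> s \<and> s \<le> r \<longrightarrow> u s \<le> w s)}"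
    have "0 \<in> G" using t by (auto simp: G_def w_def)
    have bdd: "bdd_above G" by (rule bdd_aboveI[of _ T]) (auto simp: G_def)
    define r where "r = Sup G"
    have r0: "0 \<le> r" unfolding r_def using \<open>0 \<in> G\<close> bdd by (rule cSup_upper)
    have rT: "r \<le> T" unfolding r_def using \<open>0 \<in> G\<close> by (intro cSup_least) (auto simp: G_def)
    have below: "u s \<le> w s" if s: "0 \<le> s" "s < r" for s
    proof -
      obtain r' where "r' \<in> G" "s < r'" 
        using less_cSupE[of s G] s(2) \<open>0 \<in> G\<close> unfolding r_def by blast
      then show ?thesis using s by (auto simp: G_def)
    qed
    have at: "u r \<le> w r"
    proof (cases "r = 0")
      case True then show ?thesis by (simp add: w_def)
    next
      case False
      then have r: "0 < r" using r0 by simp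
      show ?thesis
      proof (rule field_le_epsilon)
        fix e :: real assume "e > 0"
        from left[OF r rT this] obtain \<delta> where \<delta>: "\<delta> > 0" "\<And>s. 0 \<le> s \<Longrightarrow> r - \<delta> < s \<Longrightarrow> s < r \<Longrightarrow> u r \<le> u s + e"
          by blast
        define s where "s = max 0 (r - \<delta> / 2)"
        have s: "0 \<le> s" "r - \<delta> < s" "s < r" using \<delta>(1) r by (auto simp: s_def)
        show "u r \<le> w r + e" using \<delta>(2)[OF s] below[OF s(1,3)] wmono[of s r] s by linarith
      qed
    qed
    have rG: "r \<in> G" using r0 rT below at by (auto simp: G_def order_le_less)
    have "r = T"
    proof (rule ccontr)
      assume "r \<noteq> T"
      then have r: "r < T" using rT by simp
      from right[OF r0 r \<eta>] obtain \<delta> where \<delta>: "\<delta> > 0" "\<And>h. 0 < h \<Longrightarrow> h < \<delta> \<Longrightarrow> r + h \<le> T \<Longrightarrow> u (r + h) \<le> u r + h * (A * u r + B + \<eta>)"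
        by blast
      define d where "d = min (\<delta> / 2) (T - r)"
      have d: "0 < d" "d < \<delta>" "r + d \<le> T" using \<delta>(1) r by (auto simp: d_def)
      have "u s \<le> w s" if s: "0 \<le> s" "s \<le> r + d" for s
      proof (cases "s \<le> r")
        case True then show ?thesis using rG s by (auto simp: G_def)
      next
        case False
        define h where "h = s - r"
        have h: "0 < h" "h < \<delta>" "r + h \<le> T" using False s d by (auto simp: h_def)
        have "u (r + h) \<le> u r + h * (A * u r + B + \<eta>)" by (rule \<delta>(2)[OF h])
        also have "\<dots> \<le> w r + h * (A * w r + B + \<eta>)"
          using at A h by (intro add_mono mult_left_mono) auto
        also have "\<dots> \<le> w (r + h)" using h r0 by (intro wstep) auto
        finally show ?thesis by (simp add: h_def)
      qed
      then have "r + d \<in> G" using d r0 by (auto simp: G_def)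
      then have "r + d \<le> r" unfolding r_def by (rule cSup_upper[OF _ bdd])
      then show False using d by simp
    qed
    then show ?thesis using rG t by (auto simp: G_def w_def)
  qed
  have "((\<lambda>\<eta>. (u 0 + (B + \<eta>) * t) * exp (A * t)) \<longlongrightarrow> (u 0 + (B + 0) * t) * exp (A * t)) (at_right 0)"
    by (intro tendsto_intros)
  moreover have "eventually (\<lambda>\<eta>. u t \<le> (u 0 + (B + \<eta>) * t) * exp (A * t)) (at_right 0)"
    using main by (auto intro!: eventually_at_right_less[THEN eventually_mono])
  ultimately have "u t \<le> (u 0 + (B + 0) * t) * exp (A * t)"
    by (rule tendsto_lowerbound) simp
  then show ?thesis by simp
qed

text \<open>The increment is controlled by a value of \<open>u\<close> at some point of the interval, the form in which mean value
theorems provide it.\<close>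

lemma continuous_mean_gronwall:
  fixes u :: "real \<Rightarrow> real"
  assumes A: "A \<ge> 0" and u: "\<And>t. 0 \<le> t \<Longrightarrow> t \<le> T \<Longrightarrow> u t \<ge> 0" and cont: "continuous_on {0..T} u"
    and incr: "\<And>s t. 0 \<le> s \<Longrightarrow> s < t \<Longrightarrow> t \<le> T \<Longrightarrow> \<exists>\<xi>\<in>{s..t}. u t - u s \<le> (t - s) * (A * u \<xi>)"
    and t: "0 \<le> t" "t \<le> T"
  shows "u t \<le> u 0 * exp (A * t)"
proof -
  have near: "\<exists>\<delta>>0. \<forall>s\<in>{0..T}. \<bar>s - t\<bar> < \<delta> \<longrightarrow> \<bar>u s - u t\<bar> < \<eta>" if "0 \<le> t" "t \<le> T" "\<eta> > 0" for t \<eta>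
    using cont that unfolding continuous_on_iff dist_real_def by (meson atLeastAtMost_iff)
  have "u t \<le> (u 0 + 0 * t) * exp (A * t)"
  proof (rule dini_gronwall[OF A _ _ _ _ t])
    fix t \<eta> :: real assume t: "0 \<le> t" "t < T" and \<eta>: "\<eta> > 0"
    have "\<eta> / (A + 1) > 0" using \<eta> A by simp
    then obtain \<delta> where \<delta>: "\<delta> > 0" "\<And>s. s \<in> {0..T} \<Longrightarrow> \<bar>s - t\<bar> < \<delta> \<Longrightarrow> \<bar>u s - u t\<bar> < \<eta> / (A + 1)"
      using near[of t "\<eta> / (A + 1)"] t by auto
    have "u (t + h) \<le> u t + h * (A * u t + 0 + \<eta>)" if h: "0 < h" "h < \<delta>" "t + h \<le> T" for h
    proof -
      obtain \<xi> where \<xi>: "\<xi> \<in> {t..t + h}" "u (t + h) - u t \<le> h * (A * u \<xi>)"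
        using incr[of t "t + h"] t h by auto
      have "u \<xi> \<le> u t + \<eta> / (A + 1)" using \<delta>(2)[of \<xi>] \<xi> t h by fastforce
      then have "A * u \<xi> \<le> A * (u t + \<eta> / (A + 1))" using A by (intro mult_left_mono)
      also have "\<dots> \<le> A * u t + \<eta>" using A \<eta> by (simp add: field_simps)
      finally have "h * (A * u \<xi>) \<le> h * (A * u t + \<eta>)" using h by (intro mult_left_mono) auto
      then show ?thesis using \<xi>(2) by simp
    qed
    then show "\<exists>\<delta>>0. \<forall>h. 0 < h \<and> h < \<delta> \<and> t + h \<le> T \<longrightarrow> u (t + h) \<le> u t + h * (A * u t + 0 + \<eta>)"
      using \<delta>(1) by blast
  next
    fix t \<eta> :: real assume t: "0 < t" "t \<le> T" and \<eta>: "\<eta> > 0"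
    then obtain \<delta> where \<delta>: "\<delta> > 0" "\<And>s. s \<in> {0..T} \<Longrightarrow> \<bar>s - t\<bar> < \<delta> \<Longrightarrow> \<bar>u s - u t\<bar> < \<eta>"
      using near[of t \<eta>] by auto
    have "u t \<le> u s + \<eta>" if "0 \<le> s" "t - \<delta> < s" "s < t" for s
      using \<delta>(2)[of s] that t by (auto simp: abs_less_iff)
    then show "\<exists>\<delta>>0. \<forall>s. 0 \<le> s \<and> t - \<delta> < s \<and> s < t \<longrightarrow> u t \<le> u s + \<eta>" using \<delta>(1) by blast
  qed (use u[of 0] t in auto)
  then show ?thesis by simp
qed

section \<open>Atomic measures\<close>

lemma integral_atomic:
  fixes h :: "'a::euclidean_space \<Rightarrow> real"
  assumes "finite S" "\<gamma> \<in> l1_plus S" "h \<in> borel_measurable borel"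
  shows "(\<integral>x. h x \<partial>(\<I> S \<gamma>)) = (\<Sum>x\<in>S. \<gamma> x * h x)"
proof -
  have "(\<integral>x. h x \<partial>(\<I> S \<gamma>)) = (\<integral>x. h x \<partial>(point_measure S (\<lambda>x. ennreal (\<gamma> x))))"
    unfolding atomic_def using assms(3) by (intro integral_distr) (auto simp: point_measure_def)
  also have "\<dots> = (\<Sum>x\<in>S. \<gamma> x * h x)"
    using assms by (subst lebesgue_integral_point_measure_finite) (auto simp: l1_plus_def)
  finally show ?thesis .
qed

lemma measure_atomic_UNIV:
  assumes "finite S" "\<gamma> \<in> l1_plus S"
  shows "measure (\<I> S \<gamma>) UNIV = (\<Sum>x\<in>S. \<gamma> x)"
proof -
  have "(\<integral>x. 1 \<partial>(\<I> S \<gamma>)) = (\<Sum>x\<in>S. \<gamma> x * 1)" by (rule integral_atomic) (use assms in auto)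
  then show ?thesis by (simp add: atomic_def)
qed

text \<open>By duality it suffices to bound \<open>\<Sum>x\<in>S. (\<gamma> x - \<gamma>' x) \<phi> x\<close> for \<open>\<bar>\<phi>\<bar> \<le> b\<close>.\<close>

lemma PRW_atomic_le:
  assumes S: "finite S" and \<gamma>: "\<gamma> \<in> l1_plus S" "\<gamma>' \<in> l1_plus S" and b: "b \<ge> 0"
  shows "PRW b (\<I> S \<gamma>) (\<I> S \<gamma>') \<le> b * (\<Sum>x\<in>S. \<bar>\<gamma> x - \<gamma>' x\<bar>)"
proof (rule field_le_epsilon)
  fix e :: real assume e: "e > 0"
  let ?C = "3 * (measure (\<I> S \<gamma>) UNIV + measure (\<I> S \<gamma>') UNIV) + 1"
  have C: "?C > 0" by (simp add: add_nonneg_pos)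
  obtain \<phi> where \<phi>: "\<And>x y. \<bar>\<phi> x - \<phi> y\<bar> \<le> norm (x - y)" "\<And>x. \<bar>\<phi> x\<bar> \<le> b"
    "PRW b (\<I> S \<gamma>) (\<I> S \<gamma>') \<le> (\<integral>x. \<phi> x \<partial>(\<I> S \<gamma>)) - (\<integral>x. \<phi> x \<partial>(\<I> S \<gamma>')) + ?C * (e / ?C)"
    using PRW_dual_potential[OF finite_imp_compact[OF S] atomic_in_fin_measures[OF S] atomic_in_fin_measures[OF S] b, of "e / ?C"] e C
    by (metis divide_pos_pos)
  have m: "\<phi> \<in> borel_measurable borel" using \<phi>(1) by (intro lipschitz_borel[of _ 1]) auto
  have "(\<integral>x. \<phi> x \<partial>(\<I> S \<gamma>)) - (\<integral>x. \<phi> x \<partial>(\<I> S \<gamma>')) = (\<Sum>x\<in>S. (\<gamma> x - \<gamma>' x) * \<phi> x)"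
    by (simp add: integral_atomic[OF S _ m] \<gamma> sum_subtractf left_diff_distrib)
  also have "\<dots> \<le> (\<Sum>x\<in>S. \<bar>\<gamma> x - \<gamma>' x\<bar> * b)"
  proof (rule sum_mono)
    fix x
    have "(\<gamma> x - \<gamma>' x) * \<phi> x \<le> \<bar>\<gamma> x - \<gamma>' x\<bar> * \<bar>\<phi> x\<bar>" by (simp flip: abs_mult)
    also have "\<dots> \<le> \<bar>\<gamma> x - \<gamma>' x\<bar> * b" using \<phi>(2) by (intro mult_left_mono) auto
    finally show "(\<gamma> x - \<gamma>' x) * \<phi> x \<le> \<bar>\<gamma> x - \<gamma>' x\<bar> * b" .
  qed
  also have "\<dots> = b * (\<Sum>x\<in>S. \<bar>\<gamma> x - \<gamma>' x\<bar>)" by (simp add: sum_distrib_left mult.commute)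
  finally show "PRW b (\<I> S \<gamma>) (\<I> S \<gamma>') \<le> b * (\<Sum>x\<in>S. \<bar>\<gamma> x - \<gamma>' x\<bar>) + e" using \<phi>(3) C by simp
qed

lemma PRW_refl:
  fixes m :: "'a::euclidean_space measure"
  assumes m: "m \<in> \<M> X" and X: "compact X" and b: "b \<ge> 0"
  shows "PRW b m m = 0"
proof -
  have "PRW b m m \<le> 0 + e" if e: "e > 0" for e
  proof -
    let ?C = "3 * (measure m UNIV + measure m UNIV) + 1"
    have C: "?C > 0" by (simp add: add_nonneg_pos)
    obtain \<phi> where "PRW b m m \<le> (\<integral>x. \<phi> x \<partial>m) - (\<integral>x. \<phi> x \<partial>m) + ?C * (e / ?C)"
      using PRW_dual_potential[OF X m m b, of "e / ?C"] e C by (metis divide_pos_pos)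
    then show ?thesis using C by simp
  qed
  then have "PRW b m m \<le> 0" by (rule field_le_epsilon)
  then show ?thesis using PRW_nonneg[of b m m] by linarith
qed

section \<open>Discrepancy over smooth potentials\<close>

definition discrepancy :: "real \<Rightarrow> real \<Rightarrow> 'a::euclidean_space measure \<Rightarrow> 'a measure \<Rightarrow> real" where
  "discrepancy b A m n = Sup {(\<integral>x. \<phi> x \<partial>m) - (\<integral>x. \<phi> x \<partial>n) | \<phi>. \<exists>p. potential b A \<phi> p}"

lemma potential_borel: "potential b A \<phi> p \<Longrightarrow> \<phi> \<in> borel_measurable borel"
  by (rule lipschitz_borel[of _ 1]) (simp add: potential_def)

lemma potential_zero: "b \<ge> 0 \<Longrightarrow> A \<ge> 0 \<Longrightarrow> potential b A (\<lambda>x. 0) (\<lambda>x. 0)"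
  by (simp add: potential_def has_quad_gradient_def)

lemma integral_diff_le_discrepancy:
  assumes m: "m \<in> \<M> UNIV" "n \<in> \<M> UNIV" and \<phi>: "potential b A \<phi> p"
  shows "(\<integral>x. \<phi> x \<partial>m) - (\<integral>x. \<phi> x \<partial>n) \<le> discrepancy b A m n"
  unfolding discrepancy_def
proof (rule cSup_upper)
  show "bdd_above {(\<integral>x. \<phi> x \<partial>m) - (\<integral>x. \<phi> x \<partial>n) | \<phi>. \<exists>p. potential b A \<phi> p}"
    using integral_diff_le_PRW[OF m] by (intro bdd_aboveI[of _ "PRW b m n"]) (auto simp: potential_def)
qed (use \<phi> in blast)

lemma discrepancy_least:
  assumes "b \<ge> 0" "A \<ge> 0" "\<And>\<phi> p. potential b A \<phi> p \<Longrightarrow> (\<integral>x. \<phi> x \<partial>m) - (\<integral>x. \<phi> x \<partial>n) \<le> B"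
  shows "discrepancy b A m n \<le> B"
  unfolding discrepancy_def using assms potential_zero[OF assms(1,2)] by (intro cSup_least) auto

lemma discrepancy_nonneg:
  assumes "m \<in> \<M> UNIV" "n \<in> \<M> UNIV" "b \<ge> 0" "A \<ge> 0"
  shows "discrepancy b A m n \<ge> 0"
  using integral_diff_le_discrepancy[OF assms(1,2) potential_zero[OF assms(3,4)]] by simp

lemma discrepancy_le_PRW:
  assumes "m \<in> \<M> UNIV" "n \<in> \<M> UNIV" "b \<ge> 0" "A \<ge> 0"
  shows "discrepancy b A m n \<le> PRW b m n"
  using integral_diff_le_PRW[OF assms(1,2)] assms by (intro discrepancy_least) (auto simp: potential_def)

text \<open>Continuity of the discrepancy in both measures; this excludes jumps in the Gronwall argument.\<close>

lemma discrepancy_le_perturb: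
  fixes m n m' n' :: "'a::euclidean_space measure"
  assumes "m \<in> \<M> UNIV" "n \<in> \<M> UNIV" "m' \<in> \<M> UNIV" "n' \<in> \<M> UNIV" and b: "b > 0" and A: "A \<ge> 0"
  shows "discrepancy b A m n \<le> discrepancy b A m' n' + 2 * PRW b m' m + 2 * PRW b n' n"
proof (rule discrepancy_least)
  fix \<phi> and p :: "'a \<Rightarrow> 'a" assume \<phi>: "potential b A \<phi> p"
  have "\<bar>(\<integral>x. \<phi> x \<partial>m') - (\<integral>x. \<phi> x \<partial>m)\<bar> \<le> (b / b + \<bar>1\<bar>) * PRW b m' m"
    "\<bar>(\<integral>x. \<phi> x \<partial>n') - (\<integral>x. \<phi> x \<partial>n)\<bar> \<le> (b / b + \<bar>1\<bar>) * PRW b n' n"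
    using potentialD(1,2)[OF \<phi>] assms by (intro abs_integral_diff_le_PRW; simp)+
  then show "(\<integral>x. \<phi> x \<partial>m) - (\<integral>x. \<phi> x \<partial>n) \<le> discrepancy b A m' n' + 2 * PRW b m' m + 2 * PRW b n' n"
    using integral_diff_le_discrepancy[OF assms(3,4) \<phi>] b by (simp add: abs_le_iff)
qed (use b A in auto)

text \<open>An almost optimal dual potential need not be smooth, but mollification at scale \<open>\<epsilon>\<close> changes it by at most
\<open>\<epsilon>\<close>, hence its integrals by at most \<open>\<epsilon>\<close> times the masses.\<close>

lemma PRW_le_discrepancy:
  fixes m n :: "'a::euclidean_space measure"
  assumes moll: "\<And>F :: 'a \<Rightarrow> real. mollifiable \<kappa> F" and X: "compact X" and m: "m \<in> \<M> X" "n \<in> \<M> X"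
    and b: "b \<ge> 0" and \<epsilon>: "\<epsilon> > 0" and M: "measure m UNIV \<le> M" "measure n UNIV \<le> M"
  shows "PRW b m n \<le> discrepancy b (\<kappa> / \<epsilon>) m n + (8 * M + 1) * \<epsilon>"
proof -
  note mU = fin_measures_UNIV[OF m(1)] fin_measures_UNIV[OF m(2)]
  obtain \<phi> where \<phi>: "\<And>x y. \<bar>\<phi> x - \<phi> y\<bar> \<le> norm (x - y)" "\<And>x. \<bar>\<phi> x\<bar> \<le> b"
    "PRW b m n \<le> (\<integral>x. \<phi> x \<partial>m) - (\<integral>x. \<phi> x \<partial>n) + (3 * (measure m UNIV + measure n UNIV) + 1) * \<epsilon>"
    using PRW_dual_potential[OF X m b \<epsilon>] by blast
  have lip1: "norm (\<phi> x - \<phi> y) \<le> 1 * norm (x - y)" for x y using \<phi>(1) by simp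
  obtain G D where G: "\<And>x. norm (G x - \<phi> x) \<le> 1 * \<epsilon>" "\<And>x y. norm (G x - G y) \<le> 1 * norm (x - y)"
    "\<And>B x. \<forall>x. norm (\<phi> x) \<le> B \<Longrightarrow> norm (G x) \<le> B" and q: "quad_approx (\<kappa> / \<epsilon> * 1) G D"
    using mollifiableD[OF moll zero_le_one \<epsilon> lip1] by blast
  obtain p where p: "has_quad_gradient (\<kappa> / \<epsilon> * 1) G p" using quad_approx_real_gradient[OF q] .
  have pot: "potential b (\<kappa> / \<epsilon>) G p"
    using p G(2) G(3)[of b] \<phi>(2) by (simp add: potential_def)
  have close: "\<bar>(\<integral>x. \<phi> x \<partial>n') - (\<integral>x. G x \<partial>n')\<bar> \<le> \<epsilon> * M" if n': "n' \<in> \<M> X" "measure n' UNIV \<le> M" for n'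
  proof -
    note D = fin_measuresD[OF n'(1)]
    interpret finite_measure n' by (rule D(2))
    have i: "integrable n' \<phi>" "integrable n' G"
      using \<phi> potentialD(1)[OF pot] potential_borel[OF pot]
      by (auto intro!: fin_measures_integrable[OF fin_measures_UNIV[OF n'(1)], of _ b] lipschitz_borel[of _ 1])
    have "\<bar>(\<integral>x. \<phi> x \<partial>n') - (\<integral>x. G x \<partial>n')\<bar> \<le> (\<integral>x. \<bar>\<phi> x - G x\<bar> \<partial>n')"
      using integral_abs_bound[of n' "\<lambda>x. \<phi> x - G x"] i by simp
    also have "\<dots> \<le> (\<integral>x. \<epsilon> \<partial>n')"
      using i G(1) by (intro integral_mono integrable_abs Bochner_Integration.integrable_diff) (auto simp: abs_minus_commute)
    also have "\<dots> \<le> \<epsilon> * M" using n'(2) \<epsilon> by (simp add: D mult.commute mult_left_mono)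
    finally show ?thesis .
  qed
  have "(\<integral>x. \<phi> x \<partial>m) - (\<integral>x. \<phi> x \<partial>n) \<le> discrepancy b (\<kappa> / \<epsilon>) m n + 2 * (\<epsilon> * M)"
    using close[OF m(1) M(1)] close[OF m(2) M(2)] integral_diff_le_discrepancy[OF mU pot]
    by (simp add: abs_le_iff)
  moreover have "(3 * (measure m UNIV + measure n UNIV) + 1) * \<epsilon> \<le> (3 * (M + M) + 1) * \<epsilon>"
    using M \<epsilon> by (intro mult_right_mono) auto
  ultimately show ?thesis using \<phi>(3) by (simp add: algebra_simps)
qed

section \<open>Cut-off of test functions\<close>

text \<open>Built from the square \<open>q\<close> of the positive part: \<open>q (1 - q (norm x ^ 2 - r ^ 2))\<close> is constant on the ball of
radius \<open>r\<close>, so that there its gradient vanishes as well.\<close>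

lemma cutoff:
  fixes K :: "'a::euclidean_space set"
  assumes "compact K"
  obtains \<theta> :: "'a \<Rightarrow> real" and \<theta>' R where "\<And>x. (\<theta> has_derivative (\<lambda>v. \<theta>' x \<bullet> v)) (at x)" "continuous_on UNIV \<theta>'"
    "\<And>x. x \<in> K \<Longrightarrow> \<theta> x = 1" "\<And>x. x \<in> K \<Longrightarrow> \<theta>' x = 0" "\<And>x. norm x > R \<Longrightarrow> \<theta> x = 0"
proof -
  obtain r where r: "r > 0" "\<And>x. x \<in> K \<Longrightarrow> norm x \<le> r"
    using compact_imp_bounded[OF assms] bounded_pos by blast
  define q :: "real \<Rightarrow> real" where "q s = (max 0 s)\<^sup>2" for s
  define q' :: "real \<Rightarrow> real" where "q' s = 2 * max 0 s" for s
  have dq: "(q has_real_derivative q' s) (at s)" for s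
  proof -
    have "has_quad_gradient 1 q q'"
      using pos_part_square_taylor by (simp add: has_quad_gradient_def q_def q'_def)
    from quad_gradient_has_derivative[OF this, of s] show ?thesis
      by (simp add: has_field_derivative_def)
  qed
  have cq': "continuous_on UNIV q'" unfolding q'_def[abs_def] by (intro continuous_intros)
  define \<theta> :: "'a \<Rightarrow> real" where "\<theta> x = q (1 - q (x \<bullet> x - r\<^sup>2))" for x
  define \<theta>' :: "'a \<Rightarrow> 'a" where "\<theta>' x = (q' (1 - q (x \<bullet> x - r\<^sup>2)) * (- q' (x \<bullet> x - r\<^sup>2)) * 2) *\<^sub>R x" for x
  show thesis
  proof (rule that)
    fix x :: 'a
    have "((\<lambda>x. x \<bullet> x - r\<^sup>2) has_derivative (\<lambda>v. 2 * (x \<bullet> v))) (at x)"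
      by (auto intro!: derivative_eq_intros simp: inner_commute)
    from DERIV_compose_FDERIV[OF dq this]
    have "((\<lambda>x. 1 - q (x \<bullet> x - r\<^sup>2)) has_derivative (\<lambda>v. - (2 * (x \<bullet> v) * q' (x \<bullet> x - r\<^sup>2)))) (at x)"
      by (auto intro!: derivative_eq_intros)
    from DERIV_compose_FDERIV[OF dq this]
    have "(\<theta> has_derivative (\<lambda>v. - (2 * (x \<bullet> v) * q' (x \<bullet> x - r\<^sup>2)) * q' (1 - q (x \<bullet> x - r\<^sup>2)))) (at x)"
      by (simp add: \<theta>_def[abs_def])
    moreover have "(\<lambda>v. - (2 * (x \<bullet> v) * q' (x \<bullet> x - r\<^sup>2)) * q' (1 - q (x \<bullet> x - r\<^sup>2))) = (\<lambda>v. \<theta>' x \<bullet> v)"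
      by (simp add: \<theta>'_def fun_eq_iff)
    ultimately show "(\<theta> has_derivative (\<lambda>v. \<theta>' x \<bullet> v)) (at x)" by simp
  next
    show "continuous_on UNIV \<theta>'"
      unfolding \<theta>'_def[abs_def] q_def q'_def by (intro continuous_intros)
  next
    fix x assume "x \<in> K"
    then have "x \<bullet> x \<le> r\<^sup>2" using r(2)[of x] power_mono[of "norm x" r 2] by (simp add: power2_norm_eq_inner)
    then show "\<theta> x = 1" "\<theta>' x = 0" by (simp_all add: \<theta>_def \<theta>'_def q_def q'_def)
  next
    fix x :: 'a assume x: "norm x > r + 1"
    have "(r + 1)\<^sup>2 \<le> (norm x)\<^sup>2" using x r(1) by (intro power_mono) auto
    then have "1 \<le> x \<bullet> x - r\<^sup>2" using r(1) by (simp add: power2_norm_eq_inner[symmetric] power2_eq_square algebra_simps)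
    then have "1 \<le> (max 0 (x \<bullet> x - r\<^sup>2))\<^sup>2" by (intro one_le_power) auto
    then show "\<theta> x = 0" by (simp add: \<theta>_def q_def)
  qed
qed

text \<open>Test functions must have compact support, potentials have not; they agree with
a test function on any given compact set.\<close>

lemma test_function_cutoff:
  fixes \<phi> :: "'a::euclidean_space \<Rightarrow> real"
  assumes \<phi>: "\<And>x. (\<phi> has_derivative (\<lambda>v. p x \<bullet> v)) (at x)" "continuous_on UNIV p"
    and \<theta>: "\<And>x. (\<theta> has_derivative (\<lambda>v. \<theta>' x \<bullet> v)) (at x)" "continuous_on UNIV \<theta>'" "\<And>x. norm x > R \<Longrightarrow> \<theta> x = 0"
  shows "test_function T (\<lambda>z. \<phi> (snd z) * \<theta> (snd z)) (\<lambda>z. 0) (\<lambda>z. \<theta> (snd z) *\<^sub>R p (snd z) + \<phi> (snd z) *\<^sub>R \<theta>' (snd z))"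
  unfolding test_function_def
proof (intro conjI ballI)
  have cont: "continuous_on UNIV \<phi>" "continuous_on UNIV \<theta>"
    using \<phi>(1) \<theta>(1) by (auto intro!: has_derivative_continuous_on)
  note comp = continuous_on_compose2[OF _ continuous_on_snd[OF continuous_on_id], of UNIV]
  show "continuous_on ({0..T} \<times> UNIV) (\<lambda>z. \<theta> (snd z) *\<^sub>R p (snd z) + \<phi> (snd z) *\<^sub>R \<theta>' (snd z))"
    by (intro continuous_intros comp[OF cont(1)] comp[OF cont(2)] comp[OF \<phi>(2)] comp[OF \<theta>(2)]) auto
  fix z :: "real \<times> 'a"
  have 1: "((\<lambda>x. \<phi> x * \<theta> x) has_derivative (\<lambda>v. (\<theta> x *\<^sub>R p x + \<phi> x *\<^sub>R \<theta>' x) \<bullet> v)) (at x)" for x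
    by (rule has_derivative_eq_rhs[OF has_derivative_mult[OF \<phi>(1) \<theta>(1)]]) (simp add: fun_eq_iff inner_add_left)
  have "((\<lambda>z. \<phi> (snd z) * \<theta> (snd z)) has_derivative (\<lambda>w. (\<theta> (snd z) *\<^sub>R p (snd z) + \<phi> (snd z) *\<^sub>R \<theta>' (snd z)) \<bullet> snd w)) (at z within {0..T} \<times> UNIV)"
    by (rule has_derivative_compose[OF has_derivative_snd[OF has_derivative_ident] 1])
  then show "((\<lambda>z. \<phi> (snd z) * \<theta> (snd z)) has_derivative (\<lambda>(h, v). h * 0 + (\<theta> (snd z) *\<^sub>R p (snd z) + \<phi> (snd z) *\<^sub>R \<theta>' (snd z)) \<bullet> v)) (at z within {0..T} \<times> UNIV)"
    by (simp add: case_prod_unfold)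
next
  have nz: "norm x \<le> R" if "\<theta> x \<noteq> 0" for x using \<theta>(3)[of x] that by (meson not_le)
  have "{z \<in> {0..T} \<times> UNIV. \<phi> (snd z) * \<theta> (snd z) \<noteq> 0} \<subseteq> {0..T} \<times> cball 0 R"
    using nz by auto
  moreover have "bounded ({0..T} \<times> cball (0::'a) R)" by (intro bounded_Times) auto
  ultimately have "bounded {z \<in> {0..T} \<times> UNIV. \<phi> (snd z) * \<theta> (snd z) \<noteq> 0}" by (rule bounded_subset[rotated])
  then show "compact (closure {z \<in> {0..T} \<times> UNIV. \<phi> (snd z) * \<theta> (snd z) \<noteq> 0})"
    unfolding compact_closure .
qed simp

section \<open>Coefficients along curves of measures\<close>

locale balance_coefficients =
  fixes T b Lf Lg Cf Cg :: real
    and f :: "real \<Rightarrow> 'a::euclidean_space \<Rightarrow> 'a measure \<Rightarrow> 'a"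
    and g :: "real \<Rightarrow> 'a \<Rightarrow> 'a measure \<Rightarrow> real"
  assumes T: "T > 0" and b: "b > 0" and Lf: "Lf \<ge> 0" and Lg: "Lg \<ge> 0"
    and contf: "PRW_continuous T b f" and contg: "PRW_continuous T b g"
    and lipf: "PRW_lipschitz T b Lf f" and lipg: "PRW_lipschitz T b Lg g"
    and bdf: "\<And>t x m. t \<in> {0..T} \<Longrightarrow> m \<in> \<M> UNIV \<Longrightarrow> norm (f t x m) \<le> Cf"
    and bdg: "\<And>t x m. t \<in> {0..T} \<Longrightarrow> m \<in> \<M> UNIV \<Longrightarrow> \<bar>g t x m\<bar> \<le> Cg"
begin

text \<open>The rate at which \<open>\<integral>\<phi> dm\<close> changes along the balance equation, \<open>p\<close> being the gradient of \<open>\<phi>\<close>.\<close>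

definition rate :: "('a \<Rightarrow> real) \<Rightarrow> ('a \<Rightarrow> 'a) \<Rightarrow> real \<Rightarrow> 'a measure \<Rightarrow> real" where
  "rate \<phi> p t m = (\<integral>x. p x \<bullet> f t x m + \<phi> x * g t x m \<partial>m)"

definition PRW_curve :: "'a set \<Rightarrow> (real \<Rightarrow> 'a measure) \<Rightarrow> bool" where
  "PRW_curve X n \<longleftrightarrow> (\<forall>t\<in>{0..T}. n t \<in> \<M> X \<and> ((\<lambda>s. PRW b (n s) (n t)) \<longlongrightarrow> 0) (at t within {0..T}))"

lemma Cf_nonneg: "Cf \<ge> 0" and Cg_nonneg: "Cg \<ge> 0"
proof -
  have "null_measure borel \<in> \<M> UNIV" by (auto simp: fin_measures_def intro!: finite_measureI)
  then have "norm (f 0 0 (null_measure borel)) \<le> Cf" "\<bar>g 0 0 (null_measure borel)\<bar> \<le> Cg"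
    using bdf[of 0] bdg[of 0] T by auto
  then show "Cf \<ge> 0" "Cg \<ge> 0" using norm_ge_zero order_trans abs_ge_zero by blast+
qed

lemma lipf_space:
  assumes "t \<in> {0..T}" "compact X" "m \<in> \<M> X"
  shows "norm (f t x m - f t y m) \<le> Lf * norm (x - y)"
proof -
  have "norm (f t x m - f t y m) \<le> Lf * (norm (x - y) + PRW b m m)"
    using lipf assms(1) fin_measures_UNIV[OF assms(3)] unfolding PRW_lipschitz_def by blast
  then show ?thesis using PRW_refl[OF assms(3,2)] b by simp
qed

lemma lipg_space:
  assumes "t \<in> {0..T}" "compact X" "m \<in> \<M> X"
  shows "\<bar>g t x m - g t y m\<bar> \<le> Lg * norm (x - y)"
proof -
  have "norm (g t x m - g t y m) \<le> Lg * (norm (x - y) + PRW b m m)"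
    using lipg assms(1) fin_measures_UNIV[OF assms(3)] unfolding PRW_lipschitz_def by blast
  then show ?thesis using PRW_refl[OF assms(3,2)] b by simp
qed

lemma lipf_measure:
  assumes "t \<in> {0..T}" "m \<in> \<M> UNIV" "n \<in> \<M> UNIV"
  shows "norm (f t x m - f t x n) \<le> Lf * PRW b m n"
proof -
  have "norm (f t x m - f t x n) \<le> Lf * (norm (x - x) + PRW b m n)"
    using lipf assms unfolding PRW_lipschitz_def by blast
  then show ?thesis by simp
qed

lemma lipg_measure:
  assumes "t \<in> {0..T}" "m \<in> \<M> UNIV" "n \<in> \<M> UNIV"
  shows "\<bar>g t x m - g t x n\<bar> \<le> Lg * PRW b m n"
proof -
  have "norm (g t x m - g t x n) \<le> Lg * (norm (x - x) + PRW b m n)"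
    using lipg assms unfolding PRW_lipschitz_def by blast
  then show ?thesis by simp
qed

text \<open>Joint continuity is a pointwise statement; covering the compact set \<open>X\<close> by finitely many of the
neighbourhoods that it provides makes it uniform in the space variable.\<close>

lemma curve_uniformly_continuous:
  fixes h :: "real \<Rightarrow> 'a \<Rightarrow> 'a measure \<Rightarrow> 'c::real_normed_vector"
  assumes h: "PRW_continuous T b h" and X: "compact X" and n: "PRW_curve X n" and t: "t \<in> {0..T}" and \<eta>: "\<eta> > 0"
  shows "\<forall>\<^sub>F s in at t within {0..T}. \<forall>x\<in>X. norm (h s x (n s) - h t x (n t)) \<le> \<eta>"
proof -
  have nU: "n s \<in> \<M> UNIV" if "s \<in> {0..T}" for s using n that fin_measures_UNIV unfolding PRW_curve_def by blast
  have self: "PRW b (n t) (n t) = 0" using n t X b by (intro PRW_refl[of _ X]) (auto simp: PRW_curve_def)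
  have "\<forall>x. \<exists>\<delta>>0. \<forall>s\<in>{0..T}. \<forall>y. \<bar>s - t\<bar> < \<delta> \<and> norm (y - x) < \<delta> \<and> PRW b (n s) (n t) < \<delta> \<longrightarrow> norm (h s y (n s) - h t x (n t)) < \<eta> / 2"
  proof
    fix x
    obtain \<delta> where "\<delta> > 0" "\<forall>s\<in>{0..T}. \<forall>y. \<forall>n'\<in>\<M> UNIV. \<bar>s - t\<bar> < \<delta> \<and> norm (y - x) < \<delta> \<and> PRW b n' (n t) < \<delta> \<longrightarrow> norm (h s y n' - h t x (n t)) < \<eta> / 2"
      using h[unfolded PRW_continuous_def, rule_format, OF t nU[OF t], of "\<eta> / 2" x] \<eta> by auto
    then show "\<exists>\<delta>>0. \<forall>s\<in>{0..T}. \<forall>y. \<bar>s - t\<bar> < \<delta> \<and> norm (y - x) < \<delta> \<and> PRW b (n s) (n t) < \<delta> \<longrightarrow> norm (h s y (n s) - h t x (n t)) < \<eta> / 2"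
      using nU by (intro exI[of _ \<delta>]) simp
  qed
  then obtain \<delta> where \<delta>: "\<And>x. \<delta> x > 0"
    "\<And>x s y. s \<in> {0..T} \<Longrightarrow> \<bar>s - t\<bar> < \<delta> x \<Longrightarrow> norm (y - x) < \<delta> x \<Longrightarrow> PRW b (n s) (n t) < \<delta> x \<Longrightarrow> norm (h s y (n s) - h t x (n t)) < \<eta> / 2"
    by metis
  obtain C where C: "C \<subseteq> X" "finite C" "X \<subseteq> (\<Union>x\<in>C. ball x (\<delta> x))"
  proof (rule compactE_image[OF X, of X "\<lambda>x. ball x (\<delta> x)"])
    show "X \<subseteq> (\<Union>x\<in>X. ball x (\<delta> x))" using \<delta>(1) by auto
  qed auto
  have "\<forall>\<^sub>F s in at t within {0..T}. \<forall>x\<in>C. \<bar>s - t\<bar> < \<delta> x \<and> PRW b (n s) (n t) < \<delta> x"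
  proof (intro eventually_ball_finite[OF C(2)] ballI eventually_conj)
    fix x
    show "\<forall>\<^sub>F s in at t within {0..T}. \<bar>s - t\<bar> < \<delta> x"
      unfolding eventually_at using \<delta>(1)[of x] by (auto simp: dist_real_def)
    show "\<forall>\<^sub>F s in at t within {0..T}. PRW b (n s) (n t) < \<delta> x"
      using n t \<delta>(1)[of x] order_tendstoD(2)[of "\<lambda>s. PRW b (n s) (n t)" 0] unfolding PRW_curve_def by blast
  qed
  moreover have "\<forall>\<^sub>F s in at t within {0..T}. s \<in> {0..T}"
    unfolding eventually_at by (auto intro: exI[of _ 1])
  ultimately show ?thesis
  proof eventually_elim
    case (elim s)
    show ?case
    proof
      fix y assume "y \<in> X"
      then obtain x where x: "x \<in> C" "norm (y - x) < \<delta> x" using C(3) by (auto simp: dist_norm norm_minus_commute)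
      have "norm (h s y (n s) - h t x (n t)) < \<eta> / 2" using \<delta>(2)[of s x y] elim x by auto
      moreover have "norm (h t y (n t) - h t x (n t)) < \<eta> / 2" using \<delta>(2)[of t x y] t x \<delta>(1)[of x] self by auto
      ultimately show "norm (h s y (n s) - h t y (n t)) \<le> \<eta>"
        using norm_triangle_ineq4[of "h s y (n s) - h t x (n t)" "h t y (n t) - h t x (n t)"] by simp
    qed
  qed
qed

lemma rate_integrand_props:
  fixes \<phi> :: "'a \<Rightarrow> real" and p :: "'a \<Rightarrow> 'a"
  assumes \<phi>: "potential b A \<phi> p" and A: "A \<ge> 0"
    and F: "\<And>x y. norm (F x - F y) \<le> Lf * norm (x - y)" "\<And>x. norm (F x) \<le> Cf"
    and \<gamma>: "\<And>x y. \<bar>\<gamma> x - \<gamma> y\<bar> \<le> Lg * norm (x - y)" "\<And>x. \<bar>\<gamma> x\<bar> \<le> Cg"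
  shows "\<bar>p x \<bullet> F x + \<phi> x * \<gamma> x\<bar> \<le> Cf + b * Cg"
    and "\<bar>(p x \<bullet> F x + \<phi> x * \<gamma> x) - (p y \<bullet> F y + \<phi> y * \<gamma> y)\<bar> \<le> (6 * A * Cf + Lf + Cg + b * Lg) * norm (x - y)"
proof -
  note pn = potential_grad_norm[OF \<phi>] and \<phi>b = potentialD(1)[OF \<phi>]
  have cs: "\<bar>v \<bullet> u\<bar> \<le> P * Q" if "norm v \<le> P" "norm u \<le> Q" for v u :: 'a and P Q
    using Cauchy_Schwarz_ineq2[of v u] mult_mono[OF that order_trans[OF norm_ge_zero that(1)] norm_ge_zero] by linarith
  have ab: "\<bar>v * u\<bar> \<le> P * Q" if "\<bar>v\<bar> \<le> P" "\<bar>u\<bar> \<le> Q" for v u P Q :: real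
    using mult_mono[OF that order_trans[OF abs_ge_zero that(1)] abs_ge_zero] by (simp add: abs_mult)
  show "\<bar>p x \<bullet> F x + \<phi> x * \<gamma> x\<bar> \<le> Cf + b * Cg"
    using cs[OF pn F(2), of x x] ab[OF \<phi>b \<gamma>(2), of x x] by linarith
  let ?r = "norm (x - y)"
  have "\<bar>(p x - p y) \<bullet> F x\<bar> \<le> (6 * A * ?r) * Cf"
    using quad_gradient_lipschitz[OF potentialD(3)[OF \<phi>] A, of x y] F(2) by (intro cs)
  moreover have "\<bar>p y \<bullet> (F x - F y)\<bar> \<le> 1 * (Lf * ?r)" using pn F(1) by (intro cs)
  moreover have "\<bar>(\<phi> x - \<phi> y) * \<gamma> x\<bar> \<le> ?r * Cg" using potentialD(2)[OF \<phi>] \<gamma>(2) by (intro ab)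
  moreover have "\<bar>\<phi> y * (\<gamma> x - \<gamma> y)\<bar> \<le> b * (Lg * ?r)" using \<phi>b \<gamma>(1) by (intro ab)
  moreover have "(p x \<bullet> F x + \<phi> x * \<gamma> x) - (p y \<bullet> F y + \<phi> y * \<gamma> y)
     = (p x - p y) \<bullet> F x + p y \<bullet> (F x - F y) + (\<phi> x - \<phi> y) * \<gamma> x + \<phi> y * (\<gamma> x - \<gamma> y)"
    by (simp add: inner_diff_left inner_diff_right algebra_simps)
  ultimately show "\<bar>(p x \<bullet> F x + \<phi> x * \<gamma> x) - (p y \<bullet> F y + \<phi> y * \<gamma> y)\<bar> \<le> (6 * A * Cf + Lf + Cg + b * Lg) * ?r"
    by (simp add: algebra_simps)
qed

lemma rate_integrand_borel:
  fixes \<phi> :: "'a \<Rightarrow> real" and p :: "'a \<Rightarrow> 'a"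
  assumes \<phi>: "potential b A \<phi> p" and A: "A \<ge> 0"
    and F: "F \<in> borel_measurable borel" and \<gamma>: "\<gamma> \<in> borel_measurable borel"
  shows "(\<lambda>x. p x \<bullet> F x + \<phi> x * \<gamma> x) \<in> borel_measurable borel"
proof -
  have "p \<in> borel_measurable borel"
    using quad_gradient_lipschitz[OF potentialD(3)[OF \<phi>] A] by (rule lipschitz_borel)
  then show ?thesis using F \<gamma> potential_borel[OF \<phi>] by measurable
qed

lemma coefficients_borel:
  assumes "t \<in> {0..T}" "compact X" "m \<in> \<M> X"
  shows "(\<lambda>x. f t x m) \<in> borel_measurable borel" "(\<lambda>x. g t x m) \<in> borel_measurable borel"
  using lipschitz_borel[OF lipf_space[OF assms]] lipschitz_borel[OF lipg_space[OF assms, folded real_norm_def]]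
  by auto

lemma integrand_bound:
  fixes \<phi> :: "'a \<Rightarrow> real" and p :: "'a \<Rightarrow> 'a"
  assumes \<phi>: "potential b A \<phi> p" and u: "norm u \<le> P" and v: "\<bar>v\<bar> \<le> Q"
  shows "\<bar>p x \<bullet> u + \<phi> x * v\<bar> \<le> P + b * Q"
proof -
  have "norm (p x) * norm u \<le> 1 * P" using potential_grad_norm[OF \<phi>] u by (intro mult_mono) auto
  moreover have "\<bar>\<phi> x\<bar> * \<bar>v\<bar> \<le> b * Q" using potentialD(1)[OF \<phi>] v b by (intro mult_mono) auto
  ultimately show ?thesis
    using Cauchy_Schwarz_ineq2[of "p x" u] by (simp add: abs_mult[symmetric]) 
qed

lemma rate_change_integrand:
  fixes \<phi> :: "'a \<Rightarrow> real" and p :: "'a \<Rightarrow> 'a"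
  assumes \<phi>: "potential b A \<phi> p" and A: "A \<ge> 0" and m: "m \<in> \<M> X" "compact X"
    and F: "F \<in> borel_measurable borel" "F' \<in> borel_measurable borel" "\<And>x. norm (F x) \<le> Cf" "\<And>x. norm (F' x) \<le> Cf"
    and \<gamma>: "\<gamma> \<in> borel_measurable borel" "\<gamma>' \<in> borel_measurable borel" "\<And>x. \<bar>\<gamma> x\<bar> \<le> Cg" "\<And>x. \<bar>\<gamma>' x\<bar> \<le> Cg"
    and d: "\<And>x. x \<in> X \<Longrightarrow> norm (F x - F' x) \<le> P" "\<And>x. x \<in> X \<Longrightarrow> \<bar>\<gamma> x - \<gamma>' x\<bar> \<le> Q" and PQ: "P \<ge> 0" "Q \<ge> 0"
  shows "\<bar>(\<integral>x. p x \<bullet> F x + \<phi> x * \<gamma> x \<partial>m) - (\<integral>x. p x \<bullet> F' x + \<phi> x * \<gamma>' x \<partial>m)\<bar> \<le> (P + b * Q) * measure m UNIV"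
proof -
  have i: "integrable m (\<lambda>x. p x \<bullet> F x + \<phi> x * \<gamma> x)" "integrable m (\<lambda>x. p x \<bullet> F' x + \<phi> x * \<gamma>' x)"
    using F \<gamma> by (auto intro!: fin_measures_integrable[OF fin_measures_UNIV[OF m(1)], of _ "Cf + b * Cg"]
      rate_integrand_borel[OF \<phi> A] integrand_bound[OF \<phi>])
  have "(\<integral>x. p x \<bullet> F x + \<phi> x * \<gamma> x \<partial>m) - (\<integral>x. p x \<bullet> F' x + \<phi> x * \<gamma>' x \<partial>m)
     = (\<integral>x. (p x \<bullet> F x + \<phi> x * \<gamma> x) - (p x \<bullet> F' x + \<phi> x * \<gamma>' x) \<partial>m)"
    using i by simp
  also have "\<dots> = (\<integral>x. p x \<bullet> (F x - F' x) + \<phi> x * (\<gamma> x - \<gamma>' x) \<partial>m)"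
    by (simp add: inner_diff_right algebra_simps)
  finally show ?thesis
    using abs_integral_le_mass[OF m, of "\<lambda>x. p x \<bullet> (F x - F' x) + \<phi> x * (\<gamma> x - \<gamma>' x)" "P + b * Q"]
      rate_integrand_borel[OF \<phi> A borel_measurable_diff[OF F(1,2)] borel_measurable_diff[OF \<gamma>(1,2)]]
      integrand_bound[OF \<phi> d] PQ b by simp
qed

lemma mass_le_PRW:
  assumes "m \<in> \<M> UNIV" "n \<in> \<M> UNIV"
  shows "\<bar>measure m UNIV - measure n UNIV\<bar> \<le> PRW b m n / b"
proof -
  have "\<bar>(\<integral>x. 1 \<partial>m) - (\<integral>x. 1 \<partial>n)\<bar> \<le> (1 / b + \<bar>0\<bar>) * PRW b m n"
    using assms b by (intro abs_integral_diff_le_PRW) auto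
  then show ?thesis using fin_measuresD[OF assms(1)] fin_measuresD[OF assms(2)] by simp
qed

text \<open>Continuity of the rate along a curve, uniformly over all potentials. The coefficients change little
by uniform continuity on \<open>X\<close>; the measure changes little because the integrand at the fixed time is bounded and
Lipschitz with a constant that depends on the potential through \<open>A\<close> only.\<close>

lemma rate_continuous:
  assumes X: "compact X" and n: "PRW_curve X n" and t: "t \<in> {0..T}" and A: "A \<ge> 0" and \<eta>: "\<eta> > 0"
  shows "\<forall>\<^sub>F s in at t within {0..T}. \<forall>\<phi> p. potential b A \<phi> p \<longrightarrow> \<bar>rate \<phi> p s (n s) - rate \<phi> p t (n t)\<bar> \<le> \<eta>"
proof -
  have nX: "n s \<in> \<M> X" if "s \<in> {0..T}" for s using n that unfolding PRW_curve_def by blast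
  note nU = fin_measures_UNIV[OF nX]
  define M where "M = measure (n t) UNIV + 1"
  have M: "M > 0" by (simp add: M_def add_nonneg_pos)
  define e where "e = \<eta> / (2 * (1 + b) * M)"
  have e: "e > 0" using \<eta> M b by (simp add: e_def)
  \<comment> \<open>the factor by which \<open>PRW\<close> controls integrals of the frozen integrand\<close>
  define L where "L = (Cf + b * Cg) / b + \<bar>6 * A * Cf + Lf + Cg + b * Lg\<bar>"
  have L: "L \<ge> 0" using Cf_nonneg Cg_nonneg b by (simp add: L_def)
  have tend: "((\<lambda>s. PRW b (n s) (n t)) \<longlongrightarrow> 0) (at t within {0..T})"
    using n t unfolding PRW_curve_def by blast
  have "min b (\<eta> / (2 * (L + 1))) > 0" using b \<eta> L by simp
  from order_tendstoD(2)[OF tend this]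
  have "\<forall>\<^sub>F s in at t within {0..T}. PRW b (n s) (n t) < min b (\<eta> / (2 * (L + 1)))" .
  moreover have "\<forall>\<^sub>F s in at t within {0..T}. s \<in> {0..T}"
    unfolding eventually_at by (auto intro: exI[of _ 1])
  moreover note curve_uniformly_continuous[OF contf X n t e] curve_uniformly_continuous[OF contg X n t e]
  ultimately show ?thesis
  proof eventually_elim
    case (elim s)
    note s = elim(2)
    have "PRW b (n s) (n t) / b \<le> 1" using elim(1) b by simp
    then have mass: "measure (n s) UNIV \<le> M" using mass_le_PRW[OF nU[OF s] nU[OF t]] by (simp add: M_def)
    show ?case
    proof (intro allI impI)
      fix \<phi> :: "'a \<Rightarrow> real" and p :: "'a \<Rightarrow> 'a" assume \<phi>: "potential b A \<phi> p"
      let ?k = "\<lambda>x. p x \<bullet> f t x (n t) + \<phi> x * g t x (n t)"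
      have "\<bar>rate \<phi> p s (n s) - (\<integral>x. ?k x \<partial>(n s))\<bar> \<le> (e + b * e) * measure (n s) UNIV"
        unfolding rate_def
        by (rule rate_change_integrand[OF \<phi> A nX[OF s] X])
          (use elim(3,4) e bdf[OF s nU[OF s]] bdf[OF t nU[OF t]] bdg[OF s nU[OF s]] bdg[OF t nU[OF t]]
            coefficients_borel[OF s X nX[OF s]] coefficients_borel[OF t X nX[OF t]] in simp_all)
      also have "\<dots> \<le> (e + b * e) * M" using mass e b by (intro mult_left_mono) auto
      also have "\<dots> = e * ((1 + b) * M)" by (simp add: algebra_simps)
      also have "\<dots> = \<eta> / (2 * ((1 + b) * M)) * ((1 + b) * M)" by (simp only: e_def mult.assoc)
      also have "\<dots> = \<eta> / 2" using M b by simp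
      finally have 1: "\<bar>rate \<phi> p s (n s) - (\<integral>x. ?k x \<partial>(n s))\<bar> \<le> \<eta> / 2" .
      have "\<bar>(\<integral>x. ?k x \<partial>(n s)) - (\<integral>x. ?k x \<partial>(n t))\<bar> \<le> L * PRW b (n s) (n t)"
        unfolding L_def using lipf_space[OF t X nX[OF t]] lipg_space[OF t X nX[OF t]] bdf[OF t nU[OF t]] bdg[OF t nU[OF t]]
        by (intro abs_integral_diff_le_PRW[OF nU[OF s] nU[OF t] b] rate_integrand_props[OF \<phi> A])
      also have "\<dots> \<le> (L + 1) * (\<eta> / (2 * (L + 1)))"
        using elim(1) L PRW_nonneg[of b "n s" "n t"] by (intro mult_mono) auto
      also have "\<dots> = \<eta> / 2" using L by (simp add: divide_simps)
      finally show "\<bar>rate \<phi> p s (n s) - rate \<phi> p t (n t)\<bar> \<le> \<eta>"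
        using 1 unfolding rate_def[of _ _ t] by linarith
    qed
  qed
qed

section \<open>Increments along weak solutions\<close>

text \<open>The solutions are carried by the compact set \<open>K\<close>, where a potential agrees with a genuine test function
to first order.\<close>

lemma weak_solution_increment:
  fixes \<phi> :: "'a \<Rightarrow> real" and p :: "'a \<Rightarrow> 'a"
  assumes weak: "weak_solution T b f g m\<^sub>0 m" and mK: "\<And>t. t \<in> {0..T} \<Longrightarrow> m t \<in> \<M> K" and K: "compact K"
    and \<phi>: "potential b A \<phi> p" and A: "A \<ge> 0" and st: "0 \<le> s" "s \<le> t" "t \<le> T"
  shows "((\<lambda>r. rate \<phi> p r (m r)) has_integral (\<integral>x. \<phi> x \<partial>m t) - (\<integral>x. \<phi> x \<partial>m s)) {s..t}"
proof -
  obtain \<theta> :: "'a \<Rightarrow> real" and \<theta>' R where \<theta>: "\<And>x. (\<theta> has_derivative (\<lambda>v. \<theta>' x \<bullet> v)) (at x)" "continuous_on UNIV \<theta>'"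
    "\<And>x. norm x > R \<Longrightarrow> \<theta> x = 0" and on_K: "\<And>x. x \<in> K \<Longrightarrow> \<theta> x = 1" "\<And>x. x \<in> K \<Longrightarrow> \<theta>' x = 0"
    using cutoff[OF K] by metis
  note d\<phi> = quad_gradient_has_derivative[OF potentialD(3)[OF \<phi>]]
  note lip_p = quad_gradient_lipschitz[OF potentialD(3)[OF \<phi>] A]
  have "(6 * A)-lipschitz_on UNIV p" using lip_p A by (auto simp: lipschitz_on_def dist_norm)
  then have cp: "continuous_on UNIV p" by (rule lipschitz_on_continuous_on)
  let ?\<psi> = "\<lambda>x. \<phi> x * \<theta> x" and ?P = "\<lambda>x. \<theta> x *\<^sub>R p x + \<phi> x *\<^sub>R \<theta>' x"
  let ?I = "\<lambda>t. \<integral>x. 0 + ?P x \<bullet> f t x (m t) + ?\<psi> x * g t x (m t) \<partial>m t"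
  have c: "continuous_on UNIV \<phi>" "continuous_on UNIV \<theta>"
    using d\<phi> \<theta>(1) by (auto intro!: has_derivative_continuous_on)
  have b\<psi>: "?\<psi> \<in> borel_measurable borel" "?P \<in> borel_measurable borel"
    using c cp \<theta>(2) by (auto intro!: borel_measurable_continuous_onI continuous_intros)
  have weak0: "(?I has_integral (\<integral>x. ?\<psi> x \<partial>m s) - (\<integral>x. ?\<psi> x \<partial>m\<^sub>0)) {0..s}" if "s \<in> {0..T}" for s
    using weak[unfolded weak_solution_def, THEN conjunct2, THEN conjunct2, rule_format,
      OF test_function_cutoff[where T = T, OF d\<phi> cp \<theta>] that] by simp
  have sets: "sets (m r) = sets borel" if "r \<in> {0..T}" for r using fin_measuresD(1)[OF mK[OF that]] .
  have \<psi>: "(\<integral>x. ?\<psi> x \<partial>m r) = (\<integral>x. \<phi> x \<partial>m r)" if r: "r \<in> {0..T}" for r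
  proof (rule integral_cong_AE)
    show "?\<psi> \<in> borel_measurable (m r)" "\<phi> \<in> borel_measurable (m r)"
      unfolding measurable_cong_sets[OF sets[OF r] refl] using b\<psi> potential_borel[OF \<phi>] by auto
    show "AE x in m r. ?\<psi> x = \<phi> x" using AE_support[OF mK[OF r] K] by eventually_elim (simp add: on_K)
  qed
  have I: "?I r = rate \<phi> p r (m r)" if r: "r \<in> {0..T}" for r
    unfolding rate_def
  proof (rule integral_cong_AE)
    note cb = coefficients_borel[OF r K mK[OF r]]
    show "(\<lambda>x. 0 + ?P x \<bullet> f r x (m r) + ?\<psi> x * g r x (m r)) \<in> borel_measurable (m r)"
      unfolding measurable_cong_sets[OF sets[OF r] refl] using b\<psi> cb by measurable
    show "(\<lambda>x. p x \<bullet> f r x (m r) + \<phi> x * g r x (m r)) \<in> borel_measurable (m r)"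
      unfolding measurable_cong_sets[OF sets[OF r] refl] using cb by (intro rate_integrand_borel[OF \<phi> A])
    show "AE x in m r. 0 + ?P x \<bullet> f r x (m r) + ?\<psi> x * g r x (m r) = p x \<bullet> f r x (m r) + \<phi> x * g r x (m r)"
      using AE_support[OF mK[OF r] K] by eventually_elim (simp add: on_K)
  qed
  let ?J = "\<lambda>r. rate \<phi> p r (m r)"
  have J: "(?J has_integral (\<integral>x. \<phi> x \<partial>m r) - (\<integral>x. ?\<psi> x \<partial>m\<^sub>0)) {0..r}" if r: "r \<in> {0..T}" for r
    using weak0[OF r] unfolding \<psi>[OF r] by (rule has_integral_eq[rotated]) (use r I in auto)
  have s: "s \<in> {0..T}" and t: "t \<in> {0..T}" using st by auto
  have int: "?J integrable_on {0..t}" using J[OF t] by blast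
  then have int': "?J integrable_on {s..t}" by (rule integrable_subinterval_real) (use st in auto)
  have "integral {0..s} ?J + integral {s..t} ?J = integral {0..t} ?J"
    by (rule Henstock_Kurzweil_Integration.integral_combine[OF st(1,2) int])
  then have "integral {s..t} ?J = (\<integral>x. \<phi> x \<partial>m t) - (\<integral>x. \<phi> x \<partial>m s)"
    using integral_unique[OF J[OF s]] integral_unique[OF J[OF t]] by simp
  then show ?thesis using int' by (metis integrable_integral)
qed

text \<open>Constants are potentials, and for them the rate is at most \<open>Cg\<close> times the mass.\<close>

lemma weak_solution_mass:
  assumes weak: "weak_solution T b f g m\<^sub>0 m" and mK: "\<And>t. t \<in> {0..T} \<Longrightarrow> m t \<in> \<M> K" and K: "compact K"
    and t: "0 \<le> t" "t \<le> T"
  shows "measure (m t) UNIV \<le> measure (m 0) UNIV * exp (Cg * t)"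
proof (rule continuous_mean_gronwall[OF Cg_nonneg _ _ _ t])
  note mU = fin_measures_UNIV[OF mK]
  have curve: "((\<lambda>s. PRW b (m s) (m t)) \<longlongrightarrow> 0) (at t within {0..T})" if "t \<in> {0..T}" for t
    using weak[unfolded weak_solution_def, THEN conjunct2, THEN conjunct1] that by blast
  show cont: "continuous_on {0..T} (\<lambda>t. measure (m t) UNIV)"
    unfolding continuous_on_def
  proof
    fix t assume t: "t \<in> {0..T}"
    have "((\<lambda>s. PRW b (m s) (m t) / b) \<longlongrightarrow> 0 / b) (at t within {0..T})"
      using b by (intro tendsto_divide curve t tendsto_const) auto
    moreover have "\<forall>\<^sub>F s in at t within {0..T}. norm (measure (m s) UNIV - measure (m t) UNIV) \<le> PRW b (m s) (m t) / b"
      unfolding eventually_at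
    proof (intro exI[of _ 1] conjI ballI impI)
      fix s assume s: "s \<in> {0..T}"
      show "norm (measure (m s) UNIV - measure (m t) UNIV) \<le> PRW b (m s) (m t) / b"
        using mass_le_PRW[OF mU[OF s] mU[OF t]] by simp
    qed simp
    ultimately have "((\<lambda>s. measure (m s) UNIV - measure (m t) UNIV) \<longlongrightarrow> 0) (at t within {0..T})"
      by (simp add: Lim_null_comparison)
    then show "((\<lambda>s. measure (m s) UNIV) \<longlongrightarrow> measure (m t) UNIV) (at t within {0..T})" by (rule LIM_zero_cancel)
  qed
  fix s t assume st: "0 \<le> s" "s < t" "t \<le> T"
  have "continuous_on {s..t} (\<lambda>t. measure (m t) UNIV)" using cont by (rule continuous_on_subset) (use st in auto)
  moreover have "{s..t} \<noteq> {}" using st by simp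
  ultimately obtain \<xi> where \<xi>: "\<xi> \<in> {s..t}" "\<forall>r\<in>{s..t}. measure (m r) UNIV \<le> measure (m \<xi>) UNIV"
    using continuous_attains_sup[OF compact_Icc, of s t] by blast
  have const: "potential b 0 (\<lambda>x::'a. b) (\<lambda>x. 0)" using b by (simp add: potential_def has_quad_gradient_def)
  have int: "((\<lambda>r. rate (\<lambda>x. b) (\<lambda>x. 0) r (m r)) has_integral b * measure (m t) UNIV - b * measure (m s) UNIV) {s..t}"
  proof -
    have "((\<lambda>r. rate (\<lambda>x. b) (\<lambda>x. 0) r (m r)) has_integral (\<integral>x. b \<partial>m t) - (\<integral>x. b \<partial>m s)) {s..t}"
      by (rule weak_solution_increment[OF weak mK K const]) (use st in auto)
    moreover have "space (m t) = UNIV" "space (m s) = UNIV" using fin_measuresD(3)[OF mK] st by auto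
    ultimately show ?thesis by (simp add: mult.commute)
  qed
  have le: "rate (\<lambda>x. b) (\<lambda>x. 0) r (m r) \<le> b * (Cg * measure (m \<xi>) UNIV)" if r: "r \<in> {s..t}" for r
  proof -
    have rT: "r \<in> {0..T}" using r st by auto
    have "\<bar>rate (\<lambda>x. b) (\<lambda>x. 0) r (m r)\<bar> \<le> (b * Cg) * measure (m r) UNIV"
      unfolding rate_def
    proof (rule abs_integral_le_mass[OF mK[OF rT] K])
      show "(\<lambda>x. 0 \<bullet> f r x (m r) + b * g r x (m r)) \<in> borel_measurable borel"
        using coefficients_borel[OF rT K mK[OF rT]] by simp
      show "\<bar>0 \<bullet> f r x (m r) + b * g r x (m r)\<bar> \<le> b * Cg" for x
        using mult_left_mono[OF bdg[OF rT mU[OF rT], of x] less_imp_le[OF b]] b by (simp add: abs_mult)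
    qed (use b Cg_nonneg in simp)
    also have "\<dots> \<le> (b * Cg) * measure (m \<xi>) UNIV" using bspec[OF \<xi>(2) r] b Cg_nonneg by (intro mult_left_mono) auto
    finally show ?thesis by (simp add: mult.assoc)
  qed
  have "b * measure (m t) UNIV - b * measure (m s) UNIV \<le> (t - s) * (b * (Cg * measure (m \<xi>) UNIV))"
  proof -
    have "((\<lambda>r. b * (Cg * measure (m \<xi>) UNIV)) has_integral (t - s) * (b * (Cg * measure (m \<xi>) UNIV))) {s..t}"
      using has_integral_const_real[of "b * (Cg * measure (m \<xi>) UNIV)" s t] st by simp
    from has_integral_le[OF int this le] show ?thesis .
  qed
  then have "b * (measure (m t) UNIV - measure (m s) UNIV) \<le> b * ((t - s) * (Cg * measure (m \<xi>) UNIV))"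
    by (simp add: algebra_simps)
  then have "measure (m t) UNIV - measure (m s) UNIV \<le> (t - s) * (Cg * measure (m \<xi>) UNIV)" using b by simp
  then show "\<exists>\<xi>\<in>{s..t}. measure (m t) UNIV - measure (m s) UNIV \<le> (t - s) * (Cg * measure (m \<xi>) UNIV)" using \<xi>(1) by blast
qed simp

section \<open>Increments along the Markov chain equation\<close>

text \<open>The matrices \<open>Q\<close> may depend on time in an irregular way. The mean value theorem needs the derivative
at a single time only, where the fundamental theorem of calculus would need its integrability. The vanishing row sums allow
\<open>\<phi> y\<close> to be replaced by \<open>\<phi> y - \<phi> x\<close>.\<close>

lemma ode_increment_mean_value:
  fixes \<phi> :: "'a \<Rightarrow> real"
  assumes S: "finite S" and ode: "ode_solution T S Q g \<beta>"
    and kol: "\<And>t. t \<in> {0..T} \<Longrightarrow> kolmogorov_matrix S (Q t (\<beta> t))"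
    and st: "0 \<le> s" "s < t" "t \<le> T"
  obtains \<xi> where "\<xi> \<in> {s..t}" "(\<Sum>x\<in>S. \<beta> t x * \<phi> x) - (\<Sum>x\<in>S. \<beta> s x * \<phi> x) =
    (t - s) * (\<Sum>x\<in>S. \<beta> \<xi> x * ((\<Sum>y\<in>S. Q \<xi> (\<beta> \<xi>) x y * (\<phi> y - \<phi> x)) + \<phi> x * g \<xi> x (\<I> S (\<beta> \<xi>))))"
proof -
  let ?Q = "\<lambda>r. Q r (\<beta> r)" and ?g = "\<lambda>r x. g r x (\<I> S (\<beta> r))"
  let ?u = "\<lambda>r. \<Sum>x\<in>S. \<beta> r x * \<phi> x"
  let ?d = "\<lambda>r. \<Sum>y\<in>S. (row_mult S (\<beta> r) (?Q r) y + row_mult S (\<beta> r) (G_matrix S g r (\<beta> r)) y) * \<phi> y"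
  have der: "(?u has_real_derivative ?d r) (at r within {0..T})" if "r \<in> {0..T}" for r
    using ode that unfolding ode_solution_def by (intro DERIV_sum DERIV_cmult_right) auto
  have cont: "continuous_on {s..t} ?u"
    using der st by (intro continuous_on_subset[OF DERIV_continuous_on, of "{0..T}"]) auto
  have "(?u has_derivative (\<lambda>v. v * ?d r)) (at r)" if "s < r" "r < t" for r
  proof -
    have "(?u has_real_derivative ?d r) (at r)"
      using der[of r] that st by (simp add: at_within_Icc_at)
    then show ?thesis by (simp add: has_field_derivative_def mult_commute_abs)
  qed
  then obtain \<xi> where \<xi>: "s < \<xi>" "\<xi> < t" "?u t - ?u s = (t - s) * ?d \<xi>"
    by (rule mvt[OF st(2) cont, of "\<lambda>r v. v * ?d r"])
  have \<xi>T: "\<xi> \<in> {0..T}" using \<xi> st by auto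
  have Gm: "row_mult S (\<beta> \<xi>) (G_matrix S g \<xi> (\<beta> \<xi>)) y = \<beta> \<xi> y * ?g \<xi> y" if "y \<in> S" for y
    using S that by (simp add: row_mult_def G_matrix_def if_distrib cong: if_cong)
  have "(\<Sum>y\<in>S. row_mult S (\<beta> \<xi>) (?Q \<xi>) y * \<phi> y) = (\<Sum>x\<in>S. \<beta> \<xi> x * (\<Sum>y\<in>S. ?Q \<xi> x y * \<phi> y))"
    unfolding row_mult_def sum_distrib_left sum_distrib_right by (subst sum.swap) (simp add: mult.assoc)
  also have "\<dots> = (\<Sum>x\<in>S. \<beta> \<xi> x * (\<Sum>y\<in>S. ?Q \<xi> x y * (\<phi> y - \<phi> x)))"
  proof (rule sum.cong[OF refl])
    fix x assume "x \<in> S"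
    then have "(\<Sum>y\<in>S. ?Q \<xi> x y) = 0" using kol[OF \<xi>T] by (simp add: kolmogorov_matrix_def)
    then have "(\<Sum>y\<in>S. ?Q \<xi> x y * \<phi> y) = (\<Sum>y\<in>S. ?Q \<xi> x y * (\<phi> y - \<phi> x))"
      by (simp add: right_diff_distrib sum_subtractf flip: sum_distrib_right)
    then show "\<beta> \<xi> x * (\<Sum>y\<in>S. ?Q \<xi> x y * \<phi> y) = \<beta> \<xi> x * (\<Sum>y\<in>S. ?Q \<xi> x y * (\<phi> y - \<phi> x))" by simp
  qed
  finally have "?d \<xi> = (\<Sum>x\<in>S. \<beta> \<xi> x * ((\<Sum>y\<in>S. ?Q \<xi> x y * (\<phi> y - \<phi> x)) + \<phi> x * ?g \<xi> x))"
    by (simp add: Gm distrib_left distrib_right sum.distrib mult_ac)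
  then show thesis using that[of \<xi>] \<xi> by auto
qed

lemma ode_solution_mass:
  assumes S: "finite S" and ode: "ode_solution T S Q g \<beta>"
    and kol: "\<And>t. t \<in> {0..T} \<Longrightarrow> kolmogorov_matrix S (Q t (\<beta> t))"
    and t: "0 \<le> t" "t \<le> T"
  shows "(\<Sum>x\<in>S. \<beta> t x) \<le> (\<Sum>x\<in>S. \<beta> 0 x) * exp (Cg * t)"
proof (rule continuous_mean_gronwall[OF Cg_nonneg _ _ _ t])
  have \<beta>: "\<beta> r \<in> l1_plus S" if "r \<in> {0..T}" for r using ode that by (simp add: ode_solution_def)
  show "0 \<le> (\<Sum>x\<in>S. \<beta> r x)" if "0 \<le> r" "r \<le> T" for r
    using \<beta>[of r] that by (intro sum_nonneg) (auto simp: l1_plus_def)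
  show "continuous_on {0..T} (\<lambda>t. \<Sum>x\<in>S. \<beta> t x)"
    using ode unfolding ode_solution_def by (intro continuous_on_sum) (auto intro!: DERIV_continuous_on)
  fix s t assume st: "0 \<le> s" "s < t" "t \<le> T"
  from ode_increment_mean_value[OF S ode kol st, of "\<lambda>_. 1"]
  obtain \<xi> where \<xi>: "\<xi> \<in> {s..t}" "(\<Sum>x\<in>S. \<beta> t x) - (\<Sum>x\<in>S. \<beta> s x) = (t - s) * (\<Sum>x\<in>S. \<beta> \<xi> x * g \<xi> x (\<I> S (\<beta> \<xi>)))"
    by auto
  have \<xi>T: "\<xi> \<in> {0..T}" using \<xi> st by auto
  have "(\<Sum>x\<in>S. \<beta> \<xi> x * g \<xi> x (\<I> S (\<beta> \<xi>))) \<le> (\<Sum>x\<in>S. \<beta> \<xi> x * Cg)"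
  proof (intro sum_mono mult_left_mono)
    fix x assume "x \<in> S"
    then show "0 \<le> \<beta> \<xi> x" using \<beta>[OF \<xi>T] by (simp add: l1_plus_def)
    show "g \<xi> x (\<I> S (\<beta> \<xi>)) \<le> Cg"
      using bdg[OF \<xi>T fin_measures_UNIV[OF atomic_in_fin_measures[OF S]], of x "\<beta> \<xi>"] by linarith
  qed
  then have "(t - s) * (\<Sum>x\<in>S. \<beta> \<xi> x * g \<xi> x (\<I> S (\<beta> \<xi>))) \<le> (t - s) * (Cg * (\<Sum>x\<in>S. \<beta> \<xi> x))"
    using st by (intro mult_left_mono) (auto simp: sum_distrib_left mult.commute)
  then show "\<exists>\<xi>\<in>{s..t}. (\<Sum>x\<in>S. \<beta> t x) - (\<Sum>x\<in>S. \<beta> s x) \<le> (t - s) * (Cg * (\<Sum>x\<in>S. \<beta> \<xi> x))"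
    using \<xi> by (intro bexI[of _ \<xi>]) auto
qed

text \<open>This is where both conditions on \<open>Q\<close> enter: the first moment of the jumps is compared with the drift, and the quadratic
remainder of \<open>\<phi>\<close> is integrated against the second moment. The diagonal entry, which may be negative, belongs to
the jump of length 0 and does not contribute.\<close>

lemma generator_lower_bound:
  fixes \<phi> :: "'a \<Rightarrow> real"
  assumes \<phi>: "potential b A \<phi> p" and A: "A \<ge> 0" and x: "x \<in> S"
    and kol: "kolmogorov_matrix S q"
    and drift: "norm (v - (\<Sum>y\<in>S. q x y *\<^sub>R (y - x))) \<le> \<epsilon>"
    and var: "(\<Sum>y\<in>S. (norm (x - y))\<^sup>2 * q x y) \<le> \<epsilon>\<^sup>2"
  shows "p x \<bullet> v - (\<epsilon> + A * \<epsilon>\<^sup>2) \<le> (\<Sum>y\<in>S. q x y * (\<phi> y - \<phi> x))"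
proof -
  have "(\<Sum>y\<in>S. q x y * (\<phi> y - \<phi> x)) \<ge> (\<Sum>y\<in>S. q x y * (p x \<bullet> (y - x)) - A * ((norm (x - y))\<^sup>2 * q x y))"
  proof (rule sum_mono)
    fix y assume y: "y \<in> S"
    show "q x y * (p x \<bullet> (y - x)) - A * ((norm (x - y))\<^sup>2 * q x y) \<le> q x y * (\<phi> y - \<phi> x)"
    proof (cases "y = x")
      case False
      then have "q x y \<ge> 0" using kol x y by (auto simp: kolmogorov_matrix_def)
      moreover have "p x \<bullet> (y - x) - A * (norm (x - y))\<^sup>2 \<le> \<phi> y - \<phi> x"
        using has_quad_gradientD[OF potentialD(3)[OF \<phi>], of y x] by (simp add: abs_le_iff norm_minus_commute)
      ultimately have "q x y * (p x \<bullet> (y - x) - A * (norm (x - y))\<^sup>2) \<le> q x y * (\<phi> y - \<phi> x)"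
        by (rule mult_left_mono[rotated])
      then show ?thesis by (simp add: algebra_simps)
    qed simp
  qed
  moreover have "(\<Sum>y\<in>S. q x y * (p x \<bullet> (y - x)) - A * ((norm (x - y))\<^sup>2 * q x y))
     = p x \<bullet> (\<Sum>y\<in>S. q x y *\<^sub>R (y - x)) - A * (\<Sum>y\<in>S. (norm (x - y))\<^sup>2 * q x y)"
    by (simp add: sum_subtractf inner_sum_right sum_distrib_left)
  moreover have "A * (\<Sum>y\<in>S. (norm (x - y))\<^sup>2 * q x y) \<le> A * \<epsilon>\<^sup>2" using var A by (rule mult_left_mono)
  moreover have "p x \<bullet> v - p x \<bullet> (\<Sum>y\<in>S. q x y *\<^sub>R (y - x)) \<le> 1 * \<epsilon>"
  proof -
    have "norm (p x) * norm (v - (\<Sum>y\<in>S. q x y *\<^sub>R (y - x))) \<le> 1 * \<epsilon>"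
      using potential_grad_norm[OF \<phi>] drift by (intro mult_mono) auto
    then show ?thesis using norm_cauchy_schwarz[of "p x" "v - (\<Sum>y\<in>S. q x y *\<^sub>R (y - x))"] by (simp add: inner_diff_right)
  qed
  ultimately show ?thesis by linarith
qed

lemma ode_solution_PRW_curve:
  assumes S: "finite S" and ode: "ode_solution T S Q g \<beta>" and X: "S \<subseteq> X"
  shows "PRW_curve X (\<lambda>t. \<I> S (\<beta> t))"
  unfolding PRW_curve_def
proof (intro ballI conjI)
  fix t assume t: "t \<in> {0..T}"
  show "\<I> S (\<beta> t) \<in> \<M> X"
    by (rule fin_measures_mono[OF atomic_in_fin_measures[OF S] X]) (use finite_imp_closed[OF S] in auto)
  have \<beta>: "\<beta> r \<in> l1_plus S" if "r \<in> {0..T}" for r using ode that by (simp add: ode_solution_def)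
  have lim: "((\<lambda>s. \<beta> s x) \<longlongrightarrow> \<beta> t x) (at t within {0..T})" if "x \<in> S" for x
    using DERIV_continuous[OF ode[unfolded ode_solution_def, THEN conjunct2, rule_format, OF t that]]
    unfolding continuous_within .
  have "((\<lambda>s. b * (\<Sum>x\<in>S. \<bar>\<beta> s x - \<beta> t x\<bar>)) \<longlongrightarrow> b * (\<Sum>x\<in>S. \<bar>\<beta> t x - \<beta> t x\<bar>)) (at t within {0..T})"
    by (intro tendsto_mult tendsto_const tendsto_sum tendsto_rabs tendsto_diff lim)
  then have "((\<lambda>s. b * (\<Sum>x\<in>S. \<bar>\<beta> s x - \<beta> t x\<bar>)) \<longlongrightarrow> 0) (at t within {0..T})" by simp
  moreover have "\<forall>\<^sub>F s in at t within {0..T}. norm (PRW b (\<I> S (\<beta> s)) (\<I> S (\<beta> t))) \<le> b * (\<Sum>x\<in>S. \<bar>\<beta> s x - \<beta> t x\<bar>)"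
    unfolding eventually_at
  proof (intro exI[of _ 1] conjI ballI impI)
    fix s assume s: "s \<in> {0..T}"
    show "norm (PRW b (\<I> S (\<beta> s)) (\<I> S (\<beta> t))) \<le> b * (\<Sum>x\<in>S. \<bar>\<beta> s x - \<beta> t x\<bar>)"
      using PRW_atomic_le[OF S \<beta>[OF s] \<beta>[OF t], of b] b PRW_nonneg[of b "\<I> S (\<beta> s)" "\<I> S (\<beta> t)"] by simp
  qed simp
  ultimately show "((\<lambda>s. PRW b (\<I> S (\<beta> s)) (\<I> S (\<beta> t))) \<longlongrightarrow> 0) (at t within {0..T})"
    by (rule Lim_null_comparison[rotated])
qed

lemma ode_increment:
  fixes \<phi> :: "'a \<Rightarrow> real"
  assumes S: "finite S" and ode: "ode_solution T S Q g \<beta>"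
    and kol: "\<And>t. t \<in> {0..T} \<Longrightarrow> kolmogorov_matrix S (Q t (\<beta> t))"
    and drift: "\<And>t x. t \<in> {0..T} \<Longrightarrow> x \<in> S \<Longrightarrow> norm (f t x (\<I> S (\<beta> t)) - (\<Sum>y\<in>S. Q t (\<beta> t) x y *\<^sub>R (y - x))) \<le> \<epsilon>"
    and var: "\<And>t x. t \<in> {0..T} \<Longrightarrow> x \<in> S \<Longrightarrow> (\<Sum>y\<in>S. (norm (x - y))\<^sup>2 * Q t (\<beta> t) x y) \<le> \<epsilon>\<^sup>2"
    and mass: "\<And>t. t \<in> {0..T} \<Longrightarrow> (\<Sum>x\<in>S. \<beta> t x) \<le> M"
    and \<phi>: "potential b A \<phi> p" and A: "A \<ge> 0" and \<epsilon>: "\<epsilon> \<ge> 0"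
    and st: "0 \<le> s" "s < t" "t \<le> T"
  shows "\<exists>\<xi>\<in>{s..t}. (t - s) * (rate \<phi> p \<xi> (\<I> S (\<beta> \<xi>)) - (\<epsilon> + A * \<epsilon>\<^sup>2) * M) \<le> (\<integral>x. \<phi> x \<partial>(\<I> S (\<beta> t))) - (\<integral>x. \<phi> x \<partial>(\<I> S (\<beta> s)))"
proof -
  have \<beta>: "\<beta> r \<in> l1_plus S" if "r \<in> {0..T}" for r using ode that by (simp add: ode_solution_def)
  obtain \<xi> where \<xi>: "\<xi> \<in> {s..t}" "(\<Sum>x\<in>S. \<beta> t x * \<phi> x) - (\<Sum>x\<in>S. \<beta> s x * \<phi> x) =
    (t - s) * (\<Sum>x\<in>S. \<beta> \<xi> x * ((\<Sum>y\<in>S. Q \<xi> (\<beta> \<xi>) x y * (\<phi> y - \<phi> x)) + \<phi> x * g \<xi> x (\<I> S (\<beta> \<xi>))))"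
    using ode_increment_mean_value[OF S ode kol st, of \<phi>] by blast
  have \<xi>T: "\<xi> \<in> {0..T}" using \<xi> st by auto
  let ?m = "\<I> S (\<beta> \<xi>)" and ?e = "\<epsilon> + A * \<epsilon>\<^sup>2"
  have "?e * (\<Sum>x\<in>S. \<beta> \<xi> x) \<le> ?e * M" using mass[OF \<xi>T] \<epsilon> A by (intro mult_left_mono) auto
  moreover have "rate \<phi> p \<xi> ?m = (\<Sum>x\<in>S. \<beta> \<xi> x * (p x \<bullet> f \<xi> x ?m + \<phi> x * g \<xi> x ?m))"
    unfolding rate_def
    using coefficients_borel[OF \<xi>T finite_imp_compact[OF S] atomic_in_fin_measures[OF S]]
    by (intro integral_atomic[OF S \<beta>[OF \<xi>T]] rate_integrand_borel[OF \<phi> A])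
  moreover have "(\<Sum>x\<in>S. \<beta> \<xi> x * (p x \<bullet> f \<xi> x ?m + \<phi> x * g \<xi> x ?m) - ?e * \<beta> \<xi> x)
     \<le> (\<Sum>x\<in>S. \<beta> \<xi> x * ((\<Sum>y\<in>S. Q \<xi> (\<beta> \<xi>) x y * (\<phi> y - \<phi> x)) + \<phi> x * g \<xi> x ?m))"
  proof (rule sum_mono)
    fix x assume x: "x \<in> S"
    have "p x \<bullet> f \<xi> x ?m - ?e \<le> (\<Sum>y\<in>S. Q \<xi> (\<beta> \<xi>) x y * (\<phi> y - \<phi> x))"
      by (rule generator_lower_bound[OF \<phi> A x kol[OF \<xi>T] drift[OF \<xi>T x] var[OF \<xi>T x]])
    moreover have "\<beta> \<xi> x \<ge> 0" using \<beta>[OF \<xi>T] x by (simp add: l1_plus_def)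
    ultimately have "\<beta> \<xi> x * (p x \<bullet> f \<xi> x ?m - ?e + \<phi> x * g \<xi> x ?m) \<le> \<beta> \<xi> x * ((\<Sum>y\<in>S. Q \<xi> (\<beta> \<xi>) x y * (\<phi> y - \<phi> x)) + \<phi> x * g \<xi> x ?m)"
      by (intro mult_left_mono) auto
    then show "\<beta> \<xi> x * (p x \<bullet> f \<xi> x ?m + \<phi> x * g \<xi> x ?m) - ?e * \<beta> \<xi> x
      \<le> \<beta> \<xi> x * ((\<Sum>y\<in>S. Q \<xi> (\<beta> \<xi>) x y * (\<phi> y - \<phi> x)) + \<phi> x * g \<xi> x ?m)"
      by (simp add: algebra_simps)
  qed
  ultimately have "rate \<phi> p \<xi> ?m - ?e * M \<le> (\<Sum>x\<in>S. \<beta> \<xi> x * ((\<Sum>y\<in>S. Q \<xi> (\<beta> \<xi>) x y * (\<phi> y - \<phi> x)) + \<phi> x * g \<xi> x ?m))"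
    by (simp add: sum_subtractf sum_distrib_left)
  then have "(t - s) * (rate \<phi> p \<xi> ?m - ?e * M) \<le> (\<Sum>x\<in>S. \<beta> t x * \<phi> x) - (\<Sum>x\<in>S. \<beta> s x * \<phi> x)"
    unfolding \<xi>(2) using st by (intro mult_left_mono) auto
  then show ?thesis
    using \<xi>(1) st integral_atomic[OF S \<beta> potential_borel[OF \<phi>], of t] integral_atomic[OF S \<beta> potential_borel[OF \<phi>], of s]
    by (intro bexI[of _ \<xi>]) auto
qed

section \<open>One time step and the stability estimate\<close>

text \<open>One time step. The function \<open>\<phi>\<close>, tested at time \<open>t + h\<close>, is compared with the transported function
\<open>\<psi> x = \<phi> (x + h F x) (1 + h \<gamma> x)\<close>, tested at time \<open>t\<close>. The length \<open>\<delta>\<close> may depend on \<open>\<epsilon>\<close> and \<open>t\<close>, but not on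
\<open>\<phi>\<close>, which allows the passage to the supremum. The curve \<open>n\<close> is only required to satisfy the balance
equation up to an error \<open>E\<close> in the rate, and only as a lower bound for increments.\<close>

lemma discrepancy_step:
  fixes m n :: "real \<Rightarrow> 'a measure"
  assumes moll: "\<And>F :: 'a \<Rightarrow> 'a. mollifiable \<kappa> F" "\<And>F :: 'a \<Rightarrow> real. mollifiable \<kappa> F"
    and \<kappa>: "\<kappa> \<ge> 1" and \<epsilon>: "0 < \<epsilon>" "\<epsilon> \<le> 1" and A_def: "A = \<kappa> / \<epsilon>"
    and X: "compact X" and mc: "PRW_curve X m" and nc: "PRW_curve X n"
    and M: "\<And>t. t \<in> {0..T} \<Longrightarrow> measure (m t) UNIV \<le> M" "\<And>t. t \<in> {0..T} \<Longrightarrow> measure (n t) UNIV \<le> M"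
    and mi: "\<And>\<phi> p s t. potential b A \<phi> p \<Longrightarrow> 0 \<le> s \<Longrightarrow> s \<le> t \<Longrightarrow> t \<le> T \<Longrightarrow>
      ((\<lambda>r. rate \<phi> p r (m r)) has_integral (\<integral>x. \<phi> x \<partial>m t) - (\<integral>x. \<phi> x \<partial>m s)) {s..t}"
    and ni: "\<And>\<phi> p s t. potential b A \<phi> p \<Longrightarrow> 0 \<le> s \<Longrightarrow> s < t \<Longrightarrow> t \<le> T \<Longrightarrow>
      \<exists>\<xi>\<in>{s..t}. (t - s) * (rate \<phi> p \<xi> (n \<xi>) - E) \<le> (\<integral>x. \<phi> x \<partial>n t) - (\<integral>x. \<phi> x \<partial>n s)"
    and t: "0 \<le> t" "t < T" and \<eta>: "\<eta> > 0"
  defines "Df \<equiv> \<lambda>t. discrepancy b A (m t) (n t)"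
  shows "\<exists>\<delta>>0. \<forall>h. 0 < h \<and> h < \<delta> \<and> t + h \<le> T \<longrightarrow>
    Df (t + h) \<le> Df t + h * (transport_growth b Lf Cg Lg * Df t + (E + 2 * (Lf + b * Lg) * M * \<epsilon> + (Lf + b * Lg) * M * PRW b (m t) (n t)) + \<eta>)"
proof -
  have A: "A \<ge> 1" using \<kappa> \<epsilon> by (simp add: A_def)
  have A0: "A \<ge> 0" using A by simp
  have tT: "t \<in> {0..T}" using t by auto
  have mX: "m r \<in> \<M> X" and nX: "n r \<in> \<M> X" if "r \<in> {0..T}" for r
    using mc nc that unfolding PRW_curve_def by blast+
  note mU = fin_measures_UNIV[OF mX] and nU = fin_measures_UNIV[OF nX]
  have M0: "M \<ge> 0" using M(1)[OF tT] measure_nonneg[of "m t" UNIV] by linarith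
  let ?F = "\<lambda>x. f t x (m t)" and ?\<gamma> = "\<lambda>x. g t x (m t)"
  \<comment> \<open>regularize the frozen coefficients at scale \<open>\<epsilon>\<close>\<close>
  obtain F D where F: "\<And>x. norm (F x - ?F x) \<le> Lf * \<epsilon>" "\<And>x y. norm (F x - F y) \<le> Lf * norm (x - y)"
    "\<And>B x. \<forall>x. norm (?F x) \<le> B \<Longrightarrow> norm (F x) \<le> B" and qF: "quad_approx (\<kappa> / \<epsilon> * Lf) F D"
    using mollifiableD[OF moll(1) Lf \<epsilon>(1) lipf_space[OF tT X mX[OF tT]]] by blast
  obtain \<gamma> D' where \<gamma>: "\<And>x. norm (\<gamma> x - ?\<gamma> x) \<le> Lg * \<epsilon>" "\<And>x y. norm (\<gamma> x - \<gamma> y) \<le> Lg * norm (x - y)"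
    "\<And>B x. \<forall>x. norm (?\<gamma> x) \<le> B \<Longrightarrow> norm (\<gamma> x) \<le> B" and q\<gamma>: "quad_approx (\<kappa> / \<epsilon> * Lg) \<gamma> D'"
    using mollifiableD[OF moll(2) Lg \<epsilon>(1) lipg_space[OF tT X mX[OF tT], folded real_norm_def]] by blast
  obtain q where q: "has_quad_gradient (A * Lg) \<gamma> q"
    using quad_approx_real_gradient[OF q\<gamma>] by (auto simp: A_def)
  have Fb: "norm (F x) \<le> Cf" for x using F(3) bdf[OF tT mU[OF tT]] by blast
  have \<gamma>b: "\<bar>\<gamma> x\<bar> \<le> Cg" for x using \<gamma>(3)[of Cg x] bdg[OF tT mU[OF tT]] by simp
  have Fm: "F \<in> borel_measurable borel" and \<gamma>m: "\<gamma> \<in> borel_measurable borel"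
    using lipschitz_borel[OF F(2)] lipschitz_borel[OF \<gamma>(2)] by auto
  define c1 where "c1 = Cg * Cf + (1 + Cg) * (A * Cf\<^sup>2)"
  have c1: "c1 \<ge> 0" using Cf_nonneg Cg_nonneg A by (simp add: c1_def)
  let ?K = "transport_growth b Lf Cg Lg"
  have K0: "?K \<ge> 0" unfolding transport_growth_def using Lf Lg Cg_nonneg b
    by (intro add_nonneg_nonneg mult_nonneg_nonneg) auto
  let ?W = "PRW b (m t) (n t)"
  have "\<eta> / 4 > 0" using \<eta> by simp
  from eventually_conj[OF rate_continuous[OF X mc tT A0 this] rate_continuous[OF X nc tT A0 this]]
  obtain d where d0: "d > 0" and near: "\<And>r. r \<in> {0..T} \<Longrightarrow> r \<noteq> t \<Longrightarrow> dist r t < d \<Longrightarrow>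
      (\<forall>\<phi> p. potential b A \<phi> p \<longrightarrow> \<bar>rate \<phi> p r (m r) - rate \<phi> p t (m t)\<bar> \<le> \<eta> / 4) \<and>
      (\<forall>\<phi> p. potential b A \<phi> p \<longrightarrow> \<bar>rate \<phi> p r (n r) - rate \<phi> p t (n t)\<bar> \<le> \<eta> / 4)"
    unfolding eventually_at by blast
  have d: "\<bar>rate \<phi> p r (m r) - rate \<phi> p t (m t)\<bar> \<le> \<eta> / 4 \<and> \<bar>rate \<phi> p r (n r) - rate \<phi> p t (n t)\<bar> \<le> \<eta> / 4"
    if r: "r \<in> {0..T}" "\<bar>r - t\<bar> < d" and \<phi>: "potential b A \<phi> p" for r \<phi> p
  proof (cases "r = t")
    case True then show ?thesis using \<eta> by simp
  next
    case False then show ?thesis using near[OF r(1)] r(2) \<phi> by (simp add: dist_real_def)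
  qed
  \<comment> \<open>the last entry makes the quadratic errors \<open>h\<^sup>2 c1 M\<close>, one for each measure, at most \<open>h \<eta> / 4\<close>\<close>
  define \<delta> where "\<delta> = min d (min 1 (\<eta> / (4 * (M * c1 + 1))))"
  have Mc: "0 \<le> M * c1" using M0 c1 by simp
  have \<delta>: "\<delta> > 0" using d0 \<eta> Mc by (simp add: \<delta>_def)
  have "Df (t + h) \<le> Df t + h * (?K * Df t + (E + 2 * (Lf + b * Lg) * M * \<epsilon> + (Lf + b * Lg) * M * ?W) + \<eta>)"
    if h: "0 < h" "h < \<delta>" "t + h \<le> T" for h
    unfolding Df_def
  proof (rule discrepancy_least)
    fix \<phi> :: "'a \<Rightarrow> real" and p :: "'a \<Rightarrow> 'a" assume \<phi>: "potential b A \<phi> p"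
    have h1: "h < d" "h \<le> 1" using h by (auto simp: \<delta>_def)
    have small: "h * (M * c1) \<le> \<eta> / 4"
    proof -
      have "h \<le> \<eta> / (4 * (M * c1 + 1))" using h by (simp add: \<delta>_def)
      then have "h * (M * c1 + 1) \<le> \<eta> / 4" using Mc by (simp add: field_simps)
      then show ?thesis using h(1) by (simp add: distrib_left)
    qed
    define km where "km = (\<integral>x. p x \<bullet> F x + \<phi> x * \<gamma> x \<partial>m t)"
    define kn where "kn = (\<integral>x. p x \<bullet> F x + \<phi> x * \<gamma> x \<partial>n t)"
    have inc_m: "(\<integral>x. \<phi> x \<partial>m (t + h)) - (\<integral>x. \<phi> x \<partial>m t) \<le> h * (rate \<phi> p t (m t) + \<eta> / 4)"
    proof -
      have c: "((\<lambda>r. rate \<phi> p t (m t) + \<eta> / 4) has_integral h * (rate \<phi> p t (m t) + \<eta> / 4)) {t..t + h}"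
        using has_integral_const_real[of "rate \<phi> p t (m t) + \<eta> / 4" t "t + h"] h by simp
      show ?thesis
      proof (rule has_integral_le[OF mi[OF \<phi>] c])
        fix r assume "r \<in> {t..t + h}"
        then have "r \<in> {0..T}" "\<bar>r - t\<bar> < d" using t h h1 by auto
        from d[OF this \<phi>] show "rate \<phi> p r (m r) \<le> rate \<phi> p t (m t) + \<eta> / 4" by linarith
      qed (use t h in auto)
    qed
    have inc_n: "h * (rate \<phi> p t (n t) - \<eta> / 4 - E) \<le> (\<integral>x. \<phi> x \<partial>n (t + h)) - (\<integral>x. \<phi> x \<partial>n t)"
    proof -
      obtain \<xi> where \<xi>: "\<xi> \<in> {t..t + h}" "h * (rate \<phi> p \<xi> (n \<xi>) - E) \<le> (\<integral>x. \<phi> x \<partial>n (t + h)) - (\<integral>x. \<phi> x \<partial>n t)"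
        using ni[OF \<phi>, of t "t + h"] t h by auto
      have "\<xi> \<in> {0..T}" "\<bar>\<xi> - t\<bar> < d" using \<xi>(1) t h h1 by auto
      from d[OF this \<phi>] have "rate \<phi> p t (n t) - \<eta> / 4 - E \<le> rate \<phi> p \<xi> (n \<xi>) - E" by linarith
      then have "h * (rate \<phi> p t (n t) - \<eta> / 4 - E) \<le> h * (rate \<phi> p \<xi> (n \<xi>) - E)"
        using h by (intro mult_left_mono) auto
      then show ?thesis using \<xi>(2) by linarith
    qed
    have rate_m: "\<bar>rate \<phi> p t (m t) - km\<bar> \<le> (Lf * \<epsilon> + b * (Lg * \<epsilon>)) * M"
    proof -
      have "\<bar>rate \<phi> p t (m t) - km\<bar> \<le> (Lf * \<epsilon> + b * (Lg * \<epsilon>)) * measure (m t) UNIV"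
        unfolding rate_def km_def
        by (rule rate_change_integrand[OF \<phi> A0 mX[OF tT] X])
          (use F(1) \<gamma>(1) Fb \<gamma>b Fm \<gamma>m Lf Lg \<epsilon> bdf[OF tT mU[OF tT]] bdg[OF tT mU[OF tT]]
            coefficients_borel[OF tT X mX[OF tT]] in \<open>simp_all add: norm_minus_commute abs_minus_commute\<close>)
      also have "\<dots> \<le> (Lf * \<epsilon> + b * (Lg * \<epsilon>)) * M"
        using M(1)[OF tT] Lf Lg \<epsilon> b by (intro mult_left_mono) auto
      finally show ?thesis .
    qed
    have rate_n: "\<bar>rate \<phi> p t (n t) - kn\<bar> \<le> (Lf * (\<epsilon> + ?W) + b * (Lg * (\<epsilon> + ?W))) * M"
    proof -
      have W0: "\<epsilon> + ?W \<ge> 0" using \<epsilon> PRW_nonneg[of b "m t" "n t"] by simp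
      have F': "norm (f t x (n t) - F x) \<le> Lf * (\<epsilon> + ?W)" for x
        using lipf_measure[OF tT mU[OF tT] nU[OF tT], of x] F(1)[of x]
          norm_triangle_ineq[of "f t x (n t) - f t x (m t)" "f t x (m t) - F x"]
        by (simp add: norm_minus_commute distrib_left)
      have \<gamma>': "\<bar>g t x (n t) - \<gamma> x\<bar> \<le> Lg * (\<epsilon> + ?W)" for x
        using lipg_measure[OF tT mU[OF tT] nU[OF tT], of x] \<gamma>(1)[of x]
        by (simp add: distrib_left)
      have "\<bar>rate \<phi> p t (n t) - kn\<bar> \<le> (Lf * (\<epsilon> + ?W) + b * (Lg * (\<epsilon> + ?W))) * measure (n t) UNIV"
        unfolding rate_def kn_def
        by (rule rate_change_integrand[OF \<phi> A0 nX[OF tT] X])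
          (use F' \<gamma>' Fb \<gamma>b Fm \<gamma>m Lf Lg W0 bdf[OF tT nU[OF tT]] bdg[OF tT nU[OF tT]]
            coefficients_borel[OF tT X nX[OF tT]] in simp_all)
      also have "\<dots> \<le> (Lf * (\<epsilon> + ?W) + b * (Lg * (\<epsilon> + ?W))) * M"
        using M(2)[OF tT] Lf Lg W0 b by (intro mult_left_mono) auto
      finally show ?thesis .
    qed
    let ?\<psi> = "\<lambda>x. \<phi> (x + h *\<^sub>R F x) * (1 + h * \<gamma> x)"
    obtain p' where p': "potential b A (\<lambda>x. ?\<psi> x / (1 + h * ?K)) p'"
      using potential_transport[OF \<phi> A _ _ _ _ F(2) Lf q _ \<gamma>b Lg, of h D] b h h1 \<gamma>(2) qF by (auto simp: A_def)
    have l: "1 + h * ?K > 0" using K0 h by (simp add: add_pos_nonneg)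
    have \<psi>m: "?\<psi> \<in> borel_measurable borel"
    proof -
      have "(\<lambda>x. (1 + h * ?K) * (?\<psi> x / (1 + h * ?K))) \<in> borel_measurable borel"
        using potential_borel[OF p'] by (intro borel_measurable_times borel_measurable_const)
      then show ?thesis using l by simp
    qed
    have push: "(\<integral>x. ?\<psi> x \<partial>m t) - (\<integral>x. ?\<psi> x \<partial>n t) \<le> (1 + h * ?K) * Df t"
      using integral_diff_le_discrepancy[OF mU[OF tT] nU[OF tT] p'] l
      by (simp add: Df_def pos_divide_le_eq mult.commute flip: diff_divide_distrib)
    have expand: "\<bar>(\<integral>x. ?\<psi> x \<partial>\<mu>) - (\<integral>x. \<phi> x \<partial>\<mu>) - h * (\<integral>x. p x \<bullet> F x + \<phi> x * \<gamma> x \<partial>\<mu>)\<bar> \<le> h\<^sup>2 * c1 * M"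
      if \<mu>: "\<mu> \<in> \<M> X" "measure \<mu> UNIV \<le> M" for \<mu>
    proof -
      note \<mu>U = fin_measures_UNIV[OF \<mu>(1)]
      have "\<bar>?\<psi> x\<bar> \<le> (1 + h * ?K) * b" for x
        using potentialD(1)[OF p', of x] l by (simp add: pos_divide_le_eq mult.commute)
      then have i1: "integrable \<mu> ?\<psi>" using \<psi>m by (intro fin_measures_integrable[OF \<mu>U]) auto
      have i2: "integrable \<mu> \<phi>"
        by (rule fin_measures_integrable[OF \<mu>U potential_borel[OF \<phi>] potentialD(1)[OF \<phi>]])
      have i3: "integrable \<mu> (\<lambda>x. p x \<bullet> F x + \<phi> x * \<gamma> x)"
        by (rule fin_measures_integrable[OF \<mu>U rate_integrand_borel[OF \<phi> A0 Fm \<gamma>m] integrand_bound[OF \<phi> Fb \<gamma>b]])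
      have "(\<integral>x. ?\<psi> x \<partial>\<mu>) - (\<integral>x. \<phi> x \<partial>\<mu>) - h * (\<integral>x. p x \<bullet> F x + \<phi> x * \<gamma> x \<partial>\<mu>)
         = (\<integral>x. ?\<psi> x - \<phi> x - h * (p x \<bullet> F x + \<phi> x * \<gamma> x) \<partial>\<mu>)"
        using i1 i2 i3 by (simp only: Bochner_Integration.integral_diff integral_mult_right_zero
            Bochner_Integration.integrable_diff integrable_mult_right)
      also have "\<bar>\<dots>\<bar> \<le> (h\<^sup>2 * c1) * measure \<mu> UNIV"
      proof (rule abs_integral_le_mass[OF \<mu>(1) X])
        show "(\<lambda>x. ?\<psi> x - \<phi> x - h * (p x \<bullet> F x + \<phi> x * \<gamma> x)) \<in> borel_measurable borel"
          by (intro borel_measurable_diff borel_measurable_times borel_measurable_const \<psi>m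
              potential_borel[OF \<phi>] rate_integrand_borel[OF \<phi> A0 Fm \<gamma>m])
        show "\<bar>?\<psi> x - \<phi> x - h * (p x \<bullet> F x + \<phi> x * \<gamma> x)\<bar> \<le> h\<^sup>2 * c1" for x
          unfolding c1_def using h h1 by (intro potential_transport_expansion[OF \<phi> A0 _ _ Fb \<gamma>b]) auto
      qed (use c1 in simp)
      also have "\<dots> \<le> (h\<^sup>2 * c1) * M" using \<mu>(2) c1 by (intro mult_left_mono) auto
      finally show ?thesis .
    qed
    have "h\<^sup>2 * c1 * M = h * (h * (M * c1))" by (simp add: power2_eq_square)
    also have "\<dots> \<le> h * (\<eta> / 4)" using small h by (intro mult_left_mono) auto
    finally have sq: "h\<^sup>2 * c1 * M \<le> h * (\<eta> / 4)" .
    have em: "(\<integral>x. \<phi> x \<partial>m t) + h * km \<le> (\<integral>x. ?\<psi> x \<partial>m t) + h * (\<eta> / 4)"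
      using expand[OF mX[OF tT] M(1)[OF tT]] sq unfolding km_def by linarith
    have en: "(\<integral>x. ?\<psi> x \<partial>n t) - h * (\<eta> / 4) \<le> (\<integral>x. \<phi> x \<partial>n t) + h * kn"
      using expand[OF nX[OF tT] M(2)[OF tT]] sq unfolding kn_def by linarith
    have rm: "h * rate \<phi> p t (m t) \<le> h * km + h * ((Lf * \<epsilon> + b * (Lg * \<epsilon>)) * M)"
      using rate_m h unfolding distrib_left[symmetric] by (intro mult_left_mono) auto
    have rn: "h * kn \<le> h * rate \<phi> p t (n t) + h * ((Lf * (\<epsilon> + ?W) + b * (Lg * (\<epsilon> + ?W))) * M)"
      using rate_n h unfolding distrib_left[symmetric] by (intro mult_left_mono) auto
    have "(\<integral>x. \<phi> x \<partial>m (t + h)) - (\<integral>x. \<phi> x \<partial>n (t + h)) \<le> (1 + h * ?K) * Df t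
      + h * ((Lf * \<epsilon> + b * (Lg * \<epsilon>)) * M) + h * ((Lf * (\<epsilon> + ?W) + b * (Lg * (\<epsilon> + ?W))) * M) + h * E + h * \<eta>"
      using inc_m inc_n em en rm rn push by (simp add: distrib_left right_diff_distrib)
    also have "\<dots> = Df t + h * (?K * Df t + (E + 2 * (Lf + b * Lg) * M * \<epsilon> + (Lf + b * Lg) * M * ?W) + \<eta>)"
      by (simp add: algebra_simps)
    finally show "(\<integral>x. \<phi> x \<partial>m (t + h)) - (\<integral>x. \<phi> x \<partial>n (t + h)) \<le> discrepancy b A (m t) (n t)
      + h * (?K * discrepancy b A (m t) (n t) + (E + 2 * (Lf + b * Lg) * M * \<epsilon> + (Lf + b * Lg) * M * ?W) + \<eta>)"
      by (simp only: Df_def)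
  qed (use b A in auto)
  then show ?thesis using \<delta> by blast
qed

definition stability_const :: "real \<Rightarrow> real \<Rightarrow> real" where
  "stability_const \<kappa> M = (let L = Lf + b * Lg in
     exp ((transport_growth b Lf Cg Lg + L * M) * T) * (1 + ((1 + \<kappa>) * M + 2 * L * M + L * M * (8 * M + 1)) * T) + (8 * M + 1))"

lemma stability_const_pos:
  assumes "\<kappa> \<ge> 1" "M \<ge> 0" shows "stability_const \<kappa> M > 0"
  unfolding stability_const_def Let_def using assms b Lf Lg T
  by (intro add_nonneg_pos mult_nonneg_nonneg add_nonneg_nonneg) auto

lemma PRW_curve_tendsto_eventually:
  assumes n: "PRW_curve X n" and t: "t \<in> {0..T}" and e: "e > 0"
  obtains d where "d > 0" "\<And>s. s \<in> {0..T} \<Longrightarrow> s \<noteq> t \<Longrightarrow> \<bar>s - t\<bar> < d \<Longrightarrow> PRW b (n s) (n t) < e"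
proof -
  have "((\<lambda>s. PRW b (n s) (n t)) \<longlongrightarrow> 0) (at t within {0..T})" using n t unfolding PRW_curve_def by blast
  from order_tendstoD(2)[OF this e] that show thesis unfolding eventually_at dist_real_def by blast
qed

text \<open>Insert \<open>PRW \<le> D + (8 M + 1) \<epsilon>\<close> into the one-step estimate, which closes it for the discrepancy \<open>D\<close>, and
apply Gronwall's inequality.\<close>

lemma curve_stability:
  fixes m n :: "real \<Rightarrow> 'a measure"
  assumes moll: "\<And>F :: 'a \<Rightarrow> 'a. mollifiable \<kappa> F" "\<And>F :: 'a \<Rightarrow> real. mollifiable \<kappa> F"
    and \<kappa>: "\<kappa> \<ge> 1" and \<epsilon>: "0 < \<epsilon>" "\<epsilon> \<le> 1"
    and X: "compact X" and mc: "PRW_curve X m" and nc: "PRW_curve X n"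
    and M: "\<And>t. t \<in> {0..T} \<Longrightarrow> measure (m t) UNIV \<le> M" "\<And>t. t \<in> {0..T} \<Longrightarrow> measure (n t) UNIV \<le> M"
    and mi: "\<And>\<phi> p s t. potential b (\<kappa> / \<epsilon>) \<phi> p \<Longrightarrow> 0 \<le> s \<Longrightarrow> s \<le> t \<Longrightarrow> t \<le> T \<Longrightarrow>
      ((\<lambda>r. rate \<phi> p r (m r)) has_integral (\<integral>x. \<phi> x \<partial>m t) - (\<integral>x. \<phi> x \<partial>m s)) {s..t}"
    and ni: "\<And>\<phi> p s t. potential b (\<kappa> / \<epsilon>) \<phi> p \<Longrightarrow> 0 \<le> s \<Longrightarrow> s < t \<Longrightarrow> t \<le> T \<Longrightarrow>
      \<exists>\<xi>\<in>{s..t}. (t - s) * (rate \<phi> p \<xi> (n \<xi>) - (1 + \<kappa>) * M * \<epsilon>) \<le> (\<integral>x. \<phi> x \<partial>n t) - (\<integral>x. \<phi> x \<partial>n s)"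
    and t: "t \<in> {0..T}"
  shows "PRW b (m t) (n t) \<le> stability_const \<kappa> M * (\<epsilon> + PRW b (m 0) (n 0))"
proof -
  define A where "A = \<kappa> / \<epsilon>"
  have A: "A \<ge> 0" using \<kappa> \<epsilon> by (simp add: A_def)
  have mX: "m r \<in> \<M> X" and nX: "n r \<in> \<M> X" if "r \<in> {0..T}" for r
    using mc nc that unfolding PRW_curve_def by blast+
  note mU = fin_measures_UNIV[OF mX] and nU = fin_measures_UNIV[OF nX]
  have M0: "M \<ge> 0" using M(1)[OF t] measure_nonneg[of "m t" UNIV] by linarith
  define L where "L = Lf + b * Lg"
  have L0: "L \<ge> 0" using Lf Lg b by (simp add: L_def)
  define K where "K = transport_growth b Lf Cg Lg"
  have K0: "K \<ge> 0" unfolding K_def transport_growth_def using Lf Lg Cg_nonneg b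
    by (intro add_nonneg_nonneg mult_nonneg_nonneg) auto
  define B where "B = (1 + \<kappa>) * M + 2 * L * M + L * M * (8 * M + 1)"
  have B0: "B \<ge> 0" unfolding B_def using \<kappa> M0 L0 by (intro add_nonneg_nonneg mult_nonneg_nonneg) auto
  define D where "D r = discrepancy b A (m r) (n r)" for r
  have W: "PRW b (m r) (n r) \<le> D r + (8 * M + 1) * \<epsilon>" if r: "r \<in> {0..T}" for r
    unfolding D_def A_def
    by (rule PRW_le_discrepancy[OF moll(2) X mX[OF r] nX[OF r] _ \<epsilon>(1) M(1)[OF r] M(2)[OF r]]) (use b in simp)
  have D0: "D r \<ge> 0" if r: "r \<in> {0..T}" for r
    unfolding D_def using discrepancy_nonneg[OF mU[OF r] nU[OF r]] b A by simp
  have zero: "0 \<in> {0..T}" using T by simp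
  have "D t \<le> (D 0 + B * \<epsilon> * t) * exp ((K + L * M) * t)"
  proof (rule dini_gronwall)
    fix t \<eta> :: real assume t: "0 \<le> t" "t < T" and \<eta>: "\<eta> > 0"
    have tT: "t \<in> {0..T}" using t by auto
    obtain \<delta> where \<delta>: "\<delta> > 0" and step: "\<And>h. 0 < h \<Longrightarrow> h < \<delta> \<Longrightarrow> t + h \<le> T \<Longrightarrow>
      D (t + h) \<le> D t + h * (K * D t + ((1 + \<kappa>) * M * \<epsilon> + 2 * L * M * \<epsilon> + L * M * PRW b (m t) (n t)) + \<eta>)"
      using discrepancy_step[OF moll \<kappa> \<epsilon> A_def X mc nc M mi[folded A_def] ni[folded A_def] t \<eta>]
      unfolding D_def[symmetric] K_def[symmetric] L_def[symmetric] by blast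
    have "D (t + h) \<le> D t + h * ((K + L * M) * D t + B * \<epsilon> + \<eta>)" if h: "0 < h" "h < \<delta>" "t + h \<le> T" for h
    proof -
      have "L * M * PRW b (m t) (n t) \<le> L * M * (D t + (8 * M + 1) * \<epsilon>)"
        using W[OF tT] L0 M0 by (intro mult_left_mono) auto
      then have "K * D t + ((1 + \<kappa>) * M * \<epsilon> + 2 * L * M * \<epsilon> + L * M * PRW b (m t) (n t)) + \<eta>
          \<le> (K + L * M) * D t + B * \<epsilon> + \<eta>"
        by (simp add: B_def algebra_simps)
      from mult_left_mono[OF this, of h] step[OF h] h(1) show ?thesis by linarith
    qed
    then show "\<exists>\<delta>>0. \<forall>h. 0 < h \<and> h < \<delta> \<and> t + h \<le> T \<longrightarrow> D (t + h) \<le> D t + h * ((K + L * M) * D t + B * \<epsilon> + \<eta>)"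
      using \<delta> by blast
  next
    fix t \<eta> :: real assume t: "0 < t" "t \<le> T" and \<eta>: "\<eta> > 0"
    have tT: "t \<in> {0..T}" using t by auto
    have e: "\<eta> / 4 > 0" using \<eta> by simp
    obtain d1 where d1: "d1 > 0" "\<And>s. s \<in> {0..T} \<Longrightarrow> s \<noteq> t \<Longrightarrow> \<bar>s - t\<bar> < d1 \<Longrightarrow> PRW b (m s) (m t) < \<eta> / 4"
      using PRW_curve_tendsto_eventually[OF mc tT e] by blast
    obtain d2 where d2: "d2 > 0" "\<And>s. s \<in> {0..T} \<Longrightarrow> s \<noteq> t \<Longrightarrow> \<bar>s - t\<bar> < d2 \<Longrightarrow> PRW b (n s) (n t) < \<eta> / 4"
      using PRW_curve_tendsto_eventually[OF nc tT e] by blast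
    have "D t \<le> D s + \<eta>" if s: "0 \<le> s" "t - min d1 d2 < s" "s < t" for s
    proof -
      have sT: "s \<in> {0..T}" using s t by auto
      have "D t \<le> D s + 2 * PRW b (m s) (m t) + 2 * PRW b (n s) (n t)"
        unfolding D_def by (rule discrepancy_le_perturb[OF mU[OF tT] nU[OF tT] mU[OF sT] nU[OF sT] b A])
      moreover have "PRW b (m s) (m t) < \<eta> / 4" using s by (intro d1(2)[OF sT]) auto
      moreover have "PRW b (n s) (n t) < \<eta> / 4" using s by (intro d2(2)[OF sT]) auto
      ultimately show ?thesis by linarith
    qed
    then show "\<exists>\<delta>>0. \<forall>s. 0 \<le> s \<and> t - \<delta> < s \<and> s < t \<longrightarrow> D t \<le> D s + \<eta>"
      using d1(1) d2(1) by (intro exI[of _ "min d1 d2"]) simp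
  qed (use t K0 L0 M0 B0 \<epsilon> D0[OF zero] in auto)
  also have "\<dots> \<le> (PRW b (m 0) (n 0) + B * \<epsilon> * T) * exp ((K + L * M) * T)"
  proof (rule mult_mono)
    have "D 0 \<le> PRW b (m 0) (n 0)"
      unfolding D_def using b by (intro discrepancy_le_PRW mU[OF zero] nU[OF zero] A) auto
    moreover have "B * \<epsilon> * t \<le> B * \<epsilon> * T" using t B0 \<epsilon> by (intro mult_left_mono) auto
    ultimately show "D 0 + B * \<epsilon> * t \<le> PRW b (m 0) (n 0) + B * \<epsilon> * T" by simp
    show "0 \<le> PRW b (m 0) (n 0) + B * \<epsilon> * T" using PRW_nonneg[of b "m 0" "n 0"] B0 \<epsilon> T by simp
    have "(K + L * M) * t \<le> (K + L * M) * T" using t K0 L0 M0 by (intro mult_left_mono) auto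
    then show "exp ((K + L * M) * t) \<le> exp ((K + L * M) * T)" by simp
  qed simp
  also have "\<dots> \<le> (\<epsilon> + PRW b (m 0) (n 0)) * (1 + B * T) * exp ((K + L * M) * T)"
    using PRW_nonneg[of b "m 0" "n 0"] B0 \<epsilon> T by (intro mult_right_mono) (auto simp: algebra_simps)
  finally have "D t \<le> (\<epsilon> + PRW b (m 0) (n 0)) * (1 + B * T) * exp ((K + L * M) * T)" .
  moreover have "(8 * M + 1) * \<epsilon> \<le> (8 * M + 1) * (\<epsilon> + PRW b (m 0) (n 0))"
    using PRW_nonneg[of b "m 0" "n 0"] M0 by (intro mult_left_mono) auto
  ultimately have "PRW b (m t) (n t) \<le> (\<epsilon> + PRW b (m 0) (n 0)) * (1 + B * T) * exp ((K + L * M) * T) + (8 * M + 1) * (\<epsilon> + PRW b (m 0) (n 0))"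
    using W[OF t] by linarith
  also have "\<dots> = stability_const \<kappa> M * (\<epsilon> + PRW b (m 0) (n 0))"
    by (simp add: stability_const_def Let_def B_def K_def L_def algebra_simps)
  finally show ?thesis .
qed

text \<open>With the quadratic constant \<open>A = \<kappa> / \<epsilon>\<close>, the generator error \<open>\<epsilon> + A \<epsilon>\<^sup>2\<close> equals \<open>(1 + \<kappa>) \<epsilon>\<close>.\<close>

lemma markov_chain_approximation:
  assumes moll: "\<And>F :: 'a \<Rightarrow> 'a. mollifiable \<kappa> F" "\<And>F :: 'a \<Rightarrow> real. mollifiable \<kappa> F"
    and \<kappa>: "\<kappa> \<ge> 1" and \<epsilon>: "0 < \<epsilon>" "\<epsilon> \<le> 1" and c: "c > 0"
    and K: "compact K" and S: "finite S"
    and kol: "\<And>t. t \<in> {0..T} \<Longrightarrow> kolmogorov_matrix S (Q t (\<beta> t))"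
    and drift: "\<And>t x. t \<in> {0..T} \<Longrightarrow> x \<in> S \<Longrightarrow> norm (f t x (\<I> S (\<beta> t)) - (\<Sum>y\<in>S. Q t (\<beta> t) x y *\<^sub>R (y - x))) \<le> \<epsilon>"
    and var: "\<And>t x. t \<in> {0..T} \<Longrightarrow> x \<in> S \<Longrightarrow> (\<Sum>y\<in>S. (norm (x - y))\<^sup>2 * Q t (\<beta> t) x y) \<le> \<epsilon>\<^sup>2"
    and ode: "ode_solution T S Q g \<beta>" and \<beta>0: "l1_norm S (\<beta> 0) \<le> c"
    and weak: "weak_solution T b f g (m 0) m" and mK: "\<And>t. t \<in> {0..T} \<Longrightarrow> m t \<in> \<M> K"
    and m0: "measure (m 0) UNIV \<le> c" and t: "t \<in> {0..T}"
  shows "PRW b (m t) (\<I> S (\<beta> t)) \<le> stability_const \<kappa> (c * exp (Cg * T)) * (\<epsilon> + PRW b (m 0) (\<I> S (\<beta> 0)))"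
proof -
  let ?M = "c * exp (Cg * T)"
  have \<beta>: "\<beta> r \<in> l1_plus S" if "r \<in> {0..T}" for r using ode that by (simp add: ode_solution_def)
  have A: "\<kappa> / \<epsilon> \<ge> 0" using \<kappa> \<epsilon> by simp
  have grow: "u \<le> ?M" if "u \<le> v * exp (Cg * r)" "v \<le> c" "r \<in> {0..T}" for u v r
  proof -
    have "v * exp (Cg * r) \<le> c * exp (Cg * r)" using that by (intro mult_right_mono) auto
    also have "\<dots> \<le> ?M" using that c Cg_nonneg by (intro mult_left_mono) (auto intro: mult_left_mono)
    finally show ?thesis using that(1) by linarith
  qed
  have Mm: "measure (m r) UNIV \<le> ?M" if r: "r \<in> {0..T}" for r
    using weak_solution_mass[OF weak mK K, of r] r m0 by (intro grow[OF _ _ r]) auto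
  have "(\<Sum>x\<in>S. \<beta> 0 x) \<le> c"
    unfolding l1_norm_def using order_trans[OF sum_mono \<beta>0[unfolded l1_norm_def], of "\<beta> 0"] by simp
  then have M\<beta>: "(\<Sum>x\<in>S. \<beta> r x) \<le> ?M" if r: "r \<in> {0..T}" for r
    using ode_solution_mass[OF S ode kol, of r] r by (intro grow[OF _ _ r]) auto
  have closed: "K \<in> sets borel" using K by (simp add: compact_imp_closed)
  show ?thesis
  proof (rule curve_stability[OF moll \<kappa> \<epsilon>, of "K \<union> S" m "\<lambda>t. \<I> S (\<beta> t)"])
    show "compact (K \<union> S)" using K S by (simp add: compact_Un finite_imp_compact)
    have "m r \<in> \<M> (K \<union> S)" if "r \<in> {0..T}" for r
      by (rule fin_measures_mono[OF mK[OF that] _ closed]) simp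
    then show "PRW_curve (K \<union> S) m"
      using weak[unfolded weak_solution_def, THEN conjunct2, THEN conjunct1] by (simp add: PRW_curve_def)
    show "PRW_curve (K \<union> S) (\<lambda>t. \<I> S (\<beta> t))" by (rule ode_solution_PRW_curve[OF S ode]) simp
    show "measure (\<I> S (\<beta> r)) UNIV \<le> ?M" if "r \<in> {0..T}" for r
      using M\<beta>[OF that] measure_atomic_UNIV[OF S \<beta>[OF that]] by simp
    fix \<phi> :: "'a \<Rightarrow> real" and p s t assume \<phi>: "potential b (\<kappa> / \<epsilon>) \<phi> p"
    show "((\<lambda>r. rate \<phi> p r (m r)) has_integral (\<integral>x. \<phi> x \<partial>m t) - (\<integral>x. \<phi> x \<partial>m s)) {s..t}"
      if "0 \<le> s" "s \<le> t" "t \<le> T"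
      by (rule weak_solution_increment[OF weak mK K \<phi> A that])
    have eq: "(\<epsilon> + \<kappa> / \<epsilon> * \<epsilon>\<^sup>2) * ?M = (1 + \<kappa>) * ?M * \<epsilon>" using \<epsilon> by (simp add: power2_eq_square algebra_simps)
    show "\<exists>\<xi>\<in>{s..t}. (t - s) * (rate \<phi> p \<xi> (\<I> S (\<beta> \<xi>)) - (1 + \<kappa>) * ?M * \<epsilon>) \<le> (\<integral>x. \<phi> x \<partial>(\<I> S (\<beta> t))) - (\<integral>x. \<phi> x \<partial>(\<I> S (\<beta> s)))"
      if "0 \<le> s" "s < t" "t \<le> T"
      using ode_increment[OF S ode kol drift var M\<beta> \<phi> A less_imp_le[OF \<epsilon>(1)] that] unfolding eq .
  qed (use Mm t in auto)
qed

end

lemma PRW_lipschitz_mono: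
  fixes h :: "real \<Rightarrow> 'a::euclidean_space \<Rightarrow> 'a measure \<Rightarrow> 'b::real_normed_vector"
  assumes "PRW_lipschitz T b L h" "L \<le> L'" shows "PRW_lipschitz T b L' h"
  unfolding PRW_lipschitz_def
proof (intro ballI allI)
  fix t x1 x2 and m1 m2 :: "'a measure" assume "t \<in> {0..T}" "m1 \<in> \<M> UNIV" "m2 \<in> \<M> UNIV"
  then have "norm (h t x1 m1 - h t x2 m2) \<le> L * (norm (x1 - x2) + PRW b m1 m2)"
    using assms(1) by (simp add: PRW_lipschitz_def)
  also have "\<dots> \<le> L' * (norm (x1 - x2) + PRW b m1 m2)"
    using assms(2) PRW_nonneg[of b m1 m2] by (intro mult_right_mono) auto
  finally show "norm (h t x1 m1 - h t x2 m2) \<le> L' * (norm (x1 - x2) + PRW b m1 m2)" .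
qed

theorem theorem7p2:
  fixes T b c :: real
    and K :: "(real ^ 'd) set"
    and f :: "real \<Rightarrow> real ^ 'd \<Rightarrow> (real ^ 'd) measure \<Rightarrow> real ^ 'd"
    and g :: "real \<Rightarrow> real ^ 'd \<Rightarrow> (real ^ 'd) measure \<Rightarrow> real"
  assumes "T > 0" and "compact K" and "b > diameter K + 1"
    and "standing_assumptions T b K f g"
    and "c > 0"
  shows "\<exists>C>0. \<forall>\<epsilon> (S :: (real ^ 'd) set) Q \<beta>\<^sub>0 m\<^sub>0 \<beta> m.
    0 < \<epsilon> \<and> \<epsilon> \<le> 1 \<and> finite S \<and> diameter (K \<union> S) \<le> diameter K + 1 \<and>
    (\<forall>t\<in>{0..T}. \<forall>\<gamma>\<in>l1_plus S. kolmogorov_matrix S (Q t \<gamma>)) \<and>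
    (\<forall>x\<in>K. \<exists>y\<in>S. norm (x - y) \<le> \<epsilon>) \<and>
    (\<forall>t\<in>{0..T}. \<forall>x\<in>S. \<forall>\<gamma>\<in>l1_plus S.
       norm (f t x (\<I> S \<gamma>) - (\<Sum>y\<in>S. Q t \<gamma> x y *\<^sub>R (y - x))) \<le> \<epsilon>) \<and>
    (\<forall>t\<in>{0..T}. \<forall>x\<in>S. \<forall>\<gamma>\<in>l1_plus S. (\<Sum>y\<in>S. (norm (x - y))\<^sup>2 * Q t \<gamma> x y) \<le> \<epsilon>\<^sup>2) \<and>
    \<beta>\<^sub>0 \<in> l1_plus S \<and> l1_norm S \<beta>\<^sub>0 \<le> c \<and>
    m\<^sub>0 \<in> \<M> K \<and> measure m\<^sub>0 UNIV \<le> c \<and>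
    ode_solution T S Q g \<beta> \<and> \<beta> 0 = \<beta>\<^sub>0 \<and>
    weak_solution T b f g m\<^sub>0 m \<and> (\<forall>t\<in>{0..T}. m t \<in> \<M> K) \<and> m 0 = m\<^sub>0
    \<longrightarrow> (\<forall>t\<in>{0..T}. PRW b (m t) (\<I> S (\<beta> t)) \<le> C * (\<epsilon> + PRW b m\<^sub>0 (\<I> S \<beta>\<^sub>0)))"
proof -
  note sa = assms(4)[unfolded standing_assumptions_def]
  obtain Lf Lg where lip: "PRW_lipschitz T b Lf f" "PRW_lipschitz T b Lg g" using sa by blast
  obtain Cf Cg where bd: "\<forall>t\<in>{0..T}. \<forall>x. \<forall>m\<in>\<M> UNIV. norm (f t x m) \<le> Cf"
      "\<forall>t\<in>{0..T}. \<forall>x. \<forall>m\<in>\<M> UNIV. \<bar>g t x m\<bar> \<le> Cg" using sa by blast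
  have b: "b > 0" using assms(3) diameter_ge_0[OF compact_imp_bounded[OF assms(2)]] by linarith
  interpret balance_coefficients T b "\<bar>Lf\<bar>" "\<bar>Lg\<bar>" Cf Cg f g
    by unfold_locales (use assms(1) b sa bd lip in \<open>auto intro: PRW_lipschitz_mono\<close>)
  obtain \<kappa>1 :: real where k1: "\<And>F :: real ^ 'd \<Rightarrow> real ^ 'd. mollifiable \<kappa>1 F" using mollification by blast
  obtain \<kappa>2 :: real where k2: "\<And>F :: real ^ 'd \<Rightarrow> real. mollifiable \<kappa>2 F" using mollification by blast
  define \<kappa> where "\<kappa> = max 1 (max \<kappa>1 \<kappa>2)"
  have \<kappa>: "\<kappa> \<ge> 1" by (simp add: \<kappa>_def)
  have moll: "mollifiable \<kappa> F" "mollifiable \<kappa> F'" for F :: "real ^ 'd \<Rightarrow> real ^ 'd" and F' :: "real ^ 'd \<Rightarrow> real"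
    by (rule mollifiable_mono[OF k1] mollifiable_mono[OF k2], simp add: \<kappa>_def)+
  let ?C = "stability_const \<kappa> (c * exp (Cg * T))"
  show ?thesis
  proof (intro exI[of _ ?C] conjI allI impI ballI)
    show "?C > 0" using assms(5) by (intro stability_const_pos \<kappa>) simp
    fix \<epsilon> S Q \<beta>\<^sub>0 m\<^sub>0 \<beta> m t
    assume H: "0 < \<epsilon> \<and> \<epsilon> \<le> 1 \<and> finite S \<and> diameter (K \<union> S) \<le> diameter K + 1 \<and>
    (\<forall>t\<in>{0..T}. \<forall>\<gamma>\<in>l1_plus S. kolmogorov_matrix S (Q t \<gamma>)) \<and>
    (\<forall>x\<in>K. \<exists>y\<in>S. norm (x - y) \<le> \<epsilon>) \<and>
    (\<forall>t\<in>{0..T}. \<forall>x\<in>S. \<forall>\<gamma>\<in>l1_plus S.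
       norm (f t x (\<I> S \<gamma>) - (\<Sum>y\<in>S. Q t \<gamma> x y *\<^sub>R (y - x))) \<le> \<epsilon>) \<and>
    (\<forall>t\<in>{0..T}. \<forall>x\<in>S. \<forall>\<gamma>\<in>l1_plus S. (\<Sum>y\<in>S. (norm (x - y))\<^sup>2 * Q t \<gamma> x y) \<le> \<epsilon>\<^sup>2) \<and>
    \<beta>\<^sub>0 \<in> l1_plus S \<and> l1_norm S \<beta>\<^sub>0 \<le> c \<and>
    m\<^sub>0 \<in> \<M> K \<and> measure m\<^sub>0 UNIV \<le> c \<and>
    ode_solution T S Q g \<beta> \<and> \<beta> 0 = \<beta>\<^sub>0 \<and>
    weak_solution T b f g m\<^sub>0 m \<and> (\<forall>t\<in>{0..T}. m t \<in> \<M> K) \<and> m 0 = m\<^sub>0"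
      and t: "t \<in> {0..T}"
    then have \<beta>: "\<beta> r \<in> l1_plus S" if "r \<in> {0..T}" for r using that by (simp add: ode_solution_def)
    have "PRW b (m t) (\<I> S (\<beta> t)) \<le> ?C * (\<epsilon> + PRW b (m 0) (\<I> S (\<beta> 0)))"
      by (rule markov_chain_approximation[OF moll \<kappa> _ _ assms(5,2) _ _ _ _ _ _ _ _ _ t, where Q = Q])
        (use H \<beta> in auto)
    then show "PRW b (m t) (\<I> S (\<beta> t)) \<le> ?C * (\<epsilon> + PRW b m\<^sub>0 (\<I> S \<beta>\<^sub>0))" using H by simp
  qed
qed

end
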